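(* Let $\alpha>-1$ with $\alpha\neq 0$, and let $u$ be an $\alpha$-harmonic function in $\mathbb{H}$ which is of temperate growth at infinity. Assume that (1) $u(z)\to 0$ as $\mathbb{H}\ni z\to x$ for every $x\in\mathbb{R}$; and (2) there exists a sequence $\{z_j\}$ in $\mathbb{H}$ with $z_j\to\infty$ in $\mathbb{C}_\infty$ as $j\to\infty$ such that $$\lim_{j\to\infty}\frac{u(z_j)}{(\operatorname{Im} z_j)^{\alpha+1}}=0.$$ Then $u(z)=0$ for all $z\in\mathbb{H}$.
   Context: $\mathbb{H}=\{z\in\mathbb{C}:\operatorname{Im} z>0\}$ is the open upper half-plane and $\mathbb{C}_\infty=\mathbb{C}\cup\{\infty\}$ is the extended complex plane. Functions are complex-valued. $\partial_z$ and $\bar\partial_z$ are the usual complex partial derivatives, $\partial_z=\frac12(\partial_x-i\partial_y)$, $\bar\partial_z=\frac12(\partial_x+i\partial_y)$ for $z=x+iy$. For $\alpha>-1$, a function $u\in C^2(\mathbb{H})$ is called $\alpha$-harmonic in $\mathbb{H}$ if $\partial_z\big((\operatorname{Im} z)^{-\alpha}\,\bar\partial_z u(z)\big)=0$ for all $z\in\mathbb{H}$. A function $u$ in $\mathbb{H}$ is of temperate growth at infinity if there are positive constants $C,R,N$ such that $|u(z)|\leq C\,(|z|^2/\operatorname{Im} z)^N$ for all $z\in\mathbb{H}$ with $|z|>R$. *)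

theory Defs
  imports "HOL-Analysis.Analysis"
begin

definition upper_half_plane :: "complex set" where
  "upper_half_plane = {z. Im z > 0}"

definition partial_x :: "(complex \<Rightarrow> complex) \<Rightarrow> complex \<Rightarrow> complex" where
  "partial_x f z = vector_derivative (\<lambda>t::real. f (z + of_real t)) (at 0)"

definition partial_y :: "(complex \<Rightarrow> complex) \<Rightarrow> complex \<Rightarrow> complex" where
  "partial_y f z = vector_derivative (\<lambda>t::real. f (z + \<i> * of_real t)) (at 0)"

definition d_z :: "(complex \<Rightarrow> complex) \<Rightarrow> complex \<Rightarrow> complex" where
  "d_z f z = (partial_x f z - \<i> * partial_y f z) / 2"

definition dbar_z :: "(complex \<Rightarrow> complex) \<Rightarrow> complex \<Rightarrow> complex" where
  "dbar_z f z = (partial_x f z + \<i> * partial_y f z) / 2"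

(* Continuous differentiability is meant over the reals: differentiable is Frechet
   differentiability with a real-linear derivative, and continuity of the derivative
   is continuity of the two partial derivatives. The set is meant to be open. *)
definition C1_on :: "complex set \<Rightarrow> (complex \<Rightarrow> complex) \<Rightarrow> bool" where
  "C1_on S f \<longleftrightarrow>
     (\<forall>z\<in>S. f differentiable (at z)) \<and>
     continuous_on S (partial_x f) \<and> continuous_on S (partial_y f)"

definition C2_on :: "complex set \<Rightarrow> (complex \<Rightarrow> complex) \<Rightarrow> bool" where
  "C2_on S f \<longleftrightarrow> C1_on S f \<and> C1_on S (partial_x f) \<and> C1_on S (partial_y f)"

definition alpha_harmonic :: "real \<Rightarrow> (complex \<Rightarrow> complex) \<Rightarrow> bool" where
  "alpha_harmonic \<alpha> u \<longleftrightarrow>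
     C2_on upper_half_plane u \<and>
     (\<forall>z\<in>upper_half_plane.
        d_z (\<lambda>w. of_real (Im w powr (- \<alpha>)) * dbar_z u w) z = 0)"

definition temperate_growth_at_infinity :: "(complex \<Rightarrow> complex) \<Rightarrow> bool" where
  "temperate_growth_at_infinity u \<longleftrightarrow>
     (\<exists>C R N :: real. C > 0 \<and> R > 0 \<and> N > 0 \<and>
        (\<forall>z\<in>upper_half_plane. cmod z > R \<longrightarrow>
           cmod (u z) \<le> C * ((cmod z)\<^sup>2 / Im z) powr N))"

end

theory Submission
  imports Defs "HOL-Complex_Analysis.Complex_Analysis" "HOL-Real_Asymp.Real_Asymp"
begin

text \<open>
  Write $\bar\partial u = y^\alpha \overline{F}$ with $F$ holomorphic in the upper half-plane, and
  $G(s) = \overline{F(\bar s)}$ in the lower one. The function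
  $E(z) = \int_0^1 t^\alpha G((1-t) z - i t)\, dt$ is holomorphic in the lower half-plane, while
  $h(z) = \int_{-i}^{\bar z} (z - s)^\alpha G(s)\, ds - (2i)^\alpha u(z)$ is holomorphic in the upper one. Because $u$
  vanishes on the real line, $(z+i)^{\alpha+1} E(z)$ and $h(z)$ have the same boundary values there, so $E$ extends to an
  entire function; the temperate growth of $u$ makes it a polynomial. The Taylor coefficients of $E$ and $G$
  at $-i$ differ by nonzero factors, hence $F$ is a polynomial. Consequently $u$ is $y^{\alpha+1}$ times a finite
  combination of the homogeneous polynomials
  $\sum_{m \le k} \frac{(\alpha+1)_m}{m!} \bar z^m z^{k-m}$. For $\alpha \neq 0$ the one of degree $k$ is bounded
  below by a multiple of $|z|^k$ (Enestroem--Kakeya), so the combination cannot tend to $0$ along a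
  sequence going to infinity unless it is trivial.
\<close>

section \<open>Temperate entire functions and gluing across the real line\<close>

text \<open>Near the real line \<open>F\<close> is only known to be o(y^(-\<alpha>-1)), which for
  \<alpha> \<ge> 0 need not be integrable, so \<open>F\<close> cannot be continued across the line
  directly. Averaging with weight t^\<alpha> along segments is a fractional integration of order
  \<alpha>+1 and removes this singularity up to an arbitrarily small power. The partner
  \<open>h\<close> arises by replacing the kernel (cnj z - s)^\<alpha> by (z - s)^\<alpha> on the
  same path. The difference of the two integrals has a scale invariant majorant: it would stay
  bounded for F = O(y^(-\<alpha>-1)) and tends to 0 because \<open>F\<close> is o of this. That is
  where the zero boundary values enter. The base point -\<i> is the common fixed point of the maps z
  -> (1-t) z - \<i> t, which makes the passage from \<open>G\<close> to \<open>E\<close> diagonal on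
  Taylor coefficients there. Once \<open>F\<close> is a polynomial, \<open>u\<close> is recovered
  from it: a combination of explicit solutions has the same dbar derivative and zero boundary
  values, so it differs from \<open>u\<close> by a holomorphic function vanishing on the real
  line.\<close>

text \<open>
  Multiplying by $(z^2 - r^2)^N$ on the circle $|z| = r$, where $|z^2 - r^2| = 2 r |\mathrm{Im}\, z|$,
  removes the singular growth at the real line before the maximum principle is applied.
\<close>

lemma higher_deriv_0_temperate:
  assumes holf: "f holomorphic_on UNIV" and "C \<ge> 0"
    and bnd: "\<And>z. Im z \<noteq> 0 \<Longrightarrow> cmod (f z) \<le> C * (1 + cmod z) ^ A / \<bar>Im z\<bar> ^ N"
    and "n > A" "N > 0"
  shows "(deriv ^^ n) f w = 0"
proof -
  have bnd1: "cmod (f z) \<le> C * 4 ^ N * (1 + r) ^ A" if r: "r \<ge> 1" "2 * cmod z \<le> r" for z r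
  proof -
    let ?g = "\<lambda>z. f z * (z\<^sup>2 - (of_real r)\<^sup>2) ^ N"
    have "cmod (?g x) \<le> C * (1 + r) ^ A * (2 * r) ^ N" if "x \<in> sphere 0 r" for x
    proof (cases "Im x = 0")
      case True
      have "x\<^sup>2 = (of_real r)\<^sup>2"
      proof -
        have x: "x = of_real (Re x)" using True by (simp add: complex_eq_iff)
        have "\<bar>Re x\<bar> = r" using that True by (simp add: cmod_def)
        then have "(Re x)\<^sup>2 = r\<^sup>2" by (metis power2_abs)
        then show ?thesis by (metis x of_real_power)
      qed
      then show ?thesis using r \<open>C \<ge> 0\<close> \<open>N > 0\<close> by (simp add: power_0_left)
    next
      case False
      have rx: "cmod x = r" using that by simp
      have "x\<^sup>2 - (of_real r)\<^sup>2 = x * (x - cnj x)"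
        using complex_norm_square[of x] rx by (simp add: power2_eq_square algebra_simps)
      also have "cmod \<dots> = r * (2 * \<bar>Im x\<bar>)"
        by (simp add: complex_diff_cnj norm_mult rx)
      finally have "cmod (?g x) = cmod (f x) * ((2 * r) ^ N * \<bar>Im x\<bar> ^ N)"
        by (simp add: norm_mult norm_power power_mult_distrib mult_ac)
      also have "\<dots> \<le> (C * (1 + r) ^ A / \<bar>Im x\<bar> ^ N) * ((2 * r) ^ N * \<bar>Im x\<bar> ^ N)"
        using bnd[OF False] r by (intro mult_right_mono) (auto simp: rx)
      also have "\<dots> = C * (1 + r) ^ A * (2 * r) ^ N" using False by simp
      finally show ?thesis .
    qed
    note sph = this
    have gz: "cmod (?g z) \<le> C * (1 + r) ^ A * (2 * r) ^ N"
    proof (rule maximum_modulus_frontier[of ?g "cball 0 r"])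
      have "f holomorphic_on cball 0 r" using holf holomorphic_on_subset by blast
      then have g: "?g holomorphic_on cball 0 r" by (intro holomorphic_intros)
      then show "?g holomorphic_on interior (cball 0 r)"
        by (rule holomorphic_on_subset) (rule interior_subset)
      show "continuous_on (closure (cball 0 r)) ?g"
        using holomorphic_on_imp_continuous_on[OF g] by simp
      show "bounded (cball (0::complex) r)" by simp
      show "cmod (?g x) \<le> C * (1 + r) ^ A * (2 * r) ^ N" if "x \<in> frontier (cball 0 r)" for x
        using that r by (intro sph) simp
      show "z \<in> cball 0 r" using r by simp
    qed
    have gl: "(r\<^sup>2 / 2) ^ N \<le> cmod ((z\<^sup>2 - (of_real r)\<^sup>2) ^ N)"
    proof -
      have "(cmod z)\<^sup>2 \<le> (r/2)\<^sup>2" using r by (intro power_mono) auto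
      then have "r\<^sup>2 / 2 \<le> r\<^sup>2 - (cmod z)\<^sup>2" using zero_le_power2[of r] unfolding power_divide by (simp only: power2_eq_square)
      also have "\<dots> \<le> cmod (z\<^sup>2 - (of_real r)\<^sup>2)"
        using norm_triangle_ineq2[of "(of_real r)\<^sup>2" "z\<^sup>2"] by (simp add: norm_power norm_minus_commute)
      finally show ?thesis by (simp add: norm_power power_mono)
    qed
    have "cmod (f z) * (r\<^sup>2 / 2) ^ N \<le> cmod (?g z)"
      unfolding norm_mult by (intro mult_left_mono gl) simp
    also have "\<dots> \<le> C * (1 + r) ^ A * (2 * r) ^ N" by (rule gz)
    \<comment> \<open>The weaker bound with \<open>2 * r\<^sup>2\<close> suffices:
      \<open>(r\<^sup>2 / 2) ^ N\<close> cancels against it exactly, leaving the constant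
      \<open>4 ^ N\<close> and only the power \<open>A\<close> of 1 + r.\<close>
    also have "\<dots> \<le> C * (1 + r) ^ A * (2 * r\<^sup>2) ^ N"
      using r \<open>C \<ge> 0\<close> by (intro mult_left_mono power_mono) (auto simp: power2_eq_square)
    also have "\<dots> = (C * 4 ^ N * (1 + r) ^ A) * (r\<^sup>2 / 2) ^ N"
    proof -
      have "(2 * r\<^sup>2) ^ N = (4 * (r\<^sup>2 / 2)) ^ N" by simp
      also have "\<dots> = 4 ^ N * (r\<^sup>2 / 2) ^ N" by (rule power_mult_distrib)
      finally show ?thesis by (simp only: mult_ac)
    qed
    finally show ?thesis using r by simp
  qed
  let ?K = "C * 4 ^ N * 5 ^ A * fact n"
  \<comment> \<open>Cauchy's inequality on the circle of radius r about w: its points have modulus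
    at most 2 r, so \<open>bnd1\<close> applies with radius 4 r, and 1 + 4 r \<le> 5 r gives the
    factor \<open>5 ^ A\<close>.\<close>
  have est: "cmod ((deriv ^^ n) f w) \<le> ?K / r" if r: "r \<ge> 1" "r \<ge> cmod w" for r
  proof -
    have "cmod (f x) \<le> C * 4 ^ N * (5 * r) ^ A" if "cmod (w - x) = r" for x
    proof -
      have "cmod x \<le> 2 * r" using that r norm_triangle_ineq4[of w "w - x"] by simp
      then have "cmod (f x) \<le> C * 4 ^ N * (1 + 4 * r) ^ A" using bnd1[of "4 * r" x] r by simp
      also have "\<dots> \<le> C * 4 ^ N * (5 * r) ^ A"
        using r \<open>C \<ge> 0\<close> by (intro mult_left_mono power_mono) auto
      finally show ?thesis .
    qed
    then have "cmod ((deriv ^^ n) f w) \<le> fact n * (C * 4 ^ N * (5 * r) ^ A) / r ^ n"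
      using r by (intro Cauchy_inequality holomorphic_on_subset[OF holf]
          holomorphic_on_imp_continuous_on) auto
    also have "\<dots> = ?K * (r ^ A / r ^ n)" by (simp add: power_mult_distrib)
    also have "\<dots> \<le> ?K * (1 / r)"
    proof -
      have "r ^ A * r \<le> r ^ n" using r \<open>n > A\<close> power_increasing[of "Suc A" n r] by (simp add: mult_ac)
      then show ?thesis using r \<open>C \<ge> 0\<close>
        by (intro mult_left_mono) (auto simp: field_simps)
    qed
    finally show ?thesis by simp
  qed
  have "((\<lambda>r. ?K / r) \<longlongrightarrow> 0) at_top" by real_asymp
  moreover have "eventually (\<lambda>r. cmod ((deriv ^^ n) f w) \<le> ?K / r) at_top"
    using eventually_ge_at_top[of 1] eventually_ge_at_top[of "cmod w"]
    by eventually_elim (rule est)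
  ultimately have "cmod ((deriv ^^ n) f w) \<le> 0"
    using tendsto_lowerbound by fastforce
  then show ?thesis by simp
qed

text \<open>The derivative bound is integrable since \<delta> < 1, so for \<bar>x\<bar> \<le> R the
  values at heights \<epsilon> < \<epsilon>' differ by at most a multiple of
  \<epsilon>'^(1-\<delta>). This uniform Cauchy estimate yields both the limits \<open>L x\<close>
  and the joint continuity.\<close>

lemma boundary_extension:
  fixes \<phi> \<phi>' :: "real \<Rightarrow> real \<Rightarrow> complex" and \<delta> :: real
  assumes cont: "continuous_on (UNIV \<times> {0<..<1}) (\<lambda>(x, \<epsilon>). \<phi> x \<epsilon>)"
    and deriv: "\<And>x \<epsilon>. 0 < \<epsilon> \<Longrightarrow> \<epsilon> < 1 \<Longrightarrow> (\<phi> x has_vector_derivative \<phi>' x \<epsilon>) (at \<epsilon>)"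
    and bnd: "\<And>R. \<exists>C \<eta>. 0 < \<eta> \<and> \<eta> \<le> 1 \<and>
                (\<forall>x \<epsilon>. \<bar>x\<bar> \<le> R \<and> 0 < \<epsilon> \<and> \<epsilon> < \<eta> \<longrightarrow> cmod (\<phi>' x \<epsilon>) \<le> C * \<epsilon> powr (-\<delta>))"
    and \<delta>: "\<delta> < 1"
  obtains L where "continuous_on (UNIV \<times> {0..<1}) (\<lambda>(x, \<epsilon>). if \<epsilon> = 0 then L x else \<phi> x \<epsilon>)"
    "\<And>x. ((\<phi> x) \<longlongrightarrow> L x) (at_right 0)"
proof -
  have "\<exists>K \<eta>. 0 < \<eta> \<and> \<eta> \<le> 1 \<and> 0 \<le> K \<and>
      (\<forall>x \<epsilon> \<epsilon>'. \<bar>x\<bar> \<le> R \<and> 0 < \<epsilon> \<and> \<epsilon> < \<epsilon>' \<and> \<epsilon>' < \<eta> \<longrightarrow>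
         cmod (\<phi> x \<epsilon>' - \<phi> x \<epsilon>) \<le> K * \<epsilon>' powr (1 - \<delta>))" for R
  proof -
    obtain C \<eta> where \<eta>: "0 < \<eta>" "\<eta> \<le> 1" and
      C: "\<And>x \<epsilon>. \<bar>x\<bar> \<le> R \<Longrightarrow> 0 < \<epsilon> \<Longrightarrow> \<epsilon> < \<eta> \<Longrightarrow> cmod (\<phi>' x \<epsilon>) \<le> C * \<epsilon> powr (-\<delta>)"
      using bnd[of R] by blast
    have "cmod (\<phi> x \<epsilon>' - \<phi> x \<epsilon>) \<le> \<bar>C\<bar> / (1 - \<delta>) * \<epsilon>' powr (1 - \<delta>)"
      if "\<bar>x\<bar> \<le> R" "0 < \<epsilon>" "\<epsilon> < \<epsilon>'" "\<epsilon>' < \<eta>" for x \<epsilon> \<epsilon>'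
    proof -
      have "cmod (\<phi> x \<epsilon>' - \<phi> x \<epsilon>)
          \<le> \<bar>C\<bar> / (1 - \<delta>) * \<epsilon>' powr (1 - \<delta>) - \<bar>C\<bar> / (1 - \<delta>) * \<epsilon> powr (1 - \<delta>)"
      proof (rule differentiable_bound_general[where \<phi>' = "\<lambda>s. \<bar>C\<bar> * s powr (-\<delta>)"
            and f' = "\<phi>' x" and f = "\<phi> x"])
        show "continuous_on {\<epsilon>..\<epsilon>'} (\<phi> x)"
          using that \<eta> by (intro continuous_at_imp_continuous_on ballI
              has_vector_derivative_continuous[OF deriv]) auto
        show "continuous_on {\<epsilon>..\<epsilon>'} (\<lambda>s. \<bar>C\<bar> / (1 - \<delta>) * s powr (1 - \<delta>))"
          using that by (intro continuous_intros) auto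
        fix s assume s: "\<epsilon> < s" "s < \<epsilon>'"
        show "(\<phi> x has_vector_derivative \<phi>' x s) (at s)"
          using s that \<eta> by (intro deriv) auto
        show "((\<lambda>s. \<bar>C\<bar> / (1 - \<delta>) * s powr (1 - \<delta>)) has_vector_derivative \<bar>C\<bar> * s powr (-\<delta>)) (at s)"
          unfolding has_real_derivative_iff_has_vector_derivative[symmetric]
          using s that \<delta> by (auto intro!: derivative_eq_intros)
        have "cmod (\<phi>' x s) \<le> C * s powr (-\<delta>)" using s that by (intro C) auto
        also have "\<dots> \<le> \<bar>C\<bar> * s powr (-\<delta>)" by (intro mult_right_mono) auto
        finally show "cmod (\<phi>' x s) \<le> \<bar>C\<bar> * s powr (-\<delta>)" .
      qed (use that in auto)
      also have "\<dots> \<le> \<bar>C\<bar> / (1 - \<delta>) * \<epsilon>' powr (1 - \<delta>)" using \<delta> by simp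
      finally show ?thesis .
    qed
    moreover have "0 \<le> \<bar>C\<bar> / (1 - \<delta>)" using \<delta> by simp
    ultimately show ?thesis using \<eta> by blast
  qed
  then obtain K \<eta> where \<eta>: "\<And>R. 0 < \<eta> R" "\<And>R. \<eta> R \<le> 1" and K0: "\<And>R. 0 \<le> K R"
    and K: "\<And>R x \<epsilon> \<epsilon>'. \<bar>x\<bar> \<le> R \<Longrightarrow> 0 < \<epsilon> \<Longrightarrow> \<epsilon> < \<epsilon>' \<Longrightarrow> \<epsilon>' < \<eta> R \<Longrightarrow>
         cmod (\<phi> x \<epsilon>' - \<phi> x \<epsilon>) \<le> K R * \<epsilon>' powr (1 - \<delta>)"
    by metis
  have small: "\<exists>\<sigma>>0. \<sigma> < \<eta> R \<and> K R * \<sigma> powr (1 - \<delta>) < e" if "e > 0" for e R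
  proof -
    have "((\<lambda>s. K R * s powr (1 - \<delta>)) \<longlongrightarrow> K R * 0) (at_right 0)"
      using \<delta> by (intro tendsto_intros) (auto intro!: tendsto_zero_powrI[of _ _ _ "1 - \<delta>"] eventually_at_right_less simp: eventually_at_filter)
    then have "eventually (\<lambda>s. K R * s powr (1 - \<delta>) < e) (at_right 0)"
      using that order_tendstoD(2) by fastforce
    moreover have "eventually (\<lambda>s. s < \<eta> R) (at_right 0)"
      using \<eta>(1)[of R] by (intro order_tendstoD(2)[OF tendsto_ident_at])
    moreover have "eventually (\<lambda>s. s > 0) (at_right (0::real))"
      by (simp add: eventually_at_right_less)
    ultimately have "eventually (\<lambda>s. s > 0 \<and> s < \<eta> R \<and> K R * s powr (1 - \<delta>) < e) (at_right 0)"
      by eventually_elim simp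
    then show ?thesis
      using eventually_happens'[OF trivial_limit_at_right_real] by blast
  qed
  have lim: "\<exists>l. \<forall>\<epsilon>. 0 < \<epsilon> \<and> \<epsilon> < \<eta> R \<longrightarrow> cmod (\<phi> x \<epsilon> - l) \<le> K R * \<epsilon> powr (1 - \<delta>)"
    if xR: "\<bar>x\<bar> \<le> R" for R x
  proof -
    define s where "s n = \<eta> R / (real n + 2)" for n
    have s: "0 < s n" "s n < \<eta> R" for n
      using \<eta>(1)[of R] by (auto simp: s_def field_simps intro!: add_pos_nonneg mult_pos_pos)
    have sdec: "s m < s n" if "n < m" for m n
      using \<eta>(1)[of R] that unfolding s_def by (intro divide_strict_left_mono) auto
    have s0: "s \<longlonglongrightarrow> 0" unfolding s_def by real_asymp
    have "Cauchy (\<lambda>n. \<phi> x (s n))"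
    proof (rule metric_CauchyI)
      fix e :: real assume "e > 0"
      then obtain \<sigma> where \<sigma>: "\<sigma> > 0" "K R * \<sigma> powr (1 - \<delta>) < e"
        using small by blast
      obtain N where N: "\<And>n. n \<ge> N \<Longrightarrow> s n < \<sigma>"
        using order_tendstoD(2)[OF s0 \<sigma>(1)] by (auto simp: eventually_sequentially)
      have *: "dist (\<phi> x (s m)) (\<phi> x (s n)) < e" if "N \<le> m" "m < n" for m n
      proof -
        have "cmod (\<phi> x (s m) - \<phi> x (s n)) \<le> K R * s m powr (1 - \<delta>)"
          using that by (intro K xR s sdec)
        also have "\<dots> \<le> K R * \<sigma> powr (1 - \<delta>)"
          using N[OF that(1)] s(1)[of m] \<delta> by (intro mult_left_mono powr_mono2 K0) auto
        finally show ?thesis using \<sigma> by (simp add: dist_norm)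
      qed
      have "dist (\<phi> x (s m)) (\<phi> x (s n)) < e" if "N \<le> m" "N \<le> n" for m n
        using *[of m n] *[of n m] that \<open>e > 0\<close> by (cases m n rule: linorder_cases) (auto simp: dist_commute)
      then show "\<exists>M. \<forall>m\<ge>M. \<forall>n\<ge>M. dist (\<phi> x (s m)) (\<phi> x (s n)) < e" by blast
    qed
    then obtain l where l: "(\<lambda>n. \<phi> x (s n)) \<longlonglongrightarrow> l"
      using Cauchy_convergent convergentD by blast
    have "cmod (\<phi> x \<epsilon> - l) \<le> K R * \<epsilon> powr (1 - \<delta>)" if e: "0 < \<epsilon>" "\<epsilon> < \<eta> R" for \<epsilon>
    proof (rule tendsto_upperbound)
      show "(\<lambda>n. cmod (\<phi> x \<epsilon> - \<phi> x (s n))) \<longlonglongrightarrow> cmod (\<phi> x \<epsilon> - l)"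
        by (intro tendsto_intros l)
      show "eventually (\<lambda>n. cmod (\<phi> x \<epsilon> - \<phi> x (s n)) \<le> K R * \<epsilon> powr (1 - \<delta>)) sequentially"
        using order_tendstoD(2)[OF s0 e(1)] by eventually_elim (intro K xR s e)
    qed auto
    then show ?thesis by blast
  qed
  \<comment> \<open>The limits found in \<open>lim\<close> formally depend on \<open>R\<close>;
    defining \<open>L\<close> through \<open>Lim\<close> removes this dependence.\<close>
  define L where "L x = Lim (at_right 0) (\<phi> x)" for x
  have limL: "(\<phi> x \<longlongrightarrow> L x) (at_right 0) \<and>
      (\<forall>\<epsilon>. 0 < \<epsilon> \<and> \<epsilon> < \<eta> R \<longrightarrow> cmod (\<phi> x \<epsilon> - L x) \<le> K R * \<epsilon> powr (1 - \<delta>))"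
    if xR: "\<bar>x\<bar> \<le> R" for R x
  proof -
    obtain l where l: "\<And>\<epsilon>. 0 < \<epsilon> \<Longrightarrow> \<epsilon> < \<eta> R \<Longrightarrow> cmod (\<phi> x \<epsilon> - l) \<le> K R * \<epsilon> powr (1 - \<delta>)"
      using lim[OF xR] by blast
    have "((\<lambda>\<epsilon>. \<phi> x \<epsilon> - l) \<longlongrightarrow> 0) (at_right 0)"
    proof (rule Lim_null_comparison)
      have "eventually (\<lambda>s. s > 0 \<and> s < \<eta> R) (at_right (0::real))"
        using \<eta>(1)[of R] eventually_at_right_real by fastforce
      then show "eventually (\<lambda>\<epsilon>. cmod (\<phi> x \<epsilon> - l) \<le> K R * \<epsilon> powr (1 - \<delta>)) (at_right 0)"
        by eventually_elim (auto intro: l)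
      show "((\<lambda>s. K R * s powr (1 - \<delta>)) \<longlongrightarrow> 0) (at_right 0)"
        using \<delta> by (intro tendsto_mult_right_zero) (auto intro!: tendsto_zero_powrI[of _ _ _ "1 - \<delta>"] eventually_at_right_less simp: eventually_at_filter)
    qed
    then have t: "(\<phi> x \<longlongrightarrow> l) (at_right 0)" by (simp add: LIM_zero_iff)
    then have "L x = l" unfolding L_def by (intro tendsto_Lim) auto
    then show ?thesis using t l by blast
  qed
  let ?\<psi> = "\<lambda>(x, \<epsilon>). if \<epsilon> = 0 then L x else \<phi> x \<epsilon>"
  have "continuous_on (UNIV \<times> {0..<1}) ?\<psi>"
    unfolding continuous_on_eq_continuous_within
  proof
    fix p :: "real \<times> real" assume p: "p \<in> UNIV \<times> {0..<1}"
    obtain x0 e0 where p0: "p = (x0, e0)" by fastforce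
    show "continuous (at p within UNIV \<times> {0..<1}) ?\<psi>"
    proof (cases "e0 = 0")
      case False
      have o: "open (UNIV \<times> {0<..<1} :: (real \<times> real) set)" by (intro open_Times) auto
      have "continuous_on (UNIV \<times> {0<..<1}) ?\<psi>"
        by (rule continuous_on_eq[OF cont]) auto
      then have "continuous (at p) ?\<psi>"
        by (rule continuous_on_interior) (use False p p0 o in \<open>auto simp: interior_open\<close>)
      then show ?thesis by (rule continuous_at_imp_continuous_at_within)
    next
      case True
      define R where "R = \<bar>x0\<bar> + 1"
      show ?thesis unfolding continuous_within_eps_delta
      proof (intro allI impI)
        fix e :: real assume "e > 0"
        then obtain \<sigma> where \<sigma>: "\<sigma> > 0" "\<sigma> < \<eta> R" "K R * \<sigma> powr (1 - \<delta>) < e / 4"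
          using small[of "e / 4" R] by auto
        \<comment> \<open>Continuity in x is available at the fixed height \<sigma>; going up to
          \<sigma>, across, and down again produces four errors below e / 4.\<close>
        have "continuous_on UNIV (\<lambda>x. \<phi> x \<sigma>)"
          using \<sigma> \<eta>(2)[of R]
          by (intro continuous_on_compose2[OF cont, where f = "\<lambda>x. (x, \<sigma>)", simplified] continuous_intros) auto
        then obtain d where d: "d > 0" "\<And>x. \<bar>x - x0\<bar> < d \<Longrightarrow> cmod (\<phi> x \<sigma> - \<phi> x0 \<sigma>) < e / 4"
          using \<open>e > 0\<close> unfolding continuous_on_iff by (metis UNIV_I dist_norm real_norm_def zero_less_divide_iff zero_less_numeral)
        have b: "cmod (\<phi> x \<epsilon> - L x) < e / 4" if "\<bar>x\<bar> \<le> R" "0 < \<epsilon>" "\<epsilon> \<le> \<sigma>" for x \<epsilon>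
        proof -
          have "cmod (\<phi> x \<epsilon> - L x) \<le> K R * \<epsilon> powr (1 - \<delta>)"
            using limL[OF that(1)] that \<sigma> by auto
          also have "\<dots> \<le> K R * \<sigma> powr (1 - \<delta>)"
            using that \<delta> by (intro mult_left_mono powr_mono2 K0) auto
          finally show ?thesis using \<sigma> by simp
        qed
        have "dist (?\<psi> p') (?\<psi> p) < e"
          if p': "p' \<in> UNIV \<times> {0..<1}" "dist p' p < min (min d \<sigma>) 1" for p'
        proof -
          obtain x \<epsilon> where xe: "p' = (x, \<epsilon>)" by fastforce
          have e0: "0 \<le> \<epsilon>" using p' xe by auto
          have "\<bar>x - x0\<bar> \<le> dist p' p" "\<bar>\<epsilon> - e0\<bar> \<le> dist p' p"
            using dist_fst_le[of p' p] dist_snd_le[of p' p] by (auto simp: xe p0 dist_real_def)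
          then have x: "\<bar>x - x0\<bar> < d" "\<bar>x - x0\<bar> < 1" "\<epsilon> < \<sigma>" using p' True by auto
          then have xR: "\<bar>x\<bar> \<le> R" "\<bar>x0\<bar> \<le> R" by (auto simp: R_def)
          have 1: "cmod (?\<psi> p' - L x) < e / 4"
            using b[OF xR(1), of \<epsilon>] e0 x \<open>e > 0\<close> by (auto simp: xe)
          have 2: "cmod (\<phi> x \<sigma> - L x) < e / 4" "cmod (\<phi> x0 \<sigma> - L x0) < e / 4"
            using b xR \<sigma> by auto
          have 3: "cmod (\<phi> x \<sigma> - \<phi> x0 \<sigma>) < e / 4" using d x by blast
          have "cmod (?\<psi> p' - L x0) = cmod ((?\<psi> p' - L x) - (\<phi> x \<sigma> - L x)
              + (\<phi> x \<sigma> - \<phi> x0 \<sigma>) + (\<phi> x0 \<sigma> - L x0))" by (simp only: algebra_simps) simp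
          also have "\<dots> \<le> cmod (?\<psi> p' - L x) + cmod (\<phi> x \<sigma> - L x)
              + cmod (\<phi> x \<sigma> - \<phi> x0 \<sigma>) + cmod (\<phi> x0 \<sigma> - L x0)"
            by (intro norm_triangle_mono norm_triangle_ineq4 order_refl)
          also have "\<dots> < e" using 1 2 3 by linarith
          finally show ?thesis by (simp add: dist_norm p0 True)
        qed
        moreover have "min (min d \<sigma>) 1 > 0" using d \<sigma> by auto
        ultimately show "\<exists>d>0. \<forall>x'\<in>UNIV \<times> {0..<1}. dist x' p < d \<longrightarrow> dist (?\<psi> x') (?\<psi> p) < e"
          by blast
      qed
    qed
  qed
  with limL show ?thesis using that[of L] by blast
qed

text \<open>
  The functions themselves need not extend continuously to the real line (they may grow like
  a power of the distance with exponent above $-1$), but their primitives do.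
\<close>

lemma glue_across_real_line:
  fixes f g :: "complex \<Rightarrow> complex" and \<delta> :: real
  assumes f: "f holomorphic_on {z. -1 < Im z \<and> Im z < 0}"
    and g: "g holomorphic_on {z. 0 < Im z \<and> Im z < 1}"
    and bnd: "\<And>R. \<exists>C \<eta>. 0 < \<eta> \<and> \<eta> \<le> 1 \<and> (\<forall>x \<epsilon>. \<bar>x\<bar> \<le> R \<and> 0 < \<epsilon> \<and> \<epsilon> < \<eta> \<longrightarrow>
                cmod (f (Complex x (-\<epsilon>))) \<le> C * \<epsilon> powr (-\<delta>) \<and>
                cmod (g (Complex x \<epsilon>)) \<le> C * \<epsilon> powr (-\<delta>))"
    and \<delta>: "\<delta> < 1"
    and jump: "\<And>R e. e > 0 \<Longrightarrow> \<exists>\<eta>>0. \<forall>x \<epsilon>. \<bar>x\<bar> \<le> R \<and> 0 < \<epsilon> \<and> \<epsilon> < \<eta> \<longrightarrow>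
                cmod (g (Complex x \<epsilon>) - f (Complex x (-\<epsilon>))) \<le> e"
  obtains H where "H holomorphic_on {z. \<bar>Im z\<bar> < 1}"
    "\<And>z. -1 < Im z \<Longrightarrow> Im z < 0 \<Longrightarrow> H z = f z" "\<And>z. 0 < Im z \<Longrightarrow> Im z < 1 \<Longrightarrow> H z = g z"
proof -
  let ?SL = "{z. -1 < Im z \<and> Im z < 0}" and ?SU = "{z. 0 < Im z \<and> Im z < 1}" and ?S = "{z. \<bar>Im z\<bar> < 1}"
  have conv: "convex {z. a < Im z \<and> Im z < b}" for a b
  proof -
    have "{z. a < Im z \<and> Im z < b} = {z. Im z > a} \<inter> {z. Im z < b}" by auto
    then show ?thesis by (simp add: convex_Int convex_halfspace_Im_gt convex_halfspace_Im_lt)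
  qed
  have opn: "open {z. a < Im z \<and> Im z < b}" for a b
  proof -
    have "{z. a < Im z \<and> Im z < b} = {z. Im z > a} \<inter> {z. Im z < b}" by auto
    then show ?thesis by (simp add: open_Int open_halfspace_Im_gt open_halfspace_Im_lt)
  qed
  obtain f1 where f1w: "\<And>z. z \<in> ?SL \<Longrightarrow> (f1 has_field_derivative f z) (at z within ?SL)"
    using holomorphic_convex_primitive'[OF conv opn f] by blast
  obtain g1 where g1w: "\<And>z. z \<in> ?SU \<Longrightarrow> (g1 has_field_derivative g z) (at z within ?SU)"
    using holomorphic_convex_primitive'[OF conv opn g] by blast
  have f1: "(f1 has_field_derivative f z) (at z)" if "-1 < Im z" "Im z < 0" for z
    using f1w[of z] that at_within_open[OF _ opn] by auto
  have g1: "(g1 has_field_derivative g z) (at z)" if "0 < Im z" "Im z < 1" for z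
    using g1w[of z] that at_within_open[OF _ opn] by auto
  have hv: "((\<lambda>t. Complex x (c * t)) has_vector_derivative (\<i> * of_real c)) (at s)" for x c s
    unfolding Complex_eq by (auto intro!: derivative_eq_intros simp: has_vector_derivative_def fun_eq_iff scaleR_conv_of_real)
  have contf1: "continuous_on ?SL f1" and contg1: "continuous_on ?SU g1"
    using f1 g1 by (auto intro!: continuous_at_imp_continuous_on DERIV_isCont)
  obtain Lf where Lf: "continuous_on (UNIV \<times> {0..<1}) (\<lambda>(x, \<epsilon>). if \<epsilon> = 0 then Lf x else f1 (Complex x (-1 * \<epsilon>)))"
    "\<And>x. ((\<lambda>\<epsilon>. f1 (Complex x (-1 * \<epsilon>))) \<longlongrightarrow> Lf x) (at_right 0)"
  proof (rule boundary_extension[of "\<lambda>x \<epsilon>. f1 (Complex x (-1 * \<epsilon>))"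
        "\<lambda>x \<epsilon>. (\<i> * of_real (-1)) * f (Complex x (-1 * \<epsilon>))" \<delta>])
    show "continuous_on (UNIV \<times> {0<..<1}) (\<lambda>(x, \<epsilon>). f1 (Complex x (-1 * \<epsilon>)))"
      unfolding case_prod_unfold by (rule continuous_on_compose2[OF contf1])
        (auto intro!: continuous_intros simp: Complex_eq)
    show "((\<lambda>\<epsilon>. f1 (Complex x (-1 * \<epsilon>))) has_vector_derivative \<i> * of_real (- 1) * f (Complex x (-1 * \<epsilon>))) (at \<epsilon>)"
      if "0 < \<epsilon>" "\<epsilon> < 1" for x \<epsilon>
      using field_vector_diff_chain_at[OF hv f1, of x "-1" \<epsilon>] that by (simp add: o_def)
    show "\<exists>C \<eta>. 0 < \<eta> \<and> \<eta> \<le> 1 \<and> (\<forall>x \<epsilon>. \<bar>x\<bar> \<le> R \<and> 0 < \<epsilon> \<and> \<epsilon> < \<eta> \<longrightarrow>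
         cmod (\<i> * complex_of_real (- 1) * f (Complex x (- 1 * \<epsilon>))) \<le> C * \<epsilon> powr - \<delta>)" for R
      using bnd[of R] by (auto simp: norm_mult)
  qed (use \<delta> in auto)
  obtain Lg where Lg: "continuous_on (UNIV \<times> {0..<1}) (\<lambda>(x, \<epsilon>). if \<epsilon> = 0 then Lg x else g1 (Complex x (1 * \<epsilon>)))"
    "\<And>x. ((\<lambda>\<epsilon>. g1 (Complex x (1 * \<epsilon>))) \<longlongrightarrow> Lg x) (at_right 0)"
  proof (rule boundary_extension[of "\<lambda>x \<epsilon>. g1 (Complex x (1 * \<epsilon>))"
        "\<lambda>x \<epsilon>. (\<i> * of_real 1) * g (Complex x (1 * \<epsilon>))" \<delta>])
    show "continuous_on (UNIV \<times> {0<..<1}) (\<lambda>(x, \<epsilon>). g1 (Complex x (1 * \<epsilon>)))"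
      unfolding case_prod_unfold by (rule continuous_on_compose2[OF contg1])
        (auto intro!: continuous_intros simp: Complex_eq)
    show "((\<lambda>\<epsilon>. g1 (Complex x (1 * \<epsilon>))) has_vector_derivative \<i> * of_real 1 * g (Complex x (1 * \<epsilon>))) (at \<epsilon>)"
      if "0 < \<epsilon>" "\<epsilon> < 1" for x \<epsilon>
      using field_vector_diff_chain_at[OF hv g1, of x 1 \<epsilon>] that by (simp add: o_def)
    show "\<exists>C \<eta>. 0 < \<eta> \<and> \<eta> \<le> 1 \<and> (\<forall>x \<epsilon>. \<bar>x\<bar> \<le> R \<and> 0 < \<epsilon> \<and> \<epsilon> < \<eta> \<longrightarrow>
         cmod (\<i> * complex_of_real 1 * g (Complex x (1 * \<epsilon>))) \<le> C * \<epsilon> powr - \<delta>)" for R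
      using bnd[of R] by (auto simp: norm_mult)
  qed (use \<delta> in auto)
  define D where "D x = Lg x - Lf x" for x
  \<comment> \<open>At height \<epsilon> the x-derivative of the difference of the primitives is g -
    f at reflected points, hence at most e in modulus, and the bound survives \<epsilon> -> 0. So
    \<open>D\<close> is Lipschitz with every positive constant, that is, constant.\<close>
  have Dle: "cmod (D x - D y) \<le> e * \<bar>x - y\<bar>" if "e > 0" for x y e
  proof -
    obtain \<eta> where \<eta>: "\<eta> > 0" "\<And>t \<epsilon>. \<bar>t\<bar> \<le> max \<bar>x\<bar> \<bar>y\<bar> \<Longrightarrow> 0 < \<epsilon> \<Longrightarrow> \<epsilon> < \<eta> \<Longrightarrow>
        cmod (g (Complex t \<epsilon>) - f (Complex t (-\<epsilon>))) \<le> e"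
      using jump[OF \<open>e > 0\<close>, of "max \<bar>x\<bar> \<bar>y\<bar>"] by blast
    let ?D = "\<lambda>\<epsilon> t. g1 (Complex t (1 * \<epsilon>)) - f1 (Complex t (-1 * \<epsilon>))"
    have "cmod (?D \<epsilon> x - ?D \<epsilon> y) \<le> e * \<bar>x - y\<bar>" if e: "0 < \<epsilon>" "\<epsilon> < min \<eta> 1" for \<epsilon>
    proof -
      have hh: "((\<lambda>t. Complex t c) has_vector_derivative 1) (at s)" for c s
        unfolding Complex_eq by (auto intro!: derivative_eq_intros simp: has_vector_derivative_def fun_eq_iff scaleR_conv_of_real)
      have d: "(?D \<epsilon> has_vector_derivative (g (Complex t \<epsilon>) - f (Complex t (-\<epsilon>)))) (at t)" for t
        using field_vector_diff_chain_at[OF hh g1, of t \<epsilon>] field_vector_diff_chain_at[OF hh f1, of t "-\<epsilon>"] e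
        by (auto intro!: derivative_eq_intros simp: o_def)
      have "norm (?D \<epsilon> x - ?D \<epsilon> y) \<le> e * norm (x - y)"
      proof (rule differentiable_bound[OF convex_closed_segment[of x y],
          where f' = "\<lambda>t h. h *\<^sub>R (g (Complex t \<epsilon>) - f (Complex t (-\<epsilon>)))"])
        fix t assume t: "t \<in> closed_segment x y"
        show "(?D \<epsilon> has_derivative (\<lambda>h. h *\<^sub>R (g (Complex t \<epsilon>) - f (Complex t (-\<epsilon>))))) (at t within closed_segment x y)"
          using d[of t] unfolding has_vector_derivative_def by (rule has_derivative_at_withinI)
        have "\<bar>t\<bar> \<le> max \<bar>x\<bar> \<bar>y\<bar>" using t by (auto simp: closed_segment_eq_real_ivl split: if_splits)
        then have "cmod (g (Complex t \<epsilon>) - f (Complex t (-\<epsilon>))) \<le> e" using \<eta>(2) e by auto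
        then show "onorm (\<lambda>h. h *\<^sub>R (g (Complex t \<epsilon>) - f (Complex t (-\<epsilon>)))) \<le> e"
          by (intro onorm_le) (auto simp: mult.commute[of e] intro!: mult_left_mono)
      qed auto
      then show ?thesis by simp
    qed
    then have "eventually (\<lambda>\<epsilon>. cmod (?D \<epsilon> x - ?D \<epsilon> y) \<le> e * \<bar>x - y\<bar>) (at_right 0)"
      using \<eta> eventually_at_right_real[of 0 "min \<eta> 1"] by (auto elim!: eventually_mono)
    moreover have "((\<lambda>\<epsilon>. cmod (?D \<epsilon> x - ?D \<epsilon> y)) \<longlongrightarrow> cmod (D x - D y)) (at_right 0)"
      unfolding D_def by (intro tendsto_intros Lf Lg)
    ultimately show ?thesis by (intro tendsto_upperbound) auto
  qed
  have Dc: "D x = D 0" for x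
  proof (rule ccontr)
    assume "D x \<noteq> D 0"
    then have c: "cmod (D x - D 0) > 0" by simp
    have "cmod (D x - D 0) \<le> cmod (D x - D 0) / (2 * (\<bar>x\<bar> + 1)) * \<bar>x - 0\<bar>"
      by (rule Dle) (use \<open>D x \<noteq> D 0\<close> in \<open>auto intro!: divide_pos_pos\<close>)
    also have "\<dots> = cmod (D x - D 0) * (\<bar>x\<bar> / (2 * (\<bar>x\<bar> + 1)))" by simp
    also have "\<dots> < cmod (D x - D 0) * 1"
      by (rule mult_strict_left_mono[OF _ c]) (simp add: field_simps)
    finally show False by simp
  qed
  \<comment> \<open>Adding the constant \<open>D 0\<close> to the lower primitive makes the two
    agree on the line. The redundant factors -1 and 1 match the form of \<open>Lf(1)\<close> and
    \<open>Lg(1)\<close>.\<close>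
  define H1 where "H1 z = (if Im z \<le> 0 then (if -Im z = 0 then Lf (Re z) else f1 (Complex (Re z) (-1 * (-Im z)))) + D 0
     else g1 (Complex (Re z) (1 * Im z)))" for z
  have "continuous_on ({z. -1 < Im z \<and> Im z \<le> 0} \<union> {z. 0 \<le> Im z \<and> Im z < 1})
     (\<lambda>z. if Im z \<le> 0 then (\<lambda>(x, \<epsilon>). if \<epsilon> = 0 then Lf x else f1 (Complex x (-1 * \<epsilon>))) (Re z, -Im z) + D 0
       else (\<lambda>(x, \<epsilon>). if \<epsilon> = 0 then Lg x else g1 (Complex x (1 * \<epsilon>))) (Re z, Im z))"
  proof (rule continuous_on_cases_local)
    have eq1: "{z. -1 < Im z \<and> Im z \<le> 0} = ({z. -1 < Im z \<and> Im z \<le> 0} \<union> {z. 0 \<le> Im z \<and> Im z < 1}) \<inter> {z. Im z \<le> 0}" by auto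
    show "closedin (top_of_set ({z. -1 < Im z \<and> Im z \<le> 0} \<union> {z. 0 \<le> Im z \<and> Im z < 1})) {z. -1 < Im z \<and> Im z \<le> 0}"
      using closedin_closed_Int[OF closed_halfspace_Im_le[of 0], of "({z. -1 < Im z \<and> Im z \<le> 0} \<union> {z. 0 \<le> Im z \<and> Im z < 1})"]
      by (simp only: eq1[symmetric])
    have eq2: "{z. 0 \<le> Im z \<and> Im z < 1} = ({z. -1 < Im z \<and> Im z \<le> 0} \<union> {z. 0 \<le> Im z \<and> Im z < 1}) \<inter> {z. Im z \<ge> 0}" by auto
    show "closedin (top_of_set ({z. -1 < Im z \<and> Im z \<le> 0} \<union> {z. 0 \<le> Im z \<and> Im z < 1})) {z. 0 \<le> Im z \<and> Im z < 1}"
      using closedin_closed_Int[OF closed_halfspace_Im_ge[of 0], of "({z. -1 < Im z \<and> Im z \<le> 0} \<union> {z. 0 \<le> Im z \<and> Im z < 1})"]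
      by (simp only: eq2[symmetric])
    show "continuous_on {z. -1 < Im z \<and> Im z \<le> 0}
       (\<lambda>z. (\<lambda>(x, \<epsilon>). if \<epsilon> = 0 then Lf x else f1 (Complex x (-1 * \<epsilon>))) (Re z, -Im z) + D 0)"
      by (intro continuous_on_add continuous_on_const continuous_on_compose2[OF Lf(1)]) (auto intro!: continuous_intros)
    show "continuous_on {z. 0 \<le> Im z \<and> Im z < 1}
       (\<lambda>z. (\<lambda>(x, \<epsilon>). if \<epsilon> = 0 then Lg x else g1 (Complex x (1 * \<epsilon>))) (Re z, Im z))"
      by (intro continuous_on_compose2[OF Lg(1)]) (auto intro!: continuous_intros)
    have "Lf x + D 0 = Lg x" for x using Dc[of x] by (simp add: D_def algebra_simps)
    then show "\<And>z. z \<in> {z. -1 < Im z \<and> Im z \<le> 0} \<and> \<not> Im z \<le> 0 \<or> z \<in> {z. 0 \<le> Im z \<and> Im z < 1} \<and> Im z \<le> 0 \<Longrightarrow>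
      (\<lambda>(x, \<epsilon>). if \<epsilon> = 0 then Lf x else f1 (Complex x (-1 * \<epsilon>))) (Re z, -Im z) + D 0 =
      (\<lambda>(x, \<epsilon>). if \<epsilon> = 0 then Lg x else g1 (Complex x (1 * \<epsilon>))) (Re z, Im z)"
      by auto
  qed
  moreover have "{z. -1 < Im z \<and> Im z \<le> 0} \<union> {z. 0 \<le> Im z \<and> Im z < 1} = ?S" by auto
  ultimately have contH: "continuous_on ?S H1"
    unfolding H1_def by (auto elim!: continuous_on_eq)
  have H1f: "H1 z = f1 z + D 0" if "Im z < 0" for z using that by (simp add: H1_def)
  have H1g: "H1 z = g1 z" if "Im z > 0" for z using that by (simp add: H1_def)
  have "H1 holomorphic_on ?S"
  proof (rule holomorphic_on_paste_across_line[of _ \<i> _ 0])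
    show "open ?S" using opn[of "-1" 1] by (simp add: abs_less_iff conj_commute minus_less_iff)
    have "f1 holomorphic_on ?SL" using f1w by (auto simp: holomorphic_on_def field_differentiable_def)
    then have "(\<lambda>z. f1 z + D 0) holomorphic_on ?SL" by (intro holomorphic_intros)
    then have "H1 holomorphic_on ?SL" by (rule holomorphic_transform) (simp add: H1f)
    then show "H1 holomorphic_on ?S \<inter> {z. \<i> \<bullet> z < 0}"
      by (rule holomorphic_on_subset) auto
    have "g1 holomorphic_on ?SU" using g1w by (auto simp: holomorphic_on_def field_differentiable_def)
    then have "H1 holomorphic_on ?SU" by (rule holomorphic_transform) (simp add: H1g)
    then show "H1 holomorphic_on ?S \<inter> {z. 0 < \<i> \<bullet> z}"
      by (rule holomorphic_on_subset) auto
  qed (use contH in auto)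
  moreover have "open ?S" using opn[of "-1" 1] by (simp add: abs_less_iff conj_commute minus_less_iff)
  \<comment> \<open>The required continuation is the derivative of the glued primitive.\<close>
  ultimately have "deriv H1 holomorphic_on ?S" by (rule holomorphic_deriv)
  moreover have "deriv H1 z = f z" if z: "-1 < Im z" "Im z < 0" for z
  proof -
    have "((\<lambda>z. f1 z + D 0) has_field_derivative f z) (at z)"
      using f1[OF z] by (auto intro!: derivative_eq_intros)
    then have "(H1 has_field_derivative f z) (at z)"
      by (rule has_field_derivative_transform_within_open[OF _ open_halfspace_Im_lt[of 0]]) (use z in \<open>auto simp: H1f\<close>)
    then show ?thesis by (rule DERIV_imp_deriv)
  qed
  moreover have "deriv H1 z = g z" if z: "0 < Im z" "Im z < 1" for z
  proof -
    have "(H1 has_field_derivative g z) (at z)"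
      by (rule has_field_derivative_transform_within_open[OF g1[OF z] open_halfspace_Im_gt[of 0]])
        (use z in \<open>auto simp: H1g\<close>)
    then show ?thesis by (rule DERIV_imp_deriv)
  qed
  ultimately show ?thesis using that by blast
qed

section \<open>Estimates for the antiholomorphic factor\<close>

text \<open>For b \<ge> 0 the upper bound on w is used, for b < 0 the lower one; the exponent
  \<bar>b\<bar> covers both signs.\<close>

lemma powr_comparable:
  fixes w t B b :: real
  assumes "t / B \<le> w" "w \<le> B * t" "0 < t" "1 \<le> B"
  shows "w powr b \<le> B powr \<bar>b\<bar> * t powr b"
proof -
  have w: "0 < w" using assms by (intro less_le_trans[OF _ assms(1)]) auto
  have "(w / t) powr b \<le> B powr \<bar>b\<bar>"
  proof (cases "b \<ge> 0")
    case True
    then show ?thesis using assms w by (auto intro!: powr_mono2 simp: field_simps)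
  next
    case False
    have "(w / t) powr b = (t / w) powr (-b)" using w assms by (simp add: powr_minus powr_divide field_simps)
    also have "\<dots> \<le> B powr (-b)" using False assms w by (intro powr_mono2) (auto simp: field_simps)
    finally show ?thesis using False by simp
  qed
  then show ?thesis using assms w by (simp add: powr_divide field_simps)
qed

lemma circle_mean_value:
  assumes "F holomorphic_on ball p R" "0 < \<rho>" "\<rho> < R"
  shows "((\<lambda>t. F (p + of_real \<rho> * exp (2 * of_real pi * \<i> * of_real t))) has_integral F p) {0..1}"
proof -
  have "F holomorphic_on cball p \<rho>"
    by (rule holomorphic_on_subset[OF assms(1)]) (use assms in auto)
  then have "((\<lambda>w. F w / (w - p)) has_contour_integral (2 * of_real pi * \<i> * F p)) (circlepath p \<rho>)"
    by (rule Cauchy_integral_circlepath_simple) (use assms in auto)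
  then have "((\<lambda>t. F (circlepath p \<rho> t) / (circlepath p \<rho> t - p) *
      vector_derivative (circlepath p \<rho>) (at t)) has_integral 2 * of_real pi * \<i> * F p) {0..1}"
    by (simp add: has_contour_integral)
  then have "((\<lambda>t. (2 * of_real pi * \<i>) * F (p + of_real \<rho> * exp (2 * of_real pi * \<i> * of_real t)))
      has_integral (2 * of_real pi * \<i>) * F p) {0..1}"
    by (rule has_integral_eq[rotated])
      (use assms in \<open>simp only: vector_derivative_circlepath, simp add: circlepath\<close>)
  from has_integral_mult_right[OF this, of "1 / (2 * of_real pi * \<i>)"]
  show ?thesis by simp
qed

text \<open>
  A derivative of the form $h \mapsto A h + B \bar h$ means $\partial_z u = A$ and
  $\bar\partial_z u = B$; so the locale says $\bar\partial u = (\mathrm{Im}\, z)^\alpha \overline{F}$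
  with $F$ holomorphic.
\<close>

locale alpha_pair =
  fixes \<alpha> :: real and u F a :: "complex \<Rightarrow> complex"
  assumes holF: "F holomorphic_on {z. 0 < Im z}"
    and deriv_u: "\<And>z. 0 < Im z \<Longrightarrow>
      (u has_derivative (\<lambda>h. a z * h + of_real (Im z powr \<alpha>) * cnj (F z) * cnj h)) (at z)"
    and cont_a: "continuous_on {z. 0 < Im z} a"
begin

lemma cont_u: "continuous_on {z. 0 < Im z} u"
  using deriv_u by (auto intro!: continuous_at_imp_continuous_on has_derivative_continuous)

text \<open>
  With $W = u\, y^{-\alpha}$ one has $\bar\partial W = \overline{F} + u\, \bar\partial (y^{-\alpha})$ and
  $\frac{d}{d\rho} \oint_{|z-p|=\rho} W\, dz = 2 i \rho \int_0^{2\pi} \bar\partial W\, d\theta$; the mean value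
  property of $\overline F$ then expresses $F(p)$ through $u$ alone.
\<close>

lemma F_bound:
  assumes p: "0 < Im p" and M: "\<And>z. z \<in> cball p (Im p / 2) \<Longrightarrow> cmod (u z) \<le> M"
  shows "cmod (F p) \<le> (\<bar>\<alpha>\<bar> + 2) * 2 powr (\<bar>\<alpha>\<bar> + 1) * M * Im p powr (-\<alpha> - 1)"
proof -
  define y where "y = Im p"
  \<comment> \<open>Bounds the factor by which a power with exponent of modulus at most
    \<bar>\<alpha>\<bar> + 1 changes between the height y and heights from y / 2 to 3 y / 2.\<close>
  define c where "c = (2::real) powr (\<bar>\<alpha>\<bar> + 1)"
  have y: "y > 0" using p by (simp add: y_def)
  have c: "c > 0" by (simp add: c_def)
  have "cmod (u p) \<le> M" using M[of p] p by simp
  then have M0: "M \<ge> 0" using norm_ge_zero order_trans by blast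
  have powbd: "t powr b \<le> c * y powr b" if t: "y / 2 \<le> t" "t \<le> 3 / 2 * y" and b: "\<bar>b\<bar> \<le> \<bar>\<alpha>\<bar> + 1" for t b
  proof -
    have "t powr b \<le> 2 powr \<bar>b\<bar> * y powr b"
      by (rule powr_comparable) (use t y in auto)
    also have "\<dots> \<le> c * y powr b"
      unfolding c_def by (intro mult_right_mono powr_mono b) auto
    finally show ?thesis .
  qed
  define W where "W z = u z * of_real (Im z powr -\<alpha>)" for z
  define A where "A z = a z * of_real (Im z powr -\<alpha>) + u z * (\<i> * of_real (\<alpha> / 2 * Im z powr (-\<alpha> - 1)))" for z
  define B' where "B' z = u z * (- \<i> * of_real (\<alpha> / 2 * Im z powr (-\<alpha> - 1)))" for z
  define B where "B z = cnj (F z) + B' z" for z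
  have dW: "(W has_derivative (\<lambda>h. A z * h + B z * cnj h)) (at z)" if z: "0 < Im z" for z
  proof -
    have "(W has_derivative (\<lambda>h. u z * of_real (Im h * (-\<alpha>) * Im z powr (-\<alpha> - 1)) +
        (a z * h + of_real (Im z powr \<alpha>) * cnj (F z) * cnj h) * of_real (Im z powr -\<alpha>))) (at z)"
      unfolding W_def
      by (rule derivative_eq_intros deriv_u z refl | (use z in force))+
         (use z in \<open>auto simp: fun_eq_iff powr_diff mult_ac\<close>)
    moreover have "(\<lambda>h. u z * of_real (Im h * (-\<alpha>) * Im z powr (-\<alpha> - 1)) +
        (a z * h + of_real (Im z powr \<alpha>) * cnj (F z) * cnj h) * of_real (Im z powr -\<alpha>))
       = (\<lambda>h. A z * h + B z * cnj h)"
    proof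
      fix h
      have 1: "complex_of_real (Im z powr \<alpha>) * of_real (Im z powr -\<alpha>) = 1"
        using z by (simp add: powr_minus flip: of_real_mult)
      have 2: "complex_of_real (Im h) = - \<i> / 2 * h + \<i> / 2 * cnj h"
        by (simp add: complex_eq_iff)
      have "u z * of_real (Im h * (-\<alpha>) * Im z powr (-\<alpha> - 1)) +
        (a z * h + of_real (Im z powr \<alpha>) * cnj (F z) * cnj h) * of_real (Im z powr -\<alpha>)
        = u z * (of_real (Im h) * of_real ((-\<alpha>) * Im z powr (-\<alpha> - 1))) + a z * h * of_real (Im z powr -\<alpha>) +
          cnj (F z) * cnj h * (of_real (Im z powr \<alpha>) * of_real (Im z powr -\<alpha>))"
        by (simp add: algebra_simps)
      also have "\<dots> = A z * h + B z * cnj h"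
        unfolding 1 2 A_def B_def B'_def by (simp add: algebra_simps)
      finally show "u z * of_real (Im h * (-\<alpha>) * Im z powr (-\<alpha> - 1)) +
        (a z * h + of_real (Im z powr \<alpha>) * cnj (F z) * cnj h) * of_real (Im z powr -\<alpha>)
        = A z * h + B z * cnj h" .
    qed
    ultimately show ?thesis by simp
  qed
  have contW: "continuous_on {z. 0 < Im z} W"
    unfolding W_def by (intro continuous_intros cont_u) auto
  have contA: "continuous_on {z. 0 < Im z} A"
    unfolding A_def by (intro continuous_intros cont_u cont_a) auto
  have contF: "continuous_on {z. 0 < Im z} F" by (rule holomorphic_on_imp_continuous_on[OF holF])
  have contB': "continuous_on {z. 0 < Im z} B'"
    unfolding B'_def by (intro continuous_intros cont_u) auto
  have contB: "continuous_on {z. 0 < Im z} B"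
    unfolding B_def by (intro continuous_intros contB' contF)
  define e where "e t = exp (2 * of_real pi * \<i> * of_real t)" for t :: real
  have e1: "cmod (e t) = 1" for t
    by (simp add: e_def norm_exp_eq_Re)
  have conte: "continuous_on S e" for S unfolding e_def by (intro continuous_intros)
  define q where "q \<rho> t = p + of_real \<rho> * e t" for \<rho> t :: real
  have qb: "q \<rho> t \<in> cball p (y / 2)" if "0 \<le> \<rho>" "\<rho> \<le> y / 2" for \<rho> t
    using that by (simp add: q_def dist_norm norm_mult e1)
  have Imq: "y / 2 \<le> Im (q \<rho> t) \<and> Im (q \<rho> t) \<le> 3 / 2 * y" if "0 \<le> \<rho>" "\<rho> \<le> y / 2" for \<rho> t
    using abs_Im_le_cmod[of "q \<rho> t - p"] qb[OF that, of t]
    by (auto simp: dist_norm norm_minus_commute y_def)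
  have qH: "0 < Im (q \<rho> t)" if "0 \<le> \<rho>" "\<rho> \<le> y / 2" for \<rho> t
    using Imq[OF that, of t] y by linarith
  have de: "(e has_vector_derivative (2 * of_real pi * \<i> * e t)) (at t)" for t
    unfolding e_def by (auto intro!: derivative_eq_intros has_vector_derivative_real_field)
  have dq1: "((\<lambda>\<rho>. q \<rho> t) has_vector_derivative e t) (at \<rho>)" for \<rho> t
    unfolding q_def by (auto intro!: derivative_eq_intros has_vector_derivative_real_field)
  have dq2: "((\<lambda>t. q \<rho> t) has_vector_derivative of_real \<rho> * (2 * of_real pi * \<i> * e t)) (at t)" for \<rho> t
    unfolding q_def by (auto intro!: derivative_eq_intros de)
  have chainW: "((\<lambda>s. W (g s)) has_vector_derivative (A (g s) * g' + B (g s) * cnj g')) (at s)"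
    if "(g has_vector_derivative g') (at s)" "0 < Im (g s)" for g g' s
  proof -
    have "((\<lambda>s. W (g s)) has_derivative (\<lambda>h. A (g s) * (h *\<^sub>R g') + B (g s) * cnj (h *\<^sub>R g'))) (at s)"
      using has_derivative_compose[OF that(1)[unfolded has_vector_derivative_def] dW[OF that(2)]] .
    then show ?thesis unfolding has_vector_derivative_def
      by (simp add: scaleR_conv_of_real algebra_simps)
  qed
  have ee: "e t * cnj (e t) = 1" for t using e1[of t] by (simp add: complex_norm_square[symmetric])
  \<comment> \<open>The integral of \<open>f \<rho>\<close> over \<open>{0..1}\<close> is the
    contour integral of \<open>W\<close> over the circle of radius \<rho>, divided by 2 pi \<i>;
    \<open>f'\<close> is the derivative in \<rho>.\<close>
  define f where "f \<rho> t = of_real \<rho> * (W (q \<rho> t) * e t)" for \<rho> t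
  define f' where "f' \<rho> t = W (q \<rho> t) * e t + of_real \<rho> * (A (q \<rho> t) * e t * e t + B (q \<rho> t))" for \<rho> t
  have df: "((\<lambda>\<rho>. f \<rho> t) has_vector_derivative f' \<rho> t) (at \<rho>)" if "0 \<le> \<rho>" "\<rho> \<le> y / 2" for \<rho> t
  proof -
    have r: "((\<lambda>\<rho>. complex_of_real \<rho>) has_vector_derivative 1) (at \<rho>)"
      by (auto intro!: derivative_eq_intros has_vector_derivative_real_field)
    have "((\<lambda>\<rho>. f \<rho> t) has_vector_derivative
        of_real \<rho> * ((A (q \<rho> t) * e t + B (q \<rho> t) * cnj (e t)) * e t) + 1 * (W (q \<rho> t) * e t)) (at \<rho>)"
      unfolding f_def
      by (intro has_vector_derivative_mult has_vector_derivative_mult_left chainW dq1 qH r that)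
    moreover have "of_real \<rho> * ((A (q \<rho> t) * e t + B (q \<rho> t) * cnj (e t)) * e t) + 1 * (W (q \<rho> t) * e t) = f' \<rho> t"
      using ee[of t] by (simp add: f'_def algebra_simps)
    ultimately show ?thesis by simp
  qed
  have contq: "continuous_on S (\<lambda>(\<rho>, t). q \<rho> t)" for S
    unfolding q_def case_prod_unfold by (intro continuous_intros continuous_on_compose2[OF conte[of UNIV]]) auto
  define U where "U = {0..y / 2}"
  have cq: "continuous_on (U \<times> cbox 0 1) (\<lambda>x. g (q (fst x) (snd x)))"
    if "continuous_on {z. 0 < Im z} g" for g :: "complex \<Rightarrow> complex"
    by (rule continuous_on_compose2[OF that]) (use contq qH in \<open>auto simp: case_prod_unfold U_def\<close>)
  have contf': "continuous_on (U \<times> cbox 0 1) (\<lambda>(\<rho>, t). f' \<rho> t)"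
    unfolding f'_def case_prod_unfold
    by (intro continuous_intros cq contW contA contB continuous_on_compose2[OF conte[of UNIV]]) auto
  have slice: "continuous_on {0..1} (\<lambda>t. g (q \<rho> t))"
    if "continuous_on {z. 0 < Im z} g" "\<rho> \<in> U" for g :: "complex \<Rightarrow> complex" and \<rho>
    by (rule continuous_on_compose2[OF that(1)])
      (use qH that(2) in \<open>auto simp: U_def q_def intro!: continuous_intros conte\<close>)
  have Qd: "((\<lambda>\<rho>. integral (cbox 0 1) (f \<rho>)) has_vector_derivative integral (cbox 0 1) (f' \<rho>)) (at \<rho> within U)"
    if "\<rho> \<in> U" for \<rho>
  proof (rule leibniz_rule_vector_derivative)
    show "((\<lambda>\<rho>. f \<rho> t) has_vector_derivative f' \<rho> t) (at \<rho> within U)" if "\<rho> \<in> U" for \<rho> t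
      using df that by (auto simp: U_def intro: has_vector_derivative_at_within)
    show "f \<rho> integrable_on cbox 0 1" if "\<rho> \<in> U" for \<rho>
      unfolding f_def using that
      by (intro integrable_continuous) (auto intro!: continuous_intros slice contW conte)
    show "continuous_on (U \<times> cbox 0 1) (\<lambda>(\<rho>, t). f' \<rho> t)" by (rule contf')
  qed (use that in \<open>auto simp: U_def\<close>)
  have B'bd: "cmod (B' (q \<rho> t)) \<le> M * (\<bar>\<alpha>\<bar> / 2 * (c * y powr (-\<alpha> - 1)))" if "\<rho> \<in> U" for \<rho> t
  proof -
    have "Im (q \<rho> t) powr (-\<alpha> - 1) \<le> c * y powr (-\<alpha> - 1)"
      using Imq[of \<rho> t] that by (intro powbd) (auto simp: U_def)
    moreover have "cmod (u (q \<rho> t)) \<le> M" using M qb that by (auto simp: U_def y_def)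
    moreover have "cmod (- \<i> * of_real (\<alpha> / 2 * Im (q \<rho> t) powr (-\<alpha> - 1)))
        = \<bar>\<alpha>\<bar> / 2 * Im (q \<rho> t) powr (-\<alpha> - 1)"
      by (simp only: norm_mult norm_of_real) (simp add: abs_mult)
    ultimately show ?thesis unfolding B'_def norm_mult[of "u _"]
      using M0 by (intro mult_mono) (auto intro!: divide_right_mono mult_left_mono)
  qed
  \<comment> \<open>Up to the factor 2 pi \<i>, f' - 2 \<rho> B is the t-derivative of W e, which
    integrates to 0 over the closed circle. What remains is 2 \<rho> times the mean of
    \<open>B\<close>, whose part cnj F has mean \<open>cnj (F p)\<close>.\<close>
  have f'int: "integral (cbox 0 1) (f' \<rho>) - 2 * of_real \<rho> * cnj (F p)
      = 2 * of_real \<rho> * integral {0..1} (\<lambda>t. B' (q \<rho> t))" if r: "\<rho> \<in> U" for \<rho>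
  proof -
    have "((\<lambda>t. W (q \<rho> t) * e t) has_vector_derivative
        2 * of_real pi * \<i> * (f' \<rho> t - 2 * of_real \<rho> * B (q \<rho> t))) (at t)" for t
    proof -
      have "((\<lambda>t. W (q \<rho> t) * e t) has_vector_derivative
         W (q \<rho> t) * (2 * of_real pi * \<i> * e t) + (A (q \<rho> t) * (of_real \<rho> * (2 * of_real pi * \<i> * e t)) +
           B (q \<rho> t) * cnj (of_real \<rho> * (2 * of_real pi * \<i> * e t))) * e t) (at t)"
        by (intro has_vector_derivative_mult chainW dq2 de qH) (use r in \<open>auto simp: U_def\<close>)
      moreover have "W (q \<rho> t) * (2 * of_real pi * \<i> * e t) + (A (q \<rho> t) * (of_real \<rho> * (2 * of_real pi * \<i> * e t)) +
           B (q \<rho> t) * cnj (of_real \<rho> * (2 * of_real pi * \<i> * e t))) * e t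
         = 2 * of_real pi * \<i> * (f' \<rho> t - 2 * of_real \<rho> * B (q \<rho> t)) +
           2 * of_real pi * \<i> * of_real \<rho> * B (q \<rho> t) * (1 - e t * cnj (e t))"
        unfolding f'_def by (simp add: algebra_simps)
      ultimately show ?thesis by (simp add: ee)
    qed
    then have "((\<lambda>t. 2 * of_real pi * \<i> * (f' \<rho> t - 2 * of_real \<rho> * B (q \<rho> t))) has_integral
        (W (q \<rho> 1) * e 1 - W (q \<rho> 0) * e 0)) {0..1}"
      by (intro fundamental_theorem_of_calculus) (auto intro: has_vector_derivative_at_within)
    moreover have "e 1 = 1" "e 0 = 1" unfolding e_def by simp_all
    moreover from this have "q \<rho> 1 = q \<rho> 0" by (simp add: q_def)
    ultimately have "((\<lambda>t. 2 * of_real pi * \<i> * (f' \<rho> t - 2 * of_real \<rho> * B (q \<rho> t))) has_integral 0) {0..1}"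
      by simp
    from has_integral_mult_right[OF this, of "1 / (2 * of_real pi * \<i>)"]
    have z: "((\<lambda>t. f' \<rho> t - 2 * of_real \<rho> * B (q \<rho> t)) has_integral 0) {0..1}" by simp
    have B'i: "((\<lambda>t. B' (q \<rho> t)) has_integral integral {0..1} (\<lambda>t. B' (q \<rho> t))) {0..1}"
      by (intro integrable_integral integrable_continuous_interval slice contB' r)
    have "((\<lambda>t. 2 * of_real \<rho> * cnj (F (q \<rho> t))) has_integral 2 * of_real \<rho> * cnj (F p)) {0..1}"
    proof (cases "\<rho> = 0")
      case False
      have "ball p y \<subseteq> {z. 0 < Im z}"
      proof
        fix z assume "z \<in> ball p y"
        then show "z \<in> {z. 0 < Im z}"
          using abs_Im_le_cmod[of "p - z"] by (auto simp: dist_norm y_def)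
      qed
      then have "F holomorphic_on ball p y" using holF holomorphic_on_subset by blast
      then have "((\<lambda>t. F (q \<rho> t)) has_integral F p) {0..1}"
        unfolding q_def e_def using r False y by (intro circle_mean_value) (auto simp: U_def)
      then have "((\<lambda>t. cnj (F (q \<rho> t))) has_integral cnj (F p)) {0..1}"
        using has_integral_linear[OF _ bounded_linear_cnj] by (auto simp: o_def)
      then show ?thesis by (rule has_integral_mult_right)
    qed simp
    from has_integral_add[OF has_integral_add[OF z this] has_integral_mult_right[OF B'i, of "2 * of_real \<rho>"]]
    have "(f' \<rho> has_integral 2 * of_real \<rho> * cnj (F p) + 2 * of_real \<rho> * integral {0..1} (\<lambda>t. B' (q \<rho> t))) {0..1}"
      by (simp add: B_def algebra_simps)
    then show ?thesis by (simp add: integral_unique)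
  qed
  define K where "K = y * (M * (\<bar>\<alpha>\<bar> / 2 * (c * y powr (-\<alpha> - 1))))"
  \<comment> \<open>Subtracting \<open>\<rho>\<^sup>2 * cnj (F p)\<close> removes the main term of
    the derivative; the rest is at most \<open>K\<close>, in which the factor y bounds 2
    \<rho>.\<close>
  let ?G = "\<lambda>\<rho>. integral (cbox 0 1) (f \<rho>) - of_real (\<rho>\<^sup>2) * cnj (F p)"
  have "norm (?G (y / 2) - ?G 0) \<le> K * norm (y / 2 - 0)"
  proof (rule differentiable_bound[of U _ "\<lambda>\<rho> h. h *\<^sub>R (integral (cbox 0 1) (f' \<rho>) - 2 * of_real \<rho> * cnj (F p))"])
    fix \<rho> assume r: "\<rho> \<in> U"
    have "((\<lambda>\<rho>. complex_of_real (\<rho>\<^sup>2)) has_vector_derivative 2 * of_real \<rho>) (at \<rho> within U)"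
      by (auto intro!: derivative_eq_intros has_vector_derivative_real_field simp: of_real_power)
    then have "(?G has_vector_derivative (integral (cbox 0 1) (f' \<rho>) - 2 * of_real \<rho> * cnj (F p))) (at \<rho> within U)"
      by (intro has_vector_derivative_diff Qd r has_vector_derivative_mult_left)
    then show "(?G has_derivative (\<lambda>h. h *\<^sub>R (integral (cbox 0 1) (f' \<rho>) - 2 * of_real \<rho> * cnj (F p)))) (at \<rho> within U)"
      by (simp add: has_vector_derivative_def)
    have "norm (integral {0..1} (\<lambda>t. B' (q \<rho> t))) \<le> (M * (\<bar>\<alpha>\<bar> / 2 * (c * y powr (-\<alpha> - 1)))) * (1 - 0)"
      by (intro integral_bound slice contB' r B'bd) auto
    then have "norm (integral (cbox 0 1) (f' \<rho>) - 2 * of_real \<rho> * cnj (F p)) \<le> K"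
      unfolding f'int[OF r] K_def norm_mult using r y M0 by (intro mult_mono) (auto simp: U_def)
    then show "onorm (\<lambda>h. h *\<^sub>R (integral (cbox 0 1) (f' \<rho>) - 2 * of_real \<rho> * cnj (F p))) \<le> K"
      by (intro onorm_le) (auto simp: mult.commute[of K] intro!: mult_left_mono)
  qed (use y in \<open>auto simp: U_def\<close>)
  moreover have "f 0 = (\<lambda>t. 0)" by (simp add: f_def fun_eq_iff)
  ultimately have 1: "cmod (?G (y / 2)) \<le> K * (y / 2)" using y by simp
  have 2: "cmod (integral (cbox 0 1) (f (y / 2))) \<le> (y / 2 * (M * (c * y powr -\<alpha>))) * (1 - 0)"
    unfolding box_real
  proof (rule integral_bound)
    show "continuous_on {0..1} (f (y / 2))"
      unfolding f_def using y by (intro continuous_intros slice contW conte) (auto simp: U_def)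
    fix t :: real assume "t \<in> {0..1}"
    have "Im (q (y/2) t) powr (-\<alpha>) \<le> c * y powr (-\<alpha>)"
      using Imq[of "y/2" t] y by (intro powbd) auto
    moreover have "cmod (u (q (y/2) t)) \<le> M" using M qb[of "y/2" t] y by (auto simp: y_def)
    ultimately have "cmod (W (q (y / 2) t)) \<le> M * (c * y powr -\<alpha>)"
      unfolding W_def norm_mult using M0 by (intro mult_mono) auto
    then show "cmod (f (y / 2) t) \<le> y / 2 * (M * (c * y powr -\<alpha>))"
      unfolding f_def norm_mult using y by (auto simp: e1)
  qed simp
  \<comment> \<open>Evaluation at \<rho> = y / 2. In the constant \<bar>\<alpha>\<bar> + 2 the
    summand 2 comes from the circle integral of \<open>W\<close> and \<bar>\<alpha>\<bar> from
    \<open>B'\<close>.\<close>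
  have "cmod (of_real ((y / 2)\<^sup>2) * cnj (F p)) \<le> cmod (integral (cbox 0 1) (f (y / 2))) + cmod (?G (y / 2))"
    using norm_triangle_ineq4[of "integral (cbox 0 1) (f (y / 2))" "?G (y / 2)"] by simp
  also have "\<dots> \<le> y / 2 * (M * (c * y powr -\<alpha>)) + K * (y / 2)" using 1 2 by simp
  also have "y powr -\<alpha> = y * y powr (-\<alpha> - 1)" using y by (simp add: powr_diff)
  finally have "(y / 2)\<^sup>2 * cmod (F p) \<le> (y / 2)\<^sup>2 * ((\<bar>\<alpha>\<bar> + 2) * c * M * y powr (-\<alpha> - 1))"
    using y by (simp add: norm_mult K_def power2_eq_square algebra_simps)
  then show ?thesis using y by (simp add: c_def y_def)
qed

end

section \<open>Uniform boundary behaviour of \<open>u\<close> and \<open>F\<close>\<close>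

lemma compact_slab: "compact {z. \<bar>Re z\<bar> \<le> R \<and> 0 \<le> Im z \<and> Im z \<le> T}"
proof -
  have "{z. \<bar>Re z\<bar> \<le> R \<and> 0 \<le> Im z \<and> Im z \<le> T} = cbox (Complex (-R) 0) (Complex R T)"
    by (auto simp: in_cbox_complex_iff)
  then show ?thesis by simp
qed

lemma cball_Im_Re:
  assumes "w \<in> cball z (Im z / 2)"
  shows "\<bar>Re w - Re z\<bar> \<le> Im z / 2" "Im z / 2 \<le> Im w" "Im w \<le> 3 / 2 * Im z" "cmod w \<le> 3 / 2 * cmod z"
proof -
  have d: "cmod (w - z) \<le> Im z / 2" using assms by (simp add: dist_norm norm_minus_commute)
  show "\<bar>Re w - Re z\<bar> \<le> Im z / 2" using abs_Re_le_cmod[of "w - z"] d by simp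
  show "Im z / 2 \<le> Im w" "Im w \<le> 3 / 2 * Im z" using abs_Im_le_cmod[of "w - z"] d by auto
  have "cmod w \<le> cmod z + cmod (w - z)" using norm_triangle_ineq[of z "w - z"] by simp
  then show "cmod w \<le> 3 / 2 * cmod z" using d abs_Im_le_cmod[of z] by linarith
qed

locale alpha_boundary = alpha_pair +
  assumes \<alpha>: "\<alpha> > -1"
    and bdry: "\<And>x::real. (u \<longlongrightarrow> 0) (at (of_real x) within {z. 0 < Im z})"
begin

text \<open>The boundary limits are taken over all approaches within the half-plane, so extension by
  0 is continuous up to the line. Compactness then turns the pointwise hypothesis into uniform
  statements.\<close>

lemma cont_ext: "continuous_on {z. 0 \<le> Im z} (\<lambda>z. if Im z = 0 then 0 else u z)"
  unfolding continuous_on_eq_continuous_within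
proof
  fix z assume z: "z \<in> {z. 0 \<le> Im z}"
  let ?U = "\<lambda>z. if Im z = 0 then 0 else u z"
  show "continuous (at z within {z. 0 \<le> Im z}) ?U"
  proof (cases "Im z = 0")
    case False
    have o: "open {z. 0 < Im z}" by (rule open_halfspace_Im_gt)
    have "continuous_on {z. 0 < Im z} ?U" by (rule continuous_on_eq[OF cont_u]) auto
    then have "continuous (at z) ?U"
      by (rule continuous_on_interior) (use z False o in \<open>auto simp: interior_open\<close>)
    then show ?thesis by (rule continuous_at_imp_continuous_at_within)
  next
    case True
    then have zr: "z = of_real (Re z)" by (simp add: complex_eq_iff)
    show ?thesis unfolding continuous_within_eps_delta
    proof (intro allI impI)
      fix e :: real assume "e > 0"
      then have "eventually (\<lambda>w. dist (u w) 0 < e) (at (of_real (Re z)) within {z. 0 < Im z})"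
        using bdry by (rule tendstoD[rotated])
      then obtain d where "d > 0" "\<And>w. 0 < Im w \<Longrightarrow> w \<noteq> z \<Longrightarrow> dist w z < d \<Longrightarrow> dist (u w) 0 < e"
        unfolding eventually_at zr[symmetric] by auto
      then show "\<exists>d>0. \<forall>w\<in>{z. 0 \<le> Im z}. dist w z < d \<longrightarrow> dist (?U w) (?U z) < e"
        using True \<open>e > 0\<close> by (intro exI[of _ d]) (auto simp: order_less_le)
    qed
  qed
qed

text \<open>Uniform continuity of the zero extension on a compact slab, comparing z with the
  boundary point \<open>Re z\<close>.\<close>

lemma u_small:
  assumes "e > 0"
  shows "\<exists>\<eta>>0. \<forall>z. \<bar>Re z\<bar> \<le> R \<and> 0 < Im z \<and> Im z < \<eta> \<longrightarrow> cmod (u z) < e"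
proof -
  let ?U = "\<lambda>z. if Im z = 0 then 0 else u z" and ?K = "{z. \<bar>Re z\<bar> \<le> R \<and> 0 \<le> Im z \<and> Im z \<le> 1}"
  have "uniformly_continuous_on ?K ?U"
    by (intro compact_uniformly_continuous compact_slab continuous_on_subset[OF cont_ext]) auto
  then have "\<exists>d>0. \<forall>z\<in>?K. \<forall>w\<in>?K. dist w z < d \<longrightarrow> dist (?U w) (?U z) < e"
    using assms unfolding uniformly_continuous_on_def by (elim allE[of _ e] impE)
  then obtain d where d: "d > 0" "\<And>z w. z \<in> ?K \<Longrightarrow> w \<in> ?K \<Longrightarrow> dist w z < d \<Longrightarrow> dist (?U w) (?U z) < e"
    by (elim exE conjE) (rule that, auto simp only:)
  have "cmod (u z) < e" if z: "\<bar>Re z\<bar> \<le> R" "0 < Im z" "Im z < min d 1" for z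
  proof -
    have "dist z (of_real (Re z)) = Im z" using z by (simp add: dist_norm cmod_def)
    then show ?thesis using d(2)[of "of_real (Re z)" z] z by auto
  qed
  then show ?thesis using d(1) by (intro exI[of _ "min d 1"]) auto
qed

lemma u_bounded: "\<exists>M\<ge>0. \<forall>z. \<bar>Re z\<bar> \<le> R \<and> 0 < Im z \<and> Im z \<le> T \<longrightarrow> cmod (u z) \<le> M"
proof -
  let ?U = "\<lambda>z. if Im z = 0 then 0 else u z" and ?K = "{z. \<bar>Re z\<bar> \<le> R \<and> 0 \<le> Im z \<and> Im z \<le> T}"
  have "bounded (?U ` ?K)"
    by (intro compact_imp_bounded compact_continuous_image compact_slab continuous_on_subset[OF cont_ext]) auto
  then obtain M where M: "\<And>z. z \<in> ?K \<Longrightarrow> cmod (?U z) \<le> M" unfolding bounded_iff by blast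
  have "cmod (u z) \<le> max M 0" if "\<bar>Re z\<bar> \<le> R" "0 < Im z" "Im z \<le> T" for z
    using M[of z] that by auto
  then show ?thesis by (intro exI[of _ "max M 0"]) auto
qed

definition F_const :: real where
  "F_const = (\<bar>\<alpha>\<bar> + 2) * 2 powr (\<bar>\<alpha>\<bar> + 1)"

lemma F_const_pos: "F_const > 0"
  unfolding F_const_def by (intro mult_pos_pos) auto

lemma F_bound':
  assumes "0 < Im p" "\<And>z. z \<in> cball p (Im p / 2) \<Longrightarrow> cmod (u z) \<le> M"
  shows "cmod (F p) \<le> F_const * M * Im p powr (-\<alpha> - 1)"
  using F_bound[OF assms] by (simp add: F_const_def)

text \<open>The little-o counterpart of \<open>F_locally_bounded\<close>: the disc of radius Im z /
  2 about z stays in the part of the slab of half-width R + 1 where \<open>u\<close> is small, and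
  \<open>F_bound'\<close> is linear in the bound for \<open>u\<close>.\<close>

lemma F_small:
  assumes "e > 0"
  shows "\<exists>\<eta>>0. \<forall>z. \<bar>Re z\<bar> \<le> R \<and> 0 < Im z \<and> Im z < \<eta> \<longrightarrow> cmod (F z) \<le> e * Im z powr (-\<alpha> - 1)"
proof -
  obtain \<eta> where \<eta>: "\<eta> > 0" "\<And>z. \<bar>Re z\<bar> \<le> R + 1 \<Longrightarrow> 0 < Im z \<Longrightarrow> Im z < \<eta> \<Longrightarrow> cmod (u z) < e / F_const"
    using u_small[of "e / F_const" "R + 1"] assms F_const_pos by auto
  have "cmod (F z) \<le> e * Im z powr (-\<alpha> - 1)" if z: "\<bar>Re z\<bar> \<le> R" "0 < Im z" "Im z < min (\<eta> / 2) 1" for z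
  proof -
    have "cmod (F z) \<le> F_const * (e / F_const) * Im z powr (-\<alpha> - 1)"
    proof (rule F_bound')
      fix w assume w: "w \<in> cball z (Im z / 2)"
      have "\<bar>Re w\<bar> \<le> R + 1" "0 < Im w" "Im w < \<eta>"
        using cball_Im_Re(1-3)[OF w] z by linarith+
      then show "cmod (u w) \<le> e / F_const" by (rule less_imp_le[OF \<eta>(2)])
    qed (use z in auto)
    then show ?thesis using F_const_pos by simp
  qed
  then show ?thesis using \<eta>(1) by (intro exI[of _ "min (\<eta> / 2) 1"]) auto
qed

lemma F_locally_bounded:
  "\<exists>M\<ge>0. \<forall>z. \<bar>Re z\<bar> \<le> R \<and> 0 < Im z \<and> Im z \<le> 1 \<longrightarrow> cmod (F z) \<le> M * Im z powr (-\<alpha> - 1)"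
proof -
  obtain M where M: "M \<ge> 0" "\<And>z. \<bar>Re z\<bar> \<le> R + 1 \<Longrightarrow> 0 < Im z \<Longrightarrow> Im z \<le> 2 \<Longrightarrow> cmod (u z) \<le> M"
    using u_bounded[of "R + 1" 2] by auto
  have "cmod (F z) \<le> F_const * M * Im z powr (-\<alpha> - 1)" if z: "\<bar>Re z\<bar> \<le> R" "0 < Im z" "Im z \<le> 1" for z
  proof (rule F_bound')
    fix w assume w: "w \<in> cball z (Im z / 2)"
    have "\<bar>Re w\<bar> \<le> R + 1" "0 < Im w" "Im w \<le> 2"
      using cball_Im_Re(1-3)[OF w] z by linarith+
    then show "cmod (u w) \<le> M" by (rule M(2))
  qed (use z in auto)
  then show ?thesis using F_const_pos M by (intro exI[of _ "F_const * M"]) auto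
qed

end

locale alpha_temperate = alpha_boundary +
  assumes temperate: "\<exists>C A N. \<forall>z. 0 < Im z \<longrightarrow> cmod (u z) \<le> C * (1 + cmod z) ^ A / Im z ^ N"
begin

lemma F_temperate:
  "\<exists>C\<ge>0. \<exists>A N. N > 0 \<and> (\<forall>z. 0 < Im z \<longrightarrow> cmod (F z) \<le> C * (1 + cmod z) ^ A / Im z ^ N)"
proof -
  obtain C A N where C: "\<And>z. 0 < Im z \<Longrightarrow> cmod (u z) \<le> C * (1 + cmod z) ^ A / Im z ^ N"
    using temperate by blast
  have C0: "C \<ge> 0"
  proof -
    have "0 \<le> cmod (u \<i>)" by simp
    also have "\<dots> \<le> C * 2 ^ A" using C[of \<i>] by simp
    finally show ?thesis by (simp add: zero_le_mult_iff power_le_zero_eq)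
  qed
  \<comment> \<open>The real power y^(-\<alpha>-1) is traded for an integer one;
    \<open>k > 0\<close> also supplies the positive exponent in the conclusion.\<close>
  define k where "k = nat \<lceil>\<alpha> + 1\<rceil>"
  have k: "\<alpha> + 1 \<le> real k" "k > 0" using \<alpha> by (auto simp: k_def)
  have pw: "y powr (-\<alpha> - 1) \<le> (1 + b) ^ k / y ^ k" if y: "0 < y" "y \<le> b" for y b :: real
  proof -
    have "y powr (-\<alpha> - 1) = y powr -(\<alpha> + 1)" by simp
    also have "\<dots> = (1 / y) powr (\<alpha> + 1)"
      using y by (simp only: powr_minus_divide powr_divide powr_one_eq_one)
    also have "\<dots> \<le> ((1 + b) / y) powr (\<alpha> + 1)"
      using y \<alpha> by (intro powr_mono2) (auto simp: divide_right_mono)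
    also have "\<dots> \<le> ((1 + b) / y) powr real k"
      using y k by (intro powr_mono) (auto simp: field_simps)
    also have "\<dots> = (1 + b) ^ k / y ^ k"
      using y by (simp add: powr_realpow power_divide)
    finally show ?thesis .
  qed
  define D where "D = F_const * (C * 2 ^ A * 2 ^ N)"
  have "cmod (F z) \<le> D * (1 + cmod z) ^ (A + k) / Im z ^ (N + k)" if z: "0 < Im z" for z
  proof -
    have "cmod (F z) \<le> F_const * (C * (2 * (1 + cmod z)) ^ A / (Im z / 2) ^ N) * Im z powr (-\<alpha> - 1)"
    proof (rule F_bound'[OF z])
      fix w assume w: "w \<in> cball z (Im z / 2)"
      have w1: "Im z / 2 \<le> Im w" "0 < Im w" and w2: "1 + cmod w \<le> 2 * (1 + cmod z)"
      proof -
        have "cmod w \<le> 3 / 2 * cmod z" "0 \<le> cmod z" using cball_Im_Re(4)[OF w] by auto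
        then show "1 + cmod w \<le> 2 * (1 + cmod z)" by argo
      qed (use cball_Im_Re(2)[OF w] z in linarith)+
      have "cmod (u w) \<le> C * (1 + cmod w) ^ A / Im w ^ N" by (rule C[OF w1(2)])
      also have "\<dots> \<le> C * (2 * (1 + cmod z)) ^ A / (Im z / 2) ^ N"
        using w1 w2 z C0 by (intro frac_le mult_left_mono power_mono mult_nonneg_nonneg) auto
      finally show "cmod (u w) \<le> C * (2 * (1 + cmod z)) ^ A / (Im z / 2) ^ N" .
    qed
    also have "\<dots> \<le> F_const * (C * (2 * (1 + cmod z)) ^ A / (Im z / 2) ^ N) * ((1 + cmod z) ^ k / Im z ^ k)"
      using pw[OF z, of "cmod z"] abs_Im_le_cmod[of z] z C0 F_const_pos by (intro mult_left_mono) auto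
    also have "\<dots> = D * (1 + cmod z) ^ (A + k) / Im z ^ (N + k)"
      unfolding D_def power_mult_distrib power_add power_divide by simp
    finally show ?thesis .
  qed
  moreover have "D \<ge> 0" using C0 F_const_pos by (simp add: D_def)
  moreover have "N + k > 0" using k by simp
  ultimately show ?thesis by blast
qed

end

section \<open>The fractional integral and its entire extension\<close>

text \<open>Differentiation under the integral for averages of \<open>f\<close> over homotheties
  with centre w. Each derivative contributes a factor 1 - s t, hence the passage from k to
  \<open>Suc k\<close>.\<close>

lemma has_field_derivative_average:
  fixes s :: "real \<Rightarrow> real"
  assumes s: "continuous_on {0..1} s" "\<And>t. t \<in> {0..1} \<Longrightarrow> s t \<in> {0..1}"
    and f: "f holomorphic_on {z. Im z < 0}" and w: "Im w < 0" and z0: "Im z0 < 0"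
  shows "((\<lambda>z. integral {0..1} (\<lambda>t. of_real ((1 - s t) ^ k) * f (of_real (1 - s t) * z + of_real (s t) * w)))
    has_field_derivative integral {0..1} (\<lambda>t. of_real ((1 - s t) ^ Suc k) * deriv f (of_real (1 - s t) * z0 + of_real (s t) * w)))
    (at z0)"
proof -
  let ?L = "{z. Im z < 0}"
  have oL: "open ?L" by (rule open_halfspace_Im_lt)
  have cL: "convex ?L" by (rule convex_halfspace_Im_lt)
  have inL: "of_real (1 - s t) * z + of_real (s t) * w \<in> ?L" if "z \<in> ?L" "t \<in> {0..1}" for z t
    using convexD[OF cL that(1), of w "1 - s t" "s t"] s(2)[OF that(2)] w
    by (auto simp: scaleR_conv_of_real)
  have cs: "continuous_on (?L \<times> {0..1}) (\<lambda>x. s (snd x))"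
    by (rule continuous_on_compose2[OF s(1)]) (auto intro!: continuous_intros)
  have ci: "continuous_on (?L \<times> {0..1}) (\<lambda>x. g (of_real (1 - s (snd x)) * fst x + of_real (s (snd x)) * w))"
    if "g holomorphic_on ?L" for g
    by (rule continuous_on_compose2[OF holomorphic_on_imp_continuous_on[OF that]])
      (use inL in \<open>auto intro!: continuous_intros cs\<close>)
  have "((\<lambda>z. integral (cbox 0 1) (\<lambda>t. of_real ((1 - s t) ^ k) * f (of_real (1 - s t) * z + of_real (s t) * w)))
    has_field_derivative integral (cbox 0 1) (\<lambda>t. of_real ((1 - s t) ^ Suc k) * deriv f (of_real (1 - s t) * z0 + of_real (s t) * w)))
    (at z0 within ?L)"
  proof (rule leibniz_rule_field_derivative)
    fix z and t :: real assume zt: "z \<in> ?L" "t \<in> cbox 0 1"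
    have "(f has_field_derivative deriv f (of_real (1 - s t) * z + of_real (s t) * w))
        (at (of_real (1 - s t) * z + of_real (s t) * w))"
      using holomorphic_derivI[OF f oL] inL zt by auto
    moreover have "((\<lambda>z. of_real (1 - s t) * z + of_real (s t) * w) has_field_derivative of_real (1 - s t)) (at z within ?L)"
      by (auto intro!: derivative_eq_intros)
    ultimately have "((\<lambda>z. f (of_real (1 - s t) * z + of_real (s t) * w)) has_field_derivative
        deriv f (of_real (1 - s t) * z + of_real (s t) * w) * of_real (1 - s t)) (at z within ?L)"
      by (rule DERIV_chain2)
    then show "((\<lambda>z. of_real ((1 - s t) ^ k) * f (of_real (1 - s t) * z + of_real (s t) * w)) has_field_derivative
       of_real ((1 - s t) ^ Suc k) * deriv f (of_real (1 - s t) * z + of_real (s t) * w)) (at z within ?L)"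
      by (auto intro!: derivative_eq_intros)
  next
    fix z assume z: "z \<in> ?L"
    have "continuous_on {0..1} (\<lambda>t. f (of_real (1 - s t) * z + of_real (s t) * w))"
      by (rule continuous_on_compose2[OF holomorphic_on_imp_continuous_on[OF f]])
        (use inL z in \<open>auto intro!: continuous_intros s(1)\<close>)
    then show "(\<lambda>t. of_real ((1 - s t) ^ k) * f (of_real (1 - s t) * z + of_real (s t) * w)) integrable_on cbox 0 1"
      unfolding box_real by (intro integrable_continuous_interval continuous_intros s(1))
  next
    have "deriv f holomorphic_on ?L" by (rule holomorphic_deriv[OF f oL])
    then show "continuous_on (?L \<times> cbox 0 1)
       (\<lambda>(z, t). of_real ((1 - s t) ^ Suc k) * deriv f (of_real (1 - s t) * z + of_real (s t) * w))"
      unfolding box_real case_prod_unfold by (intro continuous_intros ci cs)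
  qed (use z0 cL in auto)
  then show ?thesis using at_within_open[OF _ oL, of z0] z0 by simp
qed

lemma higher_deriv_average:
  fixes s :: "real \<Rightarrow> real"
  assumes s: "continuous_on {0..1} s" "\<And>t. t \<in> {0..1} \<Longrightarrow> s t \<in> {0..1}"
    and f: "f holomorphic_on {z. Im z < 0}" and w: "Im w < 0" and z: "Im z < 0"
  shows "(deriv ^^ k) (\<lambda>z. integral {0..1} (\<lambda>t. f (of_real (1 - s t) * z + of_real (s t) * w))) z
     = integral {0..1} (\<lambda>t. of_real ((1 - s t) ^ k) * (deriv ^^ k) f (of_real (1 - s t) * z + of_real (s t) * w))"
  using z
proof (induction k arbitrary: z)
  case (Suc k)
  let ?E = "\<lambda>z. integral {0..1} (\<lambda>t. f (of_real (1 - s t) * z + of_real (s t) * w))"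
  let ?T = "\<lambda>k z. integral {0..1} (\<lambda>t. of_real ((1 - s t) ^ k) * (deriv ^^ k) f (of_real (1 - s t) * z + of_real (s t) * w))"
  have "(?T k has_field_derivative ?T (Suc k) z) (at z)"
    using has_field_derivative_average[OF s holomorphic_higher_deriv[OF f open_halfspace_Im_lt] w Suc.prems, of k k]
    by simp
  then have "((deriv ^^ k) ?E has_field_derivative ?T (Suc k) z) (at z)"
    by (rule has_field_derivative_transform_within_open[OF _ open_halfspace_Im_lt[of 0]])
      (use Suc in auto)
  then show ?case by (simp add: DERIV_imp_deriv)
qed simp

context alpha_boundary
begin

definition G :: "complex \<Rightarrow> complex" where "G s = cnj (F (cnj s))"

lemma holG: "G holomorphic_on {z. Im z < 0}"
proof -
  have eq: "cnj ` {z. Im z < 0} = {z. 0 < Im z}"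
  proof (intro set_eqI iffI)
    fix z assume "z \<in> {z. 0 < Im z}"
    then show "z \<in> cnj ` {z. Im z < 0}" by (intro image_eqI[of _ _ "cnj z"]) auto
  qed auto
  have "cnj \<circ> F \<circ> cnj holomorphic_on {z. Im z < 0}"
    by (rule holomorphic_on_compose_cnj_cnj) (use holF open_halfspace_Im_lt in \<open>auto simp: eq\<close>)
  then show ?thesis by (rule holomorphic_transform) (simp add: G_def)
qed

text \<open>
  The function $E$ below is $(\alpha + 1) \int_0^1 t^\alpha G((1-t) z - i t)\, dt$, written in the variable
  $\tau = t^{\alpha+1}$ in order to have a continuous integrand also for $\alpha < 0$. For $-1 < \mathrm{Im}\, z < 0$,
  $(z + i)^{\alpha+1} E(z) = (\alpha + 1) \int_{-i}^z (z - s)^\alpha G(s)\, ds$.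
\<close>

definition sw :: "real \<Rightarrow> real" where "sw \<tau> = \<tau> powr (1 / (\<alpha> + 1))"

lemma sw_cont: "continuous_on {0..1} sw"
  unfolding sw_def using \<alpha> by (intro continuous_on_powr' continuous_intros) auto

lemma sw_01: "\<tau> \<in> {0..1} \<Longrightarrow> sw \<tau> \<in> {0..1}"
  unfolding sw_def using \<alpha> by (auto intro: powr_le1)

text \<open>As a function of z a homothety with centre -\<i>, which serves the derivatives of
  \<open>E\<close>; as a function of t the segment from z to -\<i>, which serves the contour
  integrals.\<close>

definition seg :: "complex \<Rightarrow> real \<Rightarrow> complex" where
  "seg z t = of_real (1 - t) * z + of_real t * (- \<i>)"

definition E :: "complex \<Rightarrow> complex" where
  "E z = integral {0..1} (\<lambda>\<tau>. G (seg z (sw \<tau>)))"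

lemma Im_seg: "Im (seg z t) = (1 - t) * Im z - t" and Re_seg: "Re (seg z t) = (1 - t) * Re z"
  by (simp_all add: seg_def)

lemma Im_seg_neg:
  assumes "Im z < 0" "0 \<le> t" "t \<le> 1"
  shows "Im (seg z t) < 0"
proof (cases "t = 0")
  case False
  have "(1 - t) * Im z \<le> 0" using assms by (intro mult_nonneg_nonpos) auto
  then show ?thesis using False assms by (simp add: Im_seg)
qed (use assms in \<open>simp add: Im_seg\<close>)

lemma E_higher_deriv:
  assumes "Im z < 0"
  shows "(deriv ^^ k) E z = integral {0..1} (\<lambda>\<tau>. of_real ((1 - sw \<tau>) ^ k) * (deriv ^^ k) G (seg z (sw \<tau>)))"
  unfolding E_def seg_def
  by (rule higher_deriv_average) (use sw_cont sw_01 holG assms in auto)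

lemma holE: "E holomorphic_on {z. Im z < 0}"
  unfolding holomorphic_on_def
proof
  fix z assume z: "z \<in> {z. Im z < 0}"
  have "(E has_field_derivative integral {0..1} (\<lambda>\<tau>. of_real ((1 - sw \<tau>) ^ Suc 0) * deriv G (seg z (sw \<tau>)))) (at z)"
    unfolding E_def seg_def
    using has_field_derivative_average[of sw G "- \<i>" z 0, OF sw_cont sw_01 holG] z by simp
  then show "E field_differentiable at z within {z. Im z < 0}"
    unfolding field_differentiable_def by (blast intro: has_field_derivative_at_within)
qed

text \<open>Since every \<open>seg\<close> fixes -\<i>, the k-th derivative of \<open>G\<close>
  leaves the integral in \<open>E_higher_deriv\<close>. The remaining Beta-type integral is nonzero:
  its integrand is continuous, nonnegative and equal to 1 at \<tau> = 0.\<close>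

lemma G_higher_deriv_0:
  assumes "(deriv ^^ k) E (- \<i>) = 0"
  shows "(deriv ^^ k) G (- \<i>) = 0"
proof -
  have "seg (- \<i>) t = - \<i>" for t by (simp add: seg_def complex_eq_iff)
  then have "integral {0..1} (\<lambda>\<tau>. of_real ((1 - sw \<tau>) ^ k)) * (deriv ^^ k) G (- \<i>) = 0"
    using assms by (simp add: E_higher_deriv)
  moreover have "((\<lambda>\<tau>. (1 - sw \<tau>) ^ k) has_integral integral {0..1} (\<lambda>\<tau>. (1 - sw \<tau>) ^ k)) {0..1}"
    by (intro integrable_integral integrable_continuous_interval continuous_intros sw_cont)
  then have "((\<lambda>\<tau>. complex_of_real ((1 - sw \<tau>) ^ k)) has_integral of_real (integral {0..1} (\<lambda>\<tau>. (1 - sw \<tau>) ^ k))) {0..1}"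
    by (rule has_integral_linear[OF _ bounded_linear_of_real, unfolded o_def])
  then have "integral {0..1} (\<lambda>\<tau>. complex_of_real ((1 - sw \<tau>) ^ k)) = of_real (integral {0..1} (\<lambda>\<tau>. (1 - sw \<tau>) ^ k))"
    by (rule integral_unique)
  moreover have "integral {0..1} (\<lambda>\<tau>. (1 - sw \<tau>) ^ k) \<noteq> 0"
  proof
    assume "integral {0..1} (\<lambda>\<tau>. (1 - sw \<tau>) ^ k) = 0"
    then have "\<forall>\<tau>\<in>{0..1}. (1 - sw \<tau>) ^ k = 0"
      by (subst (asm) integral_eq_0_iff)
        (use sw_01 in \<open>auto intro!: continuous_intros sw_cont\<close>)
    then have "(1 - sw 0) ^ k = 0" by (rule bspec) simp
    then show False by (simp add: sw_def)
  qed
  ultimately show ?thesis by simp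
qed

lemma contG_seg: "Im z < 0 \<Longrightarrow> continuous_on {0..1} (\<lambda>t. G (seg z t))"
  by (rule continuous_on_compose2[OF holomorphic_on_imp_continuous_on[OF holG]])
    (use Im_seg_neg in \<open>auto intro!: continuous_intros simp: seg_def[abs_def]\<close>)

lemma E_has_integral:
  assumes "Im z < 0"
  shows "((\<lambda>t. of_real ((\<alpha> + 1) * t powr \<alpha>) * G (seg z t)) has_integral E z) {0..1}"
proof -
  have "((\<lambda>t. ((\<alpha> + 1) * t powr \<alpha>) *\<^sub>R G (seg z (sw (t powr (\<alpha> + 1))))) has_integral
      integral {0 powr (\<alpha> + 1)..1 powr (\<alpha> + 1)} (\<lambda>\<tau>. G (seg z (sw \<tau>)))) {0..1}"
  \<comment> \<open>The point 0 is excepted because \<open>t powr (\<alpha> + 1)\<close> is not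
    differentiable there for \<alpha> < 0.\<close>
  proof (rule has_integral_substitution_strong[of "{0}" _ _ _ 0 1])
    show "continuous_on {0..1} (\<lambda>\<tau>. G (seg z (sw \<tau>)))"
      by (rule continuous_on_compose2[OF contG_seg[OF assms] sw_cont]) (use sw_01 in blast)
    show "continuous_on {0..1} (\<lambda>t. t powr (\<alpha> + 1))"
      using \<alpha> by (intro continuous_on_powr' continuous_intros) auto
    show "((\<lambda>t. t powr (\<alpha> + 1)) has_real_derivative (\<alpha> + 1) * t powr \<alpha>) (at t within {0..1})"
      if "t \<in> {0..1} - {0}" for t
      using that by (auto intro!: derivative_eq_intros)
  qed (use \<alpha> in \<open>auto intro!: powr_le1\<close>)
  moreover have "sw (t powr (\<alpha> + 1)) = t" if "t \<in> {0..1}" for t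
    using that \<alpha> by (simp add: sw_def powr_powr)
  ultimately show ?thesis
    unfolding E_def by (auto simp: scaleR_conv_of_real elim!: has_integral_eq[rotated])
qed

text \<open>Along the segment the height d is at least t and at least \<epsilon>. Splitting
  d^(-\<alpha>-1) into d^(\<delta>-\<alpha>-1) and d^(-\<delta>) gives t^(\<delta>-\<alpha>-1)
  \<epsilon>^(-\<delta>), and the weight t^\<alpha> leaves the integrable t^(\<delta>-1). Since
  \<delta> may be small, the gluing condition \<delta> < 1 can be met for every \<alpha>.\<close>

lemma E_locally_bounded:
  assumes \<delta>: "0 < \<delta>" "\<delta> \<le> \<alpha> + 1"
  shows "\<exists>C\<ge>0. \<forall>x \<epsilon>. \<bar>x\<bar> \<le> R \<and> 0 < \<epsilon> \<and> \<epsilon> < 1 \<longrightarrow> cmod (E (Complex x (-\<epsilon>))) \<le> C * \<epsilon> powr -\<delta>"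
proof -
  obtain M where M: "M \<ge> 0" "\<And>z. \<bar>Re z\<bar> \<le> R \<Longrightarrow> 0 < Im z \<Longrightarrow> Im z \<le> 1 \<Longrightarrow> cmod (F z) \<le> M * Im z powr (-\<alpha> - 1)"
    using F_locally_bounded[of R] by auto
  have "cmod (E (Complex x (-\<epsilon>))) \<le> ((\<alpha> + 1) * M / \<delta>) * \<epsilon> powr -\<delta>"
    if x: "\<bar>x\<bar> \<le> R" and e: "0 < \<epsilon>" "\<epsilon> < 1" for x \<epsilon>
  proof -
    let ?z = "Complex x (-\<epsilon>)" and ?K = "(\<alpha> + 1) * M * \<epsilon> powr -\<delta>"
    let ?f = "\<lambda>t. of_real ((\<alpha> + 1) * t powr \<alpha>) * G (seg ?z t)"
    have "norm (integral {0..1} ?f) \<le> integral {0..1} (\<lambda>t. ?K * t powr (\<delta> - 1))"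
    proof (rule integral_norm_bound_integral)
      show "?f integrable_on {0..1}" using E_has_integral[of ?z] e by (auto simp: has_integral_integrable)
      have i: "((\<lambda>t. t powr (\<delta> - 1)) has_integral 1 / \<delta>) {0..1}"
        using has_integral_powr_from_0[of "\<delta> - 1" 1] \<delta> by simp
      then show "(\<lambda>t. ?K * t powr (\<delta> - 1)) integrable_on {0..1}"
        by (intro integrable_on_mult_right) (auto simp: has_integral_integrable)
      fix t :: real assume t: "t \<in> {0..1}"
      show "norm (?f t) \<le> ?K * t powr (\<delta> - 1)"
      proof (cases "t = 0")
        case False
        let ?d = "(1 - t) * \<epsilon> + t"
        have d: "?d \<ge> t" using t e by simp
        have "?d - \<epsilon> = t * (1 - \<epsilon>)" by (simp add: algebra_simps)
        then have d': "?d \<ge> \<epsilon>" using t e by (smt (verit) atLeastAtMost_iff mult_nonneg_nonneg)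
        have "1 - ?d = (1 - t) * (1 - \<epsilon>)" by (simp add: algebra_simps)
        then have d1: "?d \<le> 1" using t e by (smt (verit) atLeastAtMost_iff mult_nonneg_nonneg)
        have "\<bar>Re (cnj (seg ?z t))\<bar> \<le> R"
          using t x mult_left_le_one_le[of "\<bar>x\<bar>" "1 - t"] by (auto simp: Re_seg abs_mult)
        then have "cmod (F (cnj (seg ?z t))) \<le> M * ?d powr (-\<alpha> - 1)"
          using M(2)[of "cnj (seg ?z t)"] d d1 False t by (simp add: Im_seg add.commute)
        also have "?d powr (-\<alpha> - 1) = ?d powr (\<delta> - \<alpha> - 1) * ?d powr -\<delta>"
          by (simp flip: powr_add)
        also have "\<dots> \<le> t powr (\<delta> - \<alpha> - 1) * \<epsilon> powr -\<delta>"
          using d d' e t False \<delta> by (intro mult_mono powr_mono2') auto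
        finally have "cmod (G (seg ?z t)) \<le> M * (t powr (\<delta> - \<alpha> - 1) * \<epsilon> powr -\<delta>)"
          using M(1) by (simp add: G_def mult_left_mono)
        then have "norm (?f t) \<le> (\<alpha> + 1) * t powr \<alpha> * (M * (t powr (\<delta> - \<alpha> - 1) * \<epsilon> powr -\<delta>))"
          unfolding norm_mult norm_of_real using \<alpha> by (intro mult_mono) auto
        also have "\<dots> = ?K * (t powr \<alpha> * t powr (\<delta> - \<alpha> - 1))" by simp
        also have "t powr \<alpha> * t powr (\<delta> - \<alpha> - 1) = t powr (\<delta> - 1)" by (simp flip: powr_add)
        finally show ?thesis .
      qed (use \<alpha> M in auto)
    qed
    also have "integral {0..1} ?f = E ?z" using E_has_integral[of ?z] e by (simp add: integral_unique)
    also have "integral {0..1} (\<lambda>t. ?K * t powr (\<delta> - 1)) = ?K * (1 / \<delta>)"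
      using has_integral_powr_from_0[of "\<delta> - 1" 1] \<delta> by (simp add: integral_unique)
    finally show ?thesis by simp
  qed
  moreover have "(\<alpha> + 1) * M / \<delta> \<ge> 0" using \<alpha> M \<delta> by simp
  ultimately show ?thesis by blast
qed

end

context alpha_temperate
begin

lemma G_seg_temperate:
  "\<exists>C\<ge>0. \<exists>A N. N > 0 \<and> (\<forall>z t. Im z < 0 \<and> 0 \<le> t \<and> t \<le> 1 \<longrightarrow>
      cmod (G (seg z t)) \<le> C * (1 + cmod z) ^ A / \<bar>Im z\<bar> ^ N)"
proof -
  obtain C A N where C: "C \<ge> 0" "N > 0" "\<And>z. 0 < Im z \<Longrightarrow> cmod (F z) \<le> C * (1 + cmod z) ^ A / Im z ^ N"
    using F_temperate by blast
  have "cmod (G (seg z t)) \<le> (C * 2 ^ A) * (1 + cmod z) ^ (A + N) / \<bar>Im z\<bar> ^ N"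
    if z: "Im z < 0" and t: "0 \<le> t" "t \<le> 1" for z t
  proof -
    define w where "w = cnj (seg z t)"
    have pos: "1 + cmod z > 0" by (simp add: add_pos_nonneg)
    \<comment> \<open>Both \<bar>Im z\<bar> and 1 are at least \<bar>Im z\<bar> / (1 + cmod z),
      hence so is their convex combination, the height of \<open>cnj (seg z t)\<close>.\<close>
    have a1: "\<bar>Im z\<bar> / (1 + cmod z) \<le> \<bar>Im z\<bar>"
      using divide_left_mono[of 1 "1 + cmod z" "\<bar>Im z\<bar>"] pos by simp
    have a2: "\<bar>Im z\<bar> / (1 + cmod z) \<le> 1"
      using abs_Im_le_cmod[of z] pos by (simp add: field_simps)
    have "(1 - t) * (\<bar>Im z\<bar> / (1 + cmod z)) + t * (\<bar>Im z\<bar> / (1 + cmod z)) \<le> (1 - t) * \<bar>Im z\<bar> + t * 1"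
      using t by (intro add_mono mult_left_mono a1 a2) auto
    then have "\<bar>Im z\<bar> / (1 + cmod z) \<le> (1 - t) * \<bar>Im z\<bar> + t"
      by (simp only: distrib_right[symmetric]) simp
    then have w1: "\<bar>Im z\<bar> / (1 + cmod z) \<le> Im w" using z by (simp add: w_def Im_seg)
    have w0: "0 < Im w" using Im_seg_neg[OF z t] by (simp add: w_def)
    have "cmod w \<le> cmod (of_real (1 - t) * z) + cmod (of_real t * (- \<i>))"
      unfolding w_def seg_def complex_mod_cnj by (rule norm_triangle_ineq)
    also have "\<dots> \<le> cmod z + 1"
      using t by (intro add_mono) (auto simp: norm_mult mult_left_le_one_le simp del: of_real_diff)
    finally have w2: "1 + cmod w \<le> 2 * (1 + cmod z)" using norm_ge_zero[of z] by argo
    have b: "0 < \<bar>Im z\<bar> / (1 + cmod z)" using z by (intro divide_pos_pos pos) simp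
    have "cmod (G (seg z t)) = cmod (F w)" by (simp add: G_def w_def)
    also have "\<dots> \<le> C * (1 + cmod w) ^ A / Im w ^ N" by (rule C(3)[OF w0])
    also have "\<dots> \<le> C * (2 * (1 + cmod z)) ^ A / (\<bar>Im z\<bar> / (1 + cmod z)) ^ N"
      using C(1) w0 w2
      by (intro frac_le mult_left_mono power_mono mult_nonneg_nonneg zero_less_power less_imp_le[OF b] b w1) auto
    also have "\<dots> = (C * 2 ^ A) * (1 + cmod z) ^ (A + N) / \<bar>Im z\<bar> ^ N"
      unfolding power_mult_distrib power_add power_divide by simp
    finally show ?thesis .
  qed
  moreover have "C * 2 ^ A \<ge> 0" using C by simp
  ultimately show ?thesis using C(2) by blast
qed

end

section \<open>The kernel integral \<open>J\<close> and holomorphy of \<open>h\<close>\<close>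

lemma cmod_powr_of_real: "cmod (z powr of_real a) = cmod z powr a"
  by (auto simp: powr_def)

lemma powr_of_real_mult:
  fixes z :: complex
  assumes "0 < r" "z \<noteq> 0"
  shows "(of_real r * z) powr of_real a = of_real (r powr a) * z powr of_real a"
  using assms by (simp add: powr_def Ln_times_of_real ring_distribs exp_add Ln_of_real flip: exp_of_real)

lemma Im_pos_nonpos_Reals: "0 < Im z \<Longrightarrow> z \<notin> \<real>\<^sub>\<le>\<^sub>0"
  by (auto simp: complex_nonpos_Reals_iff)

lemma diff_nonpos_Reals: "0 < Im z \<Longrightarrow> Im s < 0 \<Longrightarrow> z - s \<notin> \<real>\<^sub>\<le>\<^sub>0"
  by (rule Im_pos_nonpos_Reals) simp

lemma linepath_neg:
  assumes "Im v < 0" "Im w < 0"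
  shows "closed_segment v w \<subseteq> {s. Im s < 0}"
  using assms by (intro closed_segment_subset convex_halfspace_Im_lt) auto

lemma contour_integral_linepath_eq:
  "contour_integral (linepath v w) f = (w - v) * integral {0..1} (\<lambda>t. f (linepath v w t))"
  by (simp add: contour_integral_integral mult.commute)

context alpha_boundary
begin

text \<open>For z above and s below the real line, z - s lies in the upper half-plane, off the cut
  of the principal power.\<close>

definition ker :: "complex \<Rightarrow> complex \<Rightarrow> complex" where
  "ker z s = (z - s) powr of_real \<alpha> * G s"

text \<open>
  $J(z) = \int_{-i}^{\bar z} (z - s)^\alpha G(s)\, ds$ has the same $\bar\partial$-derivative as $(2i)^\alpha u$,
  so the function $h$ below is holomorphic.
\<close>

definition J :: "complex \<Rightarrow> complex" where
  "J z = - contour_integral (linepath (cnj z) (- \<i>)) (ker z)"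

definition h :: "complex \<Rightarrow> complex" where
  "h z = of_real (\<alpha> + 1) * (J z - (2 * \<i>) powr of_real \<alpha> * u z)"

lemma ker_holomorphic: "0 < Im z \<Longrightarrow> ker z holomorphic_on {s. Im s < 0}"
  unfolding ker_def using holG
  by (intro holomorphic_intros) (auto dest: diff_nonpos_Reals)

lemma ker_integrable:
  assumes "0 < Im z" "Im v < 0" "Im w < 0"
  shows "ker z contour_integrable_on linepath v w"
  by (intro contour_integrable_continuous_linepath continuous_on_subset[OF holomorphic_on_imp_continuous_on[OF ker_holomorphic]]
      linepath_neg assms)

text \<open>With a fixed path only the parameter of the kernel varies, so the integral is complex
  differentiable. Existence of \<open>D\<close> suffices, because holomorphy of \<open>h\<close> is
  decided by the coefficient of the conjugate.\<close>

lemma J_field_deriv: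
  assumes z: "0 < Im z" and vw: "Im v < 0" "Im w < 0"
  shows "\<exists>D. ((\<lambda>z. contour_integral (linepath v w) (ker z)) has_field_derivative D) (at z)"
proof -
  let ?H = "{z. 0 < Im z}" and ?p = "linepath v w"
  let ?f' = "\<lambda>z t. of_real \<alpha> * (z - ?p t) powr (of_real \<alpha> - 1) * G (?p t)"
  have oH: "open ?H" by (rule open_halfspace_Im_gt)
  have p: "Im (?p t) < 0" if "t \<in> {0..1}" for t
    using linepath_neg[OF vw] linepath_in_path[OF that, of v w] by auto
  have pd: "0 < Im (z - ?p t)" if "0 < Im z" "t \<in> {0..1}" for z t
    using p[OF that(2)] that(1) by simp
  have cG: "continuous_on {0..1} (\<lambda>t. G (?p t))"
    by (rule continuous_on_compose2[OF holomorphic_on_imp_continuous_on[OF holG]]) (use p in auto)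
  have "((\<lambda>z. integral (cbox 0 1) (\<lambda>t. ker z (?p t))) has_field_derivative integral (cbox 0 1) (?f' z)) (at z within ?H)"
  proof (rule leibniz_rule_field_derivative)
    fix z and t :: real assume zt: "z \<in> ?H" "t \<in> cbox 0 1"
    then have "z - ?p t \<notin> \<real>\<^sub>\<le>\<^sub>0" using pd[of z t] by (intro Im_pos_nonpos_Reals) auto
    then have "((\<lambda>z. (z - ?p t) powr of_real \<alpha>) has_field_derivative of_real \<alpha> * (z - ?p t) powr (of_real \<alpha> - 1)) (at z within ?H)"
      by (auto intro!: derivative_eq_intros)
    then show "((\<lambda>z. ker z (?p t)) has_field_derivative ?f' z t) (at z within ?H)"
      unfolding ker_def by (intro DERIV_cmult_right)
  next
    fix z assume "z \<in> ?H"
    then show "(\<lambda>t. ker z (?p t)) integrable_on cbox 0 1"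
      unfolding box_real
      by (intro integrable_continuous_interval continuous_on_linepath
          continuous_on_compose2[OF holomorphic_on_imp_continuous_on[OF ker_holomorphic[of z]]]) (use p in auto)
  next
    have "continuous_on (?H \<times> {0..1}) (\<lambda>x. G (?p (snd x)))"
      by (rule continuous_on_compose2[OF cG]) (auto intro!: continuous_intros)
    moreover have "continuous_on (?H \<times> {0..1}) (\<lambda>x. ?p (snd x))"
      by (rule continuous_on_compose2[OF continuous_on_linepath[of UNIV]]) (auto intro!: continuous_intros)
    moreover have cp: "continuous_on ?H (\<lambda>z. z powr c)" for c
      by (intro holomorphic_on_imp_continuous_on holomorphic_intros) (auto dest: Im_pos_nonpos_Reals)
    moreover have diff_nonpos: "Im (?p t) < Im z" if "0 < Im z" "0 \<le> t" "t \<le> 1" for z t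
      using that p[of t] by auto
    ultimately show "continuous_on (?H \<times> cbox 0 1) (\<lambda>(z, t). ?f' z t)"
      unfolding box_real case_prod_unfold
      by (intro continuous_on_mult continuous_on_const continuous_on_compose2[OF cp] continuous_on_diff
          continuous_on_fst continuous_on_id) (use p in \<open>auto intro!: diff_nonpos\<close>)
  qed (use z convex_halfspace_Im_gt in auto)
  then have "((\<lambda>z. integral {0..1} (\<lambda>t. ker z (?p t))) has_field_derivative integral (cbox 0 1) (?f' z)) (at z)"
    using at_within_open[OF _ oH, of z] z by simp
  then have "((\<lambda>z. (w - v) * integral {0..1} (\<lambda>t. ker z (?p t))) has_field_derivative (w - v) * integral (cbox 0 1) (?f' z)) (at z)"
    by (rule DERIV_cmult)
  then have "((\<lambda>z. contour_integral (linepath v w) (ker z)) has_field_derivative (w - v) * integral (cbox 0 1) (?f' z)) (at z)"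
    by (rule has_field_derivative_transform_within_open[OF _ oH])
      (use z vw in \<open>auto simp: contour_integral_linepath_eq\<close>)
  then show ?thesis by blast
qed

text \<open>Cauchy's theorem on the triangle cnj z1, cnj z, -\<i> splits \<open>J\<close> into
  \<open>P\<close>, with a fixed path and so complex differentiable, and \<open>R\<close>, over the
  short segment from cnj z1 to cnj z, which produces the conjugate term.\<close>

lemma J_has_derivative:
  assumes z1: "0 < Im z1"
  shows "\<exists>D. (J has_derivative (\<lambda>k. D * k + ker z1 (cnj z1) * cnj k)) (at z1)"
proof -
  let ?H = "{z. 0 < Im z}" and ?L = "{z. Im z < 0}"
  define P where "P z = - contour_integral (linepath (cnj z1) (- \<i>)) (ker z)" for z
  define R where "R z = contour_integral (linepath (cnj z1) (cnj z)) (ker z)" for z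
  define c where "c = ker z1 (cnj z1)"
  obtain D where "(P has_field_derivative D) (at z1)"
    using J_field_deriv[OF z1, of "cnj z1" "- \<i>"] z1 unfolding P_def by (auto dest: DERIV_minus)
  then have dP: "(P has_derivative (\<lambda>k. D * k)) (at z1)" by (simp add: has_field_derivative_def)
  have JPR: "J z = P z + R z" if z: "0 < Im z" for z
  proof -
    have "convex hull {cnj z1, cnj z, - \<i>} \<subseteq> ?L"
      by (rule hull_minimal) (use z z1 convex_halfspace_Im_lt in auto)
    then have "ker z holomorphic_on convex hull {cnj z1, cnj z, - \<i>}"
      by (rule holomorphic_on_subset[OF ker_holomorphic[OF z]])
    then have "(ker z has_contour_integral 0) (linepath (cnj z1) (cnj z) +++ linepath (cnj z) (- \<i>) +++ linepath (- \<i>) (cnj z1))"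
      by (rule Cauchy_theorem_triangle)
    then have "contour_integral (linepath (cnj z1) (cnj z)) (ker z) + contour_integral (linepath (cnj z) (- \<i>)) (ker z)
       + contour_integral (linepath (- \<i>) (cnj z1)) (ker z) = 0"
      by (rule has_chain_integral_chain_integral3)
    moreover have "contour_integral (linepath (- \<i>) (cnj z1)) (ker z) = - contour_integral (linepath (cnj z1) (- \<i>)) (ker z)"
      using contour_integral_reversepath[of "linepath (cnj z1) (- \<i>)" "ker z"] by simp
    ultimately show ?thesis unfolding J_def P_def R_def by (simp add: algebra_simps eq_neg_iff_add_eq_0)
  qed
  \<comment> \<open>Joint continuity is required since both arguments of \<open>ker\<close> move in
    \<open>R\<close>: z as parameter and s along the short segment.\<close>
  have contk: "continuous_on (?H \<times> ?L) (\<lambda>(z, s). ker z s)"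
    unfolding ker_def case_prod_unfold
    by (intro continuous_intros continuous_on_compose2[OF holomorphic_on_imp_continuous_on[OF holG]])
      (auto intro!: Im_pos_nonpos_Reals)
  have "(R has_derivative (\<lambda>k. c * cnj k)) (at z1)"
    unfolding has_derivative_at_alt
  proof (intro conjI allI impI)
    show "bounded_linear (\<lambda>k. c * cnj k)"
      by (intro bounded_linear_const_mult bounded_linear_cnj)
    fix e :: real assume e: "e > 0"
    have "open (?H \<times> ?L)" by (intro open_Times open_halfspace_Im_gt open_halfspace_Im_lt)
    moreover have zz: "(z1, cnj z1) \<in> ?H \<times> ?L" using z1 by simp
    ultimately have "continuous (at (z1, cnj z1)) (\<lambda>(z, s). ker z s)"
      using contk continuous_on_eq_continuous_at by blast
    then obtain d where d: "d > 0" "\<And>x. dist x (z1, cnj z1) < d \<Longrightarrow> dist (case x of (z, s) \<Rightarrow> ker z s) c < e"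
      unfolding continuous_at_eps_delta c_def using e by fastforce
    have "cmod (R z - R z1 - c * cnj (z - z1)) \<le> e * cmod (z - z1)"
      if "cmod (z - z1) < min (d / 2) (Im z1)" for z
    proof -
      have zd: "cmod (z - z1) < d / 2" "cmod (z - z1) < Im z1" using that by auto
      have z: "0 < Im z" using abs_Im_le_cmod[of "z - z1"] zd by auto
      have cc: "((\<lambda>s. c) has_contour_integral c * (cnj z - cnj z1)) (linepath (cnj z1) (cnj z))"
        by (rule has_contour_integral_const_linepath)
      have "(ker z has_contour_integral R z) (linepath (cnj z1) (cnj z))"
        unfolding R_def using z z1 by (intro has_contour_integral_integral ker_integrable) auto
      from has_contour_integral_diff[OF this cc]
      have "cmod (R z - c * (cnj z - cnj z1)) \<le> e * cmod (cnj z - cnj z1)"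
      proof (rule has_contour_integral_bound_linepath)
        fix s assume s: "s \<in> closed_segment (cnj z1) (cnj z)"
        have "cmod (s - cnj z1) \<le> cmod (cnj z - cnj z1)" by (rule segment_bound1[OF s])
        also have "\<dots> = cmod (z - z1)" by (metis complex_cnj_diff complex_mod_cnj)
        finally have "cmod (s - cnj z1) < d / 2" using zd by simp
        moreover have "dist (z, s) (z1, cnj z1) \<le> cmod (z - z1) + cmod (s - cnj z1)"
          unfolding dist_Pair_Pair unfolding dist_norm by (rule sqrt_sum_squares_le_sum) auto
        ultimately have "dist (z, s) (z1, cnj z1) < d" using zd by linarith
        then show "cmod (ker z s - c) \<le> e" using d(2)[of "(z, s)"] by (simp add: dist_norm)
      qed (use e in auto)
      moreover have "R z1 = 0" by (simp add: R_def)
      moreover have "cmod (cnj z - cnj z1) = cmod (z - z1)" by (metis complex_cnj_diff complex_mod_cnj)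
      ultimately show ?thesis by simp
    qed
    then show "\<exists>d>0. \<forall>z. norm (z - z1) < d \<longrightarrow> norm (R z - R z1 - c * cnj (z - z1)) \<le> e * norm (z - z1)"
      using d(1) z1 by (intro exI[of _ "min (d / 2) (Im z1)"]) auto
  qed
  from has_derivative_add[OF dP this]
  have "((\<lambda>z. P z + R z) has_derivative (\<lambda>k. D * k + c * cnj k)) (at z1)" .
  then have "(J has_derivative (\<lambda>k. D * k + c * cnj k)) (at z1)"
    by (rule has_derivative_transform_within_open[OF _ open_halfspace_Im_gt[of 0]]) (use z1 JPR in auto)
  then show ?thesis unfolding c_def by blast
qed

lemma holh: "h holomorphic_on {z. 0 < Im z}"
  unfolding holomorphic_on_def
proof
  fix z assume "z \<in> {z. 0 < Im z}"
  then have z: "0 < Im z" by simp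
  obtain D where D: "(J has_derivative (\<lambda>k. D * k + ker z (cnj z) * cnj k)) (at z)"
    using J_has_derivative[OF z] by blast
  \<comment> \<open>The origin of the factor (2 \<i>)^\<alpha> in \<open>h\<close>: at s = cnj z the
    kernel is (2 \<i>)^\<alpha> times the dbar derivative of \<open>u\<close>, so the conjugate
    parts cancel.\<close>
  have "z - cnj z = of_real (Im z) * (2 * \<i>)" by (simp add: complex_eq_iff)
  then have k: "ker z (cnj z) = (2 * \<i>) powr of_real \<alpha> * (of_real (Im z powr \<alpha>) * cnj (F z))"
    unfolding ker_def G_def using z by (simp add: powr_of_real_mult)
  have "(h has_derivative (\<lambda>k. of_real (\<alpha> + 1) * ((D * k + ker z (cnj z) * cnj k) -
      (2 * \<i>) powr of_real \<alpha> * (a z * k + of_real (Im z powr \<alpha>) * cnj (F z) * cnj k)))) (at z)"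
    unfolding h_def by (intro has_derivative_mult_right has_derivative_diff D deriv_u z)
  moreover have "(\<lambda>k. of_real (\<alpha> + 1) * ((D * k + ker z (cnj z) * cnj k) -
      (2 * \<i>) powr of_real \<alpha> * (a z * k + of_real (Im z powr \<alpha>) * cnj (F z) * cnj k)))
      = (\<lambda>k. of_real (\<alpha> + 1) * (D - (2 * \<i>) powr of_real \<alpha> * a z) * k)"
    unfolding k by (simp add: algebra_simps fun_eq_iff)
  ultimately have "(h has_field_derivative of_real (\<alpha> + 1) * (D - (2 * \<i>) powr of_real \<alpha> * a z)) (at z)"
    by (simp add: has_field_derivative_def)
  then show "h field_differentiable at z within {z. 0 < Im z}"
    unfolding field_differentiable_def by (blast intro: has_field_derivative_at_within)
qed

end

section \<open>Equality of the boundary values of \<open>h\<close> and of the weighted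
  \<open>E\<close>\<close>

text \<open>Compares the kernels (z - s)^\<alpha> and (cnj z - s)^\<alpha>, powers of t \<zeta> + 2
  \<epsilon> \<i> and of t \<zeta>. For \<epsilon> \<le> t the mean value inequality works, all
  moduli being comparable to t; for t < \<epsilon> the triangle inequality is enough. The term (t /
  (t + \<epsilon>))^\<alpha> accounts for the singularity t^\<alpha> when \<alpha> < 0.\<close>

lemma powr_increment_bound:
  fixes \<alpha> t \<epsilon> R :: real
  assumes t: "0 < t" and e: "0 < \<epsilon>" "\<epsilon> \<le> 1/2" and R: "0 \<le> R"
    and \<zeta>: "1/2 \<le> Im \<zeta>" "Im \<zeta> = 1 - \<epsilon>" "cmod \<zeta> \<le> R + 1"
  shows "cmod ((of_real t * \<zeta> + 2 * of_real \<epsilon> * \<i>) powr of_real \<alpha> - (of_real t * \<zeta>) powr of_real \<alpha>)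
    \<le> 4 * (\<bar>\<alpha>\<bar> + 1) * (R + 3) powr (\<bar>\<alpha>\<bar> + 1) * (\<epsilon> / (t + \<epsilon>) * (t + \<epsilon>) powr \<alpha> * ((t / (t + \<epsilon>)) powr \<alpha> + 1))"
    (is "_ \<le> ?C * (\<epsilon> / ?s * ?s powr \<alpha> * (?r powr \<alpha> + 1))")
proof -
  define B where "B = R + 3"
  have B: "B \<ge> 3" using R by (simp add: B_def)
  have s: "?s > 0" using t e by simp
  have sr: "?s powr \<alpha> * ?r powr \<alpha> = t powr \<alpha>"
    using t s by (simp flip: powr_mult)
  let ?w = "\<lambda>\<tau>. of_real t * \<zeta> + of_real \<tau> * (2 * of_real \<epsilon> * \<i>)"
  have wlow: "t / 2 \<le> cmod (?w \<tau>)" "0 < Im (?w \<tau>)" if "0 \<le> \<tau>" for \<tau>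
  proof -
    have "t / 2 \<le> t * Im \<zeta>" using t \<zeta> by simp
    also have "\<dots> \<le> Im (?w \<tau>)" using that e by simp
    finally have *: "t / 2 \<le> Im (?w \<tau>)" .
    then show "t / 2 \<le> cmod (?w \<tau>)" using abs_Im_le_cmod[of "?w \<tau>"] by linarith
    show "0 < Im (?w \<tau>)" using * t by linarith
  qed
  have whigh: "cmod (?w \<tau>) \<le> (R + 1) * t + 2 * \<epsilon>" if "0 \<le> \<tau>" "\<tau> \<le> 1" for \<tau>
  proof -
    have "cmod (?w \<tau>) \<le> cmod (of_real t * \<zeta>) + cmod (of_real \<tau> * (2 * of_real \<epsilon> * \<i>))"
      by (rule norm_triangle_ineq)
    also have "\<dots> = t * cmod \<zeta> + \<tau> * (2 * \<epsilon>)" using t e that by (simp add: norm_mult)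
    also have "\<dots> \<le> t * (R + 1) + 1 * (2 * \<epsilon>)"
      using t e that \<zeta> by (intro add_mono mult_left_mono mult_right_mono) auto
    finally show ?thesis by (simp add: mult.commute)
  qed
  have w01: "?w 0 = of_real t * \<zeta>" "?w 1 = of_real t * \<zeta> + 2 * of_real \<epsilon> * \<i>" by simp_all
  have Bp: "B powr \<bar>b\<bar> \<le> B powr (\<bar>\<alpha>\<bar> + 1)" if "\<bar>b\<bar> \<le> \<bar>\<alpha>\<bar> + 1" for b
    using B that by (intro powr_mono) auto
  show ?thesis
  proof (cases "\<epsilon> \<le> t")
    case True
    have d: "((\<lambda>\<tau>. ?w \<tau> powr of_real \<alpha>) has_vector_derivative
        (2 * of_real \<epsilon> * \<i>) * (of_real \<alpha> * ?w \<tau> powr (of_real \<alpha> - 1))) (at \<tau>)" if "0 \<le> \<tau>" for \<tau>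
    proof -
      have 1: "(?w has_vector_derivative (2 * of_real \<epsilon> * \<i>)) (at \<tau>)"
        by (auto intro!: derivative_eq_intros has_vector_derivative_real_field)
      have 2: "((\<lambda>w. w powr of_real \<alpha>) has_field_derivative of_real \<alpha> * ?w \<tau> powr (of_real \<alpha> - 1)) (at (?w \<tau>))"
        using wlow(2)[OF that] by (intro has_field_derivative_powr) (auto simp: complex_nonpos_Reals_iff)
      from field_vector_diff_chain_at[OF 1 2] show ?thesis by (simp only: o_def)
    qed
    have "norm (?w 1 powr of_real \<alpha> - ?w 0 powr of_real \<alpha>)
        \<le> (2 * \<epsilon> * (\<bar>\<alpha>\<bar> * (B powr (\<bar>\<alpha>\<bar> + 1) * t powr (\<alpha> - 1)))) * norm (1 - 0 :: real)"
    proof (rule differentiable_bound[of "{0..1::real}" _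
          "\<lambda>\<tau> h. h *\<^sub>R ((2 * of_real \<epsilon> * \<i>) * (of_real \<alpha> * ?w \<tau> powr (of_real \<alpha> - 1)))"])
      fix \<tau> :: real assume tau: "\<tau> \<in> {0..1}"
      then show "((\<lambda>\<tau>. ?w \<tau> powr of_real \<alpha>) has_derivative
          (\<lambda>h. h *\<^sub>R ((2 * of_real \<epsilon> * \<i>) * (of_real \<alpha> * ?w \<tau> powr (of_real \<alpha> - 1))))) (at \<tau> within {0..1})"
        using d[of \<tau>] unfolding has_vector_derivative_def by (auto intro: has_derivative_at_withinI)
      have "t / B \<le> t / 2" using t B by (intro divide_left_mono) auto
      then have "t / B \<le> cmod (?w \<tau>)" by (rule order_trans) (use wlow(1) tau in auto)
      moreover have "cmod (?w \<tau>) \<le> B * t" using whigh[of \<tau>] tau True by (simp add: B_def algebra_simps)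
      ultimately have "cmod (?w \<tau>) powr (\<alpha> - 1) \<le> B powr \<bar>\<alpha> - 1\<bar> * t powr (\<alpha> - 1)"
        using t B by (intro powr_comparable) auto
      also have "\<dots> \<le> B powr (\<bar>\<alpha>\<bar> + 1) * t powr (\<alpha> - 1)"
        by (intro mult_right_mono Bp) auto
      finally have 3: "cmod (?w \<tau>) powr (\<alpha> - 1) \<le> B powr (\<bar>\<alpha>\<bar> + 1) * t powr (\<alpha> - 1)" .
      have "cmod (?w \<tau> powr (of_real \<alpha> - 1)) = cmod (?w \<tau>) powr (\<alpha> - 1)"
        using cmod_powr_of_real[of "?w \<tau>" "\<alpha> - 1"] by simp
      then have 4: "norm ((2 * of_real \<epsilon> * \<i>) * (of_real \<alpha> * ?w \<tau> powr (of_real \<alpha> - 1)))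
          \<le> 2 * \<epsilon> * (\<bar>\<alpha>\<bar> * (B powr (\<bar>\<alpha>\<bar> + 1) * t powr (\<alpha> - 1)))"
        using e 3 by (simp add: norm_mult mult_left_mono)
      show "onorm (\<lambda>h. h *\<^sub>R ((2 * of_real \<epsilon> * \<i>) * (of_real \<alpha> * ?w \<tau> powr (of_real \<alpha> - 1))))
          \<le> 2 * \<epsilon> * (\<bar>\<alpha>\<bar> * (B powr (\<bar>\<alpha>\<bar> + 1) * t powr (\<alpha> - 1)))"
        by (rule onorm_le) (use 4 in \<open>simp add: mult.commute mult_left_mono del: norm_mult\<close>)
    qed auto
    then have "cmod ((of_real t * \<zeta> + 2 * of_real \<epsilon> * \<i>) powr of_real \<alpha> - (of_real t * \<zeta>) powr of_real \<alpha>)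
        \<le> 2 * \<bar>\<alpha>\<bar> * B powr (\<bar>\<alpha>\<bar> + 1) * (\<epsilon> / t * t powr \<alpha>)"
      unfolding w01 using t by (simp add: powr_diff mult_ac)
    also have "\<dots> \<le> 2 * (\<bar>\<alpha>\<bar> + 1) * B powr (\<bar>\<alpha>\<bar> + 1) * ((2 * (\<epsilon> / ?s)) * (?s powr \<alpha> * (?r powr \<alpha> + 1)))"
    proof (intro mult_mono)
      show "\<epsilon> / t \<le> 2 * (\<epsilon> / ?s)" using t e True s by (simp add: field_simps)
      show "t powr \<alpha> \<le> ?s powr \<alpha> * (?r powr \<alpha> + 1)" by (simp add: distrib_left sr)
    qed (use t e in auto)
    also have "\<dots> = ?C * (\<epsilon> / ?s * ?s powr \<alpha> * (?r powr \<alpha> + 1))"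
    proof -
      have "4 * (\<bar>\<alpha>\<bar> + 1) = 2 * (\<bar>\<alpha>\<bar> + 1) * 2" by simp
      then show ?thesis by (simp only: mult_ac B_def)
    qed
    finally show ?thesis .
  next
    case False
    have a: "cmod (?w 1) powr \<alpha> \<le> B powr \<bar>\<alpha>\<bar> * ?s powr \<alpha>"
    proof (rule powr_comparable)
      have "t * \<epsilon> \<le> 1 * \<epsilon>" using False e by (intro mult_right_mono) auto
      moreover have "t * Im \<zeta> = t - t * \<epsilon>" unfolding \<zeta>(2) by (simp add: algebra_simps)
      ultimately have "?s \<le> Im (?w 1)" by simp
      also have "\<dots> \<le> cmod (?w 1)" using abs_Im_le_cmod[of "?w 1"] by linarith
      finally have "?s \<le> cmod (?w 1)" .
      moreover have "?s / B \<le> ?s / 1" using s B by (intro divide_left_mono) auto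
      ultimately show "?s / B \<le> cmod (?w 1)" by simp
      have "cmod (?w 1) \<le> (R + 1) * t + 2 * \<epsilon>" by (rule whigh) auto
      also have "\<dots> \<le> (R + 3) * t + (R + 3) * \<epsilon>"
        using R t e by (intro add_mono mult_right_mono) auto
      finally show "cmod (?w 1) \<le> B * ?s" by (simp only: B_def distrib_left)
    qed (use s B in auto)
    have b: "cmod (?w 0) powr \<alpha> \<le> B powr \<bar>\<alpha>\<bar> * t powr \<alpha>"
    proof (rule powr_comparable)
      have "t / B \<le> t / 2" using t B by (intro divide_left_mono) auto
      then show "t / B \<le> cmod (?w 0)" by (rule order_trans) (rule wlow(1), simp)
      have "cmod (?w 0) = t * cmod \<zeta>" using t by (simp add: norm_mult)
      also have "\<dots> \<le> t * B" using t \<zeta> by (intro mult_left_mono) (auto simp: B_def)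
      finally show "cmod (?w 0) \<le> B * t" by (simp add: mult.commute)
    qed (use t B in auto)
    have "cmod (?w 1 powr of_real \<alpha> - ?w 0 powr of_real \<alpha>) \<le> cmod (?w 1) powr \<alpha> + cmod (?w 0) powr \<alpha>"
      using norm_triangle_ineq4[of "?w 1 powr of_real \<alpha>" "?w 0 powr of_real \<alpha>"] by (simp add: cmod_powr_of_real)
    also have "\<dots> \<le> B powr \<bar>\<alpha>\<bar> * (?s powr \<alpha> * (?r powr \<alpha> + 1))"
      using a b by (simp add: distrib_left sr)
    also have "\<dots> \<le> (B powr (\<bar>\<alpha>\<bar> + 1) * (2 * (\<epsilon> / ?s))) * (?s powr \<alpha> * (?r powr \<alpha> + 1))"
    proof (rule mult_right_mono)
      have "1 \<le> 2 * (\<epsilon> / ?s)" using False s by (simp add: field_simps)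
      then have "B powr \<bar>\<alpha>\<bar> * 1 \<le> B powr (\<bar>\<alpha>\<bar> + 1) * (2 * (\<epsilon> / ?s))"
        using Bp[of \<alpha>] by (intro mult_mono) auto
      then show "B powr \<bar>\<alpha>\<bar> \<le> B powr (\<bar>\<alpha>\<bar> + 1) * (2 * (\<epsilon> / ?s))" by simp
    qed auto
    also have "\<dots> = 2 * 1 * (B powr (\<bar>\<alpha>\<bar> + 1) * (\<epsilon> / ?s * ?s powr \<alpha> * (?r powr \<alpha> + 1)))" by simp
    also have "\<dots> \<le> 4 * (\<bar>\<alpha>\<bar> + 1) * (B powr (\<bar>\<alpha>\<bar> + 1) * (\<epsilon> / ?s * ?s powr \<alpha> * (?r powr \<alpha> + 1)))"
      using e s by (intro mult_right_mono mult_mono) auto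
    finally show ?thesis unfolding w01 by (simp add: B_def mult.assoc)
  qed
qed

text \<open>The substitution q = t / (t + \<epsilon>) turns the integrand into (q^\<alpha> + 1) dq.
  The value stays below 1 / (\<alpha> + 1) + 1 for every \<epsilon>, which is the uniformity that
  the jump estimate rests on.\<close>

lemma has_integral_jump_majorant:
  fixes \<alpha> \<epsilon> :: real
  assumes "\<alpha> > -1" "\<epsilon> > 0"
  shows "((\<lambda>t. \<epsilon> / (t + \<epsilon>)\<^sup>2 * ((t / (t + \<epsilon>)) powr \<alpha> + 1)) has_integral
    ((1 / (1 + \<epsilon>)) powr (\<alpha> + 1) / (\<alpha> + 1) - \<epsilon> / (1 + \<epsilon>) + 1)) {0..1}"
proof -
  let ?\<Phi> = "\<lambda>t. (t / (t + \<epsilon>)) powr (\<alpha> + 1) / (\<alpha> + 1) - \<epsilon> / (t + \<epsilon>)"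
  have "((\<lambda>t. \<epsilon> / (t + \<epsilon>)\<^sup>2 * ((t / (t + \<epsilon>)) powr \<alpha> + 1)) has_integral (?\<Phi> 1 - ?\<Phi> 0)) {0..1}"
  \<comment> \<open>The interior version, since q^(\<alpha>+1) need not be differentiable at t =
    0.\<close>
  proof (rule fundamental_theorem_of_calculus_interior)
    show "continuous_on {0..1} ?\<Phi>"
      using assms by (intro continuous_intros continuous_on_powr') auto
    fix t :: real assume t: "t \<in> {0<..<1}"
    have q: "((\<lambda>t. t / (t + \<epsilon>)) has_real_derivative \<epsilon> / (t + \<epsilon>)\<^sup>2) (at t)"
      using t assms by (auto intro!: derivative_eq_intros simp: power2_eq_square field_simps)
    have d: "((\<lambda>t. (t / (t + \<epsilon>)) powr (\<alpha> + 1)) has_real_derivative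
        ((\<alpha> + 1) * (t / (t + \<epsilon>)) powr (\<alpha> + 1 - 1)) * (\<epsilon> / (t + \<epsilon>)\<^sup>2)) (at t)"
      by (rule DERIV_chain2[OF has_real_derivative_powr q]) (use t assms in auto)
    have 1: "((\<lambda>t. (t / (t + \<epsilon>)) powr (\<alpha> + 1) / (\<alpha> + 1)) has_real_derivative
        (t / (t + \<epsilon>)) powr \<alpha> * (\<epsilon> / (t + \<epsilon>)\<^sup>2)) (at t)"
      using DERIV_cdivide[OF d, of "\<alpha> + 1"] assms by simp
    have 2: "((\<lambda>t. \<epsilon> / (t + \<epsilon>)) has_real_derivative - (\<epsilon> / (t + \<epsilon>)\<^sup>2)) (at t)"
      using t assms by (auto intro!: derivative_eq_intros simp: power2_eq_square)
    have "(t / (t + \<epsilon>)) powr \<alpha> * (\<epsilon> / (t + \<epsilon>)\<^sup>2) - - (\<epsilon> / (t + \<epsilon>)\<^sup>2)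
        = \<epsilon> / (t + \<epsilon>)\<^sup>2 * ((t / (t + \<epsilon>)) powr \<alpha> + 1)"
      by (simp add: distrib_left)
    with DERIV_diff[OF 1 2]
    show "(?\<Phi> has_vector_derivative \<epsilon> / (t + \<epsilon>)\<^sup>2 * ((t / (t + \<epsilon>)) powr \<alpha> + 1)) (at t)"
      by (simp only: has_real_derivative_iff_has_vector_derivative)
  qed simp
  moreover have "?\<Phi> 1 - ?\<Phi> 0 = (1 / (1 + \<epsilon>)) powr (\<alpha> + 1) / (\<alpha> + 1) - \<epsilon> / (1 + \<epsilon>) + 1"
    using assms by simp
  ultimately show ?thesis by simp
qed

context alpha_boundary
begin

text \<open>With w = cnj z, both \<open>J z\<close> and \<open>E w\<close> are integrals over the
  segment from w to -\<i>, on which z - s = t \<zeta> + 2 \<epsilon> \<i> and w - s = t \<zeta>; the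
  power \<zeta>^(\<alpha>+1) collects ds and (t \<zeta>)^\<alpha>. Setting \<open>g 0 = 0\<close>
  lets a bound proved for t > 0 hold on all of \<open>{0..1}\<close>.\<close>

lemma h_minus_E:
  fixes x \<epsilon> :: real
  assumes e: "0 < \<epsilon>" "\<epsilon> < 1"
  defines "z \<equiv> Complex x \<epsilon>" and "w \<equiv> Complex x (-\<epsilon>)"
  defines "\<zeta> \<equiv> w + \<i>"
  defines "g \<equiv> \<lambda>t. if t = 0 then 0 else
      ((of_real t * \<zeta> + 2 * of_real \<epsilon> * \<i>) powr of_real \<alpha> - (of_real t * \<zeta>) powr of_real \<alpha>) * G (seg w t)"
  shows "g integrable_on {0..1}"
    "h z - \<zeta> powr of_real (\<alpha> + 1) * E w
       = of_real (\<alpha> + 1) * (\<zeta> * integral {0..1} g - (2 * \<i>) powr of_real \<alpha> * u z)"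
proof -
  have w: "cnj z = w" "Im w < 0" "0 < Im z" using e by (auto simp: z_def w_def complex_eq_iff)
  have z0: "\<zeta> \<noteq> 0" using e by (auto simp: \<zeta>_def w_def complex_eq_iff)
  have lp: "linepath w (- \<i>) t = seg w t" for t
    by (simp add: linepath_def seg_def scaleR_conv_of_real)
  have zs: "z - seg w t = of_real t * \<zeta> + 2 * of_real \<epsilon> * \<i>" for t
    by (simp add: z_def w_def \<zeta>_def seg_def complex_eq_iff algebra_simps)
  have "continuous_on {0..1} (\<lambda>t. ker z (seg w t))"
    by (rule continuous_on_compose2[OF holomorphic_on_imp_continuous_on[OF ker_holomorphic[OF w(3)]]])
      (use Im_seg_neg[OF w(2)] in \<open>auto intro!: continuous_intros simp: seg_def[abs_def]\<close>)
  then have i1: "((\<lambda>t. ker z (seg w t)) has_integral integral {0..1} (\<lambda>t. ker z (seg w t))) {0..1}"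
    by (intro integrable_integral integrable_continuous_interval)
  have Jz: "J z = \<zeta> * integral {0..1} (\<lambda>t. ker z (seg w t))"
  proof -
    have "contour_integral (linepath w (- \<i>)) (ker z) = (- \<i> - w) * integral {0..1} (\<lambda>t. ker z (seg w t))"
      using contour_integral_linepath_eq[of w "- \<i>" "ker z"] by (simp add: lp)
    then show ?thesis unfolding J_def w(1) \<zeta>_def by (simp only:) (simp add: algebra_simps)
  qed
  have "((\<lambda>t. (\<zeta> powr of_real \<alpha> / of_real (\<alpha> + 1)) * (of_real ((\<alpha> + 1) * t powr \<alpha>) * G (seg w t))) has_integral
      (\<zeta> powr of_real \<alpha> / of_real (\<alpha> + 1)) * E w) {0..1}"
    by (rule has_integral_mult_right[OF E_has_integral[OF w(2)]])
  from has_integral_diff[OF i1 this]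
  have "(g has_integral integral {0..1} (\<lambda>t. ker z (seg w t)) - (\<zeta> powr of_real \<alpha> / of_real (\<alpha> + 1)) * E w) {0..1}"
  proof (rule has_integral_spike_finite[of "{0}", rotated 2])
    fix t :: real assume t: "t \<in> {0..1} - {0}"
    have a1: "complex_of_real (\<alpha> + 1) \<noteq> 0" using \<alpha> by (simp only: of_real_eq_0_iff)
    have "(of_real t * \<zeta>) powr of_real \<alpha> = of_real (t powr \<alpha>) * \<zeta> powr of_real \<alpha>"
      using t z0 by (intro powr_of_real_mult) auto
    then show "g t = ker z (seg w t) - (\<zeta> powr of_real \<alpha> / of_real (\<alpha> + 1)) * (of_real ((\<alpha> + 1) * t powr \<alpha>) * G (seg w t))"
      using t a1 by (simp add: g_def ker_def zs of_real_mult del: of_real_add) (simp add: algebra_simps)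
  qed auto
  then show "g integrable_on {0..1}" and
    "h z - \<zeta> powr of_real (\<alpha> + 1) * E w
       = of_real (\<alpha> + 1) * (\<zeta> * integral {0..1} g - (2 * \<i>) powr of_real \<alpha> * u z)"
  proof -
    assume i: "(g has_integral integral {0..1} (\<lambda>t. ker z (seg w t)) - (\<zeta> powr of_real \<alpha> / of_real (\<alpha> + 1)) * E w) {0..1}"
    then show "g integrable_on {0..1}" by (rule has_integral_integrable)
    have a1: "complex_of_real (\<alpha> + 1) \<noteq> 0" using \<alpha> by (simp only: of_real_eq_0_iff)
    have p: "\<zeta> powr of_real (\<alpha> + 1) = \<zeta> * \<zeta> powr of_real \<alpha>"
      using z0 by (simp add: powr_add)
    have "\<zeta> * integral {0..1} g = J z - \<zeta> powr of_real (\<alpha> + 1) * E w / of_real (\<alpha> + 1)"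
      unfolding integral_unique[OF i] Jz p using a1 by (simp add: algebra_simps)
    then show "h z - \<zeta> powr of_real (\<alpha> + 1) * E w
       = of_real (\<alpha> + 1) * (\<zeta> * integral {0..1} g - (2 * \<i>) powr of_real \<alpha> * u z)"
      unfolding h_def using a1 by (simp add: field_simps del: of_real_add)
  qed
qed

text \<open>The height of \<open>cnj (seg w t)\<close> lies between s / 2 and s = t + \<epsilon>, so
  \<open>G\<close> costs s^(-\<alpha>-1), and the product with the kernel increment is of order
  \<epsilon> / s^2. For s < \<eta> the small constant \<kappa> applies. For s \<ge> \<eta> only
  \<open>M\<close> is available, but there \<epsilon> / s^2 \<le> \<epsilon> / \<eta>^2, which
  vanishes with \<epsilon>.\<close>

lemma jump_integrand_bound:
  fixes x \<epsilon> t R \<eta> \<kappa> M :: real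
  assumes R: "0 \<le> R" "\<bar>x\<bar> \<le> R" and e: "0 < \<epsilon>" "\<epsilon> \<le> 1/2" and t: "0 < t" "t \<le> 1"
    and \<eta>: "0 < \<eta>" and \<kappa>: "0 \<le> \<kappa>" and M: "0 \<le> M"
    and Fs: "\<And>z. \<bar>Re z\<bar> \<le> R \<Longrightarrow> 0 < Im z \<Longrightarrow> Im z < \<eta> \<Longrightarrow> cmod (F z) \<le> \<kappa> * Im z powr (-\<alpha> - 1)"
    and Fb: "\<And>z. \<bar>Re z\<bar> \<le> R \<Longrightarrow> 0 < Im z \<Longrightarrow> Im z \<le> 1 \<Longrightarrow> cmod (F z) \<le> M * Im z powr (-\<alpha> - 1)"
  defines "w \<equiv> Complex x (-\<epsilon>)"
  shows "cmod (((of_real t * (w + \<i>) + 2 * of_real \<epsilon> * \<i>) powr of_real \<alpha>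
        - (of_real t * (w + \<i>)) powr of_real \<alpha>) * G (seg w t))
    \<le> (4 * (\<bar>\<alpha>\<bar> + 1) * (R + 3) powr (\<bar>\<alpha>\<bar> + 1)) * 2 powr (\<alpha> + 1) *
       (\<kappa> * (\<epsilon> / (t + \<epsilon>)\<^sup>2 * ((t / (t + \<epsilon>)) powr \<alpha> + 1)) + M * \<epsilon> / \<eta>\<^sup>2 * (2 + 2 * t powr \<alpha>))"
proof -
  let ?C = "4 * (\<bar>\<alpha>\<bar> + 1) * (R + 3) powr (\<bar>\<alpha>\<bar> + 1)"
  define s where "s = t + \<epsilon>"
  define d where "d = (1 - t) * \<epsilon> + t"
  let ?r = "t / s"
  let ?k = "\<epsilon> / s\<^sup>2 * (?r powr \<alpha> + 1)"
  have s: "0 < s" "s \<le> 2" using t e by (auto simp: s_def)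
  have "t * \<epsilon> \<le> t * (1/2)" using t e by (intro mult_left_mono) auto
  moreover have "d = \<epsilon> - t * \<epsilon> + t" by (simp add: d_def algebra_simps)
  ultimately have d: "s / 2 \<le> d" using e unfolding s_def by argo
  have "1 - d = (1 - t) * (1 - \<epsilon>)" by (simp add: d_def algebra_simps)
  moreover have "0 \<le> (1 - t) * (1 - \<epsilon>)" using t e by (intro mult_nonneg_nonneg) auto
  ultimately have d1: "d \<le> 1" by linarith
  have ds: "d \<le> s" using t e by (simp add: d_def s_def algebra_simps)
  have c\<zeta>: "cmod (w + \<i>) \<le> R + 1"
  proof -
    have "cmod (w + \<i>) \<le> \<bar>Re (w + \<i>)\<bar> + \<bar>Im (w + \<i>)\<bar>" by (rule cmod_le)
    then show ?thesis using R e by (auto simp: w_def)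
  qed
  have 1: "cmod ((of_real t * (w + \<i>) + 2 * of_real \<epsilon> * \<i>) powr of_real \<alpha> - (of_real t * (w + \<i>)) powr of_real \<alpha>)
      \<le> ?C * (\<epsilon> / s * s powr \<alpha> * (?r powr \<alpha> + 1))"
    unfolding s_def by (rule powr_increment_bound) (use t e R c\<zeta> in \<open>auto simp: w_def\<close>)
  have Reb: "\<bar>Re (cnj (seg w t))\<bar> \<le> R"
    using t R mult_left_le_one_le[of "\<bar>x\<bar>" "1 - t"] by (auto simp: Re_seg abs_mult w_def)
  have Imd: "Im (cnj (seg w t)) = d" by (simp add: Im_seg w_def d_def)
  have d0: "0 < d" using d s by linarith
  let ?b = "\<kappa> + (if \<eta> \<le> s then M else 0)"
  have "cmod (G (seg w t)) \<le> ?b * d powr (-\<alpha> - 1)"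
  proof (cases "\<eta> \<le> s")
    case True
    have "cmod (G (seg w t)) \<le> M * d powr (-\<alpha> - 1)"
      using Fb[OF Reb] d0 d1 unfolding Imd by (simp add: G_def)
    then show ?thesis using True \<kappa> by (simp add: distrib_right add_increasing)
  next
    case False
    then show ?thesis using Fs[OF Reb] d0 ds unfolding Imd by (simp add: G_def)
  qed
  also have "\<dots> \<le> ?b * (2 powr (\<alpha> + 1) * s powr (-\<alpha> - 1))"
  proof (rule mult_left_mono)
    have "d powr (-\<alpha> - 1) \<le> (s / 2) powr (-\<alpha> - 1)"
      using d s \<alpha> by (intro powr_mono2') auto
    also have "\<dots> = s powr (-\<alpha> - 1) / 2 powr -(\<alpha> + 1)" using s by (simp add: powr_divide)
    also have "\<dots> = 2 powr (\<alpha> + 1) * s powr (-\<alpha> - 1)" unfolding powr_minus by (simp add: field_simps)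
    finally show "d powr (-\<alpha> - 1) \<le> 2 powr (\<alpha> + 1) * s powr (-\<alpha> - 1)" .
  qed (use \<kappa> M in auto)
  finally have 2: "cmod (G (seg w t)) \<le> ?b * (2 powr (\<alpha> + 1) * s powr (-\<alpha> - 1))" .
  have "cmod (((of_real t * (w + \<i>) + 2 * of_real \<epsilon> * \<i>) powr of_real \<alpha>
        - (of_real t * (w + \<i>)) powr of_real \<alpha>) * G (seg w t))
      \<le> (?C * (\<epsilon> / s * s powr \<alpha> * (?r powr \<alpha> + 1))) * (?b * (2 powr (\<alpha> + 1) * s powr (-\<alpha> - 1)))"
    unfolding norm_mult[of "_ - _"] using e s R by (intro mult_mono 1 2) auto
  also have "\<dots> = ?C * 2 powr (\<alpha> + 1) * (?b * (\<epsilon> / s * (s powr \<alpha> * s powr (-\<alpha> - 1)) * (?r powr \<alpha> + 1)))"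
    by (simp only: mult_ac)
  also have "s powr \<alpha> * s powr (-\<alpha> - 1) = 1 / s"
    using s by (simp add: powr_minus_divide flip: powr_add)
  also have "\<epsilon> / s * (1 / s) * (?r powr \<alpha> + 1) = ?k" by (simp add: power2_eq_square)
  also have "?C * 2 powr (\<alpha> + 1) * (?b * ?k) \<le> ?C * 2 powr (\<alpha> + 1) * (\<kappa> * ?k + M * \<epsilon> / \<eta>\<^sup>2 * (2 + 2 * t powr \<alpha>))"
  proof (intro mult_left_mono)
    have k0: "0 \<le> ?k" using e s by simp
    have "?k \<le> \<epsilon> / \<eta>\<^sup>2 * (2 + 2 * t powr \<alpha>)" if "\<eta> \<le> s"
    proof (rule mult_mono)
      show "\<epsilon> / s\<^sup>2 \<le> \<epsilon> / \<eta>\<^sup>2" using that \<eta> e by (intro divide_left_mono power_mono mult_pos_pos) auto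
      \<comment> \<open>Replaces the \<epsilon>-dependent power by an integrable function of t
        alone; for \<alpha> < 0 this uses s \<le> 2 and 2^(-\<alpha>) \<le> 2.\<close>
      have "?r powr \<alpha> \<le> 1 + 2 * t powr \<alpha>"
      proof (cases "\<alpha> \<ge> 0")
        case True
        have "?r powr \<alpha> \<le> 1" using True t e by (intro powr_le1) (auto simp: s_def)
        then show ?thesis by (simp add: add_increasing2)
      next
        case False
        have "t / 2 \<le> ?r" using s t by (intro divide_left_mono) auto
        then have "?r powr \<alpha> \<le> (t / 2) powr \<alpha>" using False t by (intro powr_mono2') auto
        also have "\<dots> = 2 powr -\<alpha> * t powr \<alpha>" using t by (simp add: powr_divide powr_minus field_simps)
        also have "\<dots> \<le> 2 powr 1 * t powr \<alpha>" using \<alpha> by (intro mult_right_mono powr_mono) auto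
        finally show ?thesis by simp
      qed
      then show "?r powr \<alpha> + 1 \<le> 2 + 2 * t powr \<alpha>" by simp
    qed (use e in auto)
    then have 3: "M * ?k \<le> M * (\<epsilon> / \<eta>\<^sup>2 * (2 + 2 * t powr \<alpha>))" if "\<eta> \<le> s"
      using that M by (intro mult_left_mono) auto
    show "?b * ?k \<le> \<kappa> * ?k + M * \<epsilon> / \<eta>\<^sup>2 * (2 + 2 * t powr \<alpha>)"
    proof (cases "\<eta> \<le> s")
      case True
      have "M * \<epsilon> / \<eta>\<^sup>2 * (2 + 2 * t powr \<alpha>) = M * (\<epsilon> / \<eta>\<^sup>2 * (2 + 2 * t powr \<alpha>))" by simp
      then show ?thesis using 3[OF True] True by (simp only: distrib_right if_True add_left_mono)
    next
      case False
      have "0 \<le> M * \<epsilon> / \<eta>\<^sup>2 * (2 + 2 * t powr \<alpha>)" using M e by simp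
      then show ?thesis using False by simp
    qed
  qed (use R in auto)
  finally show ?thesis by (simp only: s_def)
qed

text \<open>The order of choices matters: \<kappa> first, against the \<epsilon>-independent bound
  of the majorant's integral, then the height \<eta> from \<open>F_small\<close>, and last
  \<epsilon>, against the far part and the term with \<open>u\<close>. Each of the three contributes
  e / 3.\<close>

lemma jump_tends_to_0:
  assumes R: "0 \<le> R" and e: "0 < e"
  shows "\<exists>\<eta>>0. \<forall>x \<epsilon>. \<bar>x\<bar> \<le> R \<and> 0 < \<epsilon> \<and> \<epsilon> < \<eta> \<longrightarrow>
    cmod (h (Complex x \<epsilon>) - (Complex x (-\<epsilon>) + \<i>) powr of_real (\<alpha> + 1) * E (Complex x (-\<epsilon>))) \<le> e"
proof -
  define C where "C = (4 * (\<bar>\<alpha>\<bar> + 1) * (R + 3) powr (\<bar>\<alpha>\<bar> + 1)) * 2 powr (\<alpha> + 1)"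
  have C: "C \<ge> 0" using R by (simp add: C_def)
  define b where "b = 1 / (\<alpha> + 1)"
  have b: "b > 0" using \<alpha> by (simp add: b_def)
  define c2 where "c2 = cmod ((2 * \<i>) powr of_real \<alpha>)"
  \<comment> \<open>The summand 1 here, and in \<open>T\<close> and \<open>Q\<close>, makes these
    divisors positive.\<close>
  define P where "P = (\<alpha> + 1) * (R + 1) * C * (b + 1) + 1"
  have P: "P > 0" unfolding P_def using \<alpha> R C b by (intro add_nonneg_pos mult_nonneg_nonneg) auto
  define \<kappa> where "\<kappa> = e / (3 * P)"
  have \<kappa>: "\<kappa> > 0" using e P by (simp add: \<kappa>_def)
  obtain \<eta> where \<eta>: "\<eta> > 0" and Fs: "\<And>z. \<bar>Re z\<bar> \<le> R \<Longrightarrow> 0 < Im z \<Longrightarrow> Im z < \<eta> \<Longrightarrow> cmod (F z) \<le> \<kappa> * Im z powr (-\<alpha> - 1)"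
    using F_small[OF \<kappa>, of R] by auto
  obtain M where M: "M \<ge> 0" and Fb: "\<And>z. \<bar>Re z\<bar> \<le> R \<Longrightarrow> 0 < Im z \<Longrightarrow> Im z \<le> 1 \<Longrightarrow> cmod (F z) \<le> M * Im z powr (-\<alpha> - 1)"
    using F_locally_bounded[of R] by auto
  define T where "T = (\<alpha> + 1) * c2 + 1"
  have T: "T > 0" unfolding T_def c2_def using \<alpha> by (intro add_nonneg_pos mult_nonneg_nonneg) auto
  obtain \<eta>u where \<eta>u: "\<eta>u > 0" and us: "\<And>z. \<bar>Re z\<bar> \<le> R \<Longrightarrow> 0 < Im z \<Longrightarrow> Im z < \<eta>u \<Longrightarrow> cmod (u z) < e / (3 * T)"
    using u_small[of "e / (3 * T)" R] e T by auto
  define Q where "Q = (\<alpha> + 1) * (R + 1) * C * (M / \<eta>\<^sup>2 * (2 + 2 * b)) + 1"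
  have Q: "Q > 0" unfolding Q_def using \<alpha> R C b M by (intro add_nonneg_pos mult_nonneg_nonneg) auto
  let ?\<eta> = "min (min \<eta>u (1/2)) (e / (3 * Q))"
  have "cmod (h (Complex x \<epsilon>) - (Complex x (-\<epsilon>) + \<i>) powr of_real (\<alpha> + 1) * E (Complex x (-\<epsilon>))) \<le> e"
    if x: "\<bar>x\<bar> \<le> R" and e0: "0 < \<epsilon>" and e1: "\<epsilon> < ?\<eta>" for x \<epsilon>
  proof -
    let ?z = "Complex x \<epsilon>" and ?w = "Complex x (-\<epsilon>)"
    define \<zeta> where "\<zeta> = ?w + \<i>"
    define g where "g = (\<lambda>t. if t = 0 then 0 else
      ((of_real t * \<zeta> + 2 * of_real \<epsilon> * \<i>) powr of_real \<alpha> - (of_real t * \<zeta>) powr of_real \<alpha>) * G (seg ?w t))"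
    have eps: "\<epsilon> < 1" "\<epsilon> \<le> 1/2" using e1 by auto
    note hE = h_minus_E[OF e0 eps(1), of x, folded \<zeta>_def, folded g_def]
    let ?m = "\<lambda>t. C * (\<kappa> * (\<epsilon> / (t + \<epsilon>)\<^sup>2 * ((t / (t + \<epsilon>)) powr \<alpha> + 1)) + M * \<epsilon> / \<eta>\<^sup>2 * (2 + 2 * t powr \<alpha>))"
    let ?V = "(1 / (1 + \<epsilon>)) powr (\<alpha> + 1) / (\<alpha> + 1) - \<epsilon> / (1 + \<epsilon>) + 1"
    have i2: "((\<lambda>t::real. 2 + 2 * t powr \<alpha>) has_integral 2 + 2 * b) {0..1}"
      using has_integral_add[OF has_integral_const_real[of 2 0 1]
          has_integral_mult_right[OF has_integral_powr_from_0[of \<alpha> 1], of 2]] \<alpha> by (simp add: b_def)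
    have mi: "(?m has_integral C * (\<kappa> * ?V + M * \<epsilon> / \<eta>\<^sup>2 * (2 + 2 * b))) {0..1}"
      by (intro has_integral_mult_right[of _ _ _ C] has_integral_add has_integral_mult_right[OF i2]
          has_integral_mult_right[OF has_integral_jump_majorant[OF \<alpha> e0]])
    have "cmod (integral {0..1} g) \<le> integral {0..1} ?m"
    proof (rule integral_norm_bound_integral)
      fix t :: real assume t: "t \<in> {0..1}"
      show "cmod (g t) \<le> ?m t"
      proof (cases "t = 0")
        case True
        then show ?thesis using C \<kappa> M e0 by (simp add: g_def)
      next
        case False
        then show ?thesis
          using jump_integrand_bound[OF R x e0 eps(2) _ _ \<eta> less_imp_le[OF \<kappa>] M Fs Fb, of t] t
          unfolding g_def \<zeta>_def C_def by auto
      qed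
    qed (use hE(1) mi has_integral_integrable in auto)
    also have "\<dots> = C * (\<kappa> * ?V + M * \<epsilon> / \<eta>\<^sup>2 * (2 + 2 * b))"
      using mi by (rule integral_unique)
    also have "\<dots> \<le> C * (\<kappa> * (b + 1) + M * \<epsilon> / \<eta>\<^sup>2 * (2 + 2 * b))"
    proof -
      have "(1 / (1 + \<epsilon>)) powr (\<alpha> + 1) \<le> 1" using \<alpha> e0 by (intro powr_le1) auto
      then have "(1 / (1 + \<epsilon>)) powr (\<alpha> + 1) / (\<alpha> + 1) \<le> b"
        using \<alpha> by (simp add: b_def divide_right_mono)
      moreover have "0 \<le> \<epsilon> / (1 + \<epsilon>)" using e0 by simp
      ultimately have "?V \<le> b + 1" by linarith
      then show ?thesis using C \<kappa>
        by (intro mult_left_mono[of _ _ C] add_right_mono mult_left_mono[of _ _ \<kappa>]) auto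
    qed
    finally have gI: "cmod (integral {0..1} g) \<le> C * (\<kappa> * (b + 1) + M * \<epsilon> / \<eta>\<^sup>2 * (2 + 2 * b))" (is "_ \<le> ?I") .
    have I0: "0 \<le> ?I" using norm_ge_zero order_trans[OF norm_ge_zero gI] by simp
    have c\<zeta>: "cmod \<zeta> \<le> R + 1"
    proof -
      have "cmod \<zeta> \<le> \<bar>Re \<zeta>\<bar> + \<bar>Im \<zeta>\<bar>" by (rule cmod_le)
      then show ?thesis using x e0 eps by (auto simp: \<zeta>_def)
    qed
    have "cmod (h ?z - \<zeta> powr of_real (\<alpha> + 1) * E ?w)
        \<le> (\<alpha> + 1) * (cmod \<zeta> * cmod (integral {0..1} g) + c2 * cmod (u ?z))"
    proof -
      have "cmod (h ?z - \<zeta> powr of_real (\<alpha> + 1) * E ?w)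
          = (\<alpha> + 1) * cmod (\<zeta> * integral {0..1} g - (2 * \<i>) powr of_real \<alpha> * u ?z)"
        unfolding hE(2) norm_mult[of "of_real _"] norm_of_real using \<alpha> by simp
      also have "\<dots> \<le> (\<alpha> + 1) * (cmod (\<zeta> * integral {0..1} g) + cmod ((2 * \<i>) powr of_real \<alpha> * u ?z))"
        using \<alpha> by (intro mult_left_mono norm_triangle_ineq4) auto
      finally show ?thesis by (simp add: norm_mult c2_def)
    qed
    also have "\<dots> \<le> (\<alpha> + 1) * ((R + 1) * ?I + c2 * (e / (3 * T)))"
      using \<alpha> c\<zeta> gI us[of ?z] x e0 e1 R I0
      by (intro mult_left_mono add_mono mult_mono) (auto simp: c2_def)
    also have "\<dots> = ((\<alpha> + 1) * (R + 1) * C * (b + 1)) * \<kappa> + ((\<alpha> + 1) * (R + 1) * C * (M / \<eta>\<^sup>2 * (2 + 2 * b))) * \<epsilon>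
        + ((\<alpha> + 1) * c2) * (e / (3 * T))"
    proof -
      have "M * \<epsilon> / \<eta>\<^sup>2 * (2 + 2 * b) = M / \<eta>\<^sup>2 * (2 + 2 * b) * \<epsilon>" by simp
      moreover have "(\<alpha> + 1) * ((R + 1) * (C * (\<kappa> * (b + 1) + N * \<epsilon>)) + c2 * X)
        = ((\<alpha> + 1) * (R + 1) * C * (b + 1)) * \<kappa> + ((\<alpha> + 1) * (R + 1) * C * N) * \<epsilon> + ((\<alpha> + 1) * c2) * X"
        for N X by algebra
      ultimately show ?thesis by (simp only:)
    qed
    also have "\<dots> \<le> P * \<kappa> + Q * \<epsilon> + T * (e / (3 * T))"
      using \<kappa> e0 e T by (intro add_mono mult_right_mono) (auto simp: P_def Q_def T_def)
    also have "\<dots> \<le> e / 3 + e / 3 + e / 3"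
    proof (intro add_mono)
      show "P * \<kappa> \<le> e / 3" using P by (simp add: \<kappa>_def)
      have "Q * \<epsilon> \<le> Q * (e / (3 * Q))" using e1 Q by (intro mult_left_mono) auto
      then show "Q * \<epsilon> \<le> e / 3" using Q by simp
      show "T * (e / (3 * T)) \<le> e / 3" using T by simp
    qed
    finally show ?thesis by (simp add: \<zeta>_def)
  qed
  moreover have "?\<eta> > 0" using \<eta>u e Q by simp
  ultimately show ?thesis by blast
qed

end

section \<open>Growth of \<open>E\<close> and \<open>h\<close>, the entire extension, polynomiality
  of \<open>F\<close>\<close>

text \<open>As y \<le> b, every extra factor 1 / y is paid for by a factor b; this brings estimates
  with different exponents to common ones.\<close>

lemma temperate_mono:
  fixes y b C :: real
  assumes "0 < y" "y \<le> b" "1 \<le> b" "0 \<le> C" "A + m \<le> A'"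
  shows "C * b ^ A / y ^ N \<le> C * b ^ A' / y ^ (N + m)"
proof -
  have "b ^ A * y ^ m \<le> b ^ A * b ^ m" using assms by (intro mult_left_mono power_mono) auto
  also have "\<dots> \<le> b ^ A'" unfolding power_add[symmetric] using assms by (intro power_increasing) auto
  finally have "C * (b ^ A * y ^ m) \<le> C * b ^ A'" using assms by (intro mult_left_mono)
  then show ?thesis using assms by (simp add: power_add field_simps)
qed

context alpha_temperate
begin

lemma E_temperate:
  "\<exists>C\<ge>0. \<exists>A N. N > 0 \<and> (\<forall>z. Im z < 0 \<longrightarrow> cmod (E z) \<le> C * (1 + cmod z) ^ A / \<bar>Im z\<bar> ^ N)"
proof -
  obtain C A N where C: "C \<ge> 0" "N > 0" "\<And>z t. Im z < 0 \<Longrightarrow> 0 \<le> t \<Longrightarrow> t \<le> 1 \<Longrightarrow>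
      cmod (G (seg z t)) \<le> C * (1 + cmod z) ^ A / \<bar>Im z\<bar> ^ N"
    using G_seg_temperate by blast
  have "cmod (E z) \<le> C * (1 + cmod z) ^ A / \<bar>Im z\<bar> ^ N" if z: "Im z < 0" for z
  proof -
    have "norm (E z) \<le> C * (1 + cmod z) ^ A / \<bar>Im z\<bar> ^ N * (1 - 0)"
      unfolding E_def
    proof (rule integral_bound)
      show "continuous_on {0..1} (\<lambda>\<tau>. G (seg z (sw \<tau>)))"
        by (rule continuous_on_compose2[OF contG_seg[OF z] sw_cont]) (use sw_01 in blast)
      show "norm (G (seg z (sw \<tau>))) \<le> C * (1 + cmod z) ^ A / \<bar>Im z\<bar> ^ N" if "\<tau> \<in> {0..1}" for \<tau>
        using sw_01[OF that] by (intro C z) auto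
    qed simp
    then show ?thesis by simp
  qed
  with C show ?thesis by blast
qed

lemma h_temperate:
  "\<exists>C\<ge>0. \<exists>A N. \<forall>z. 0 < Im z \<longrightarrow> cmod (h z) \<le> C * (1 + cmod z) ^ A / Im z ^ N"
proof -
  obtain C A N where C: "C \<ge> 0" "\<And>z t. Im z < 0 \<Longrightarrow> 0 \<le> t \<Longrightarrow> t \<le> 1 \<Longrightarrow>
      cmod (G (seg z t)) \<le> C * (1 + cmod z) ^ A / \<bar>Im z\<bar> ^ N"
    using G_seg_temperate by blast
  obtain D B M where D: "\<And>z. 0 < Im z \<Longrightarrow> cmod (u z) \<le> D * (1 + cmod z) ^ B / Im z ^ M"
    using temperate by blast
  define k where "k = nat \<lceil>\<bar>\<alpha>\<bar>\<rceil>"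
  have k: "\<bar>\<alpha>\<bar> \<le> real k" by (simp add: k_def)
  define c2 where "c2 = cmod ((2 * \<i>) powr of_real \<alpha>)"
  have c2: "c2 \<ge> 0" by (simp add: c2_def)
  \<comment> \<open>Chosen for the two later uses of \<open>temperate_mono\<close>, which need 1 + 2
    k + A + M and B + k + N to be at most \<open>A1\<close> when the power of y is raised to
    \<open>N1\<close>.\<close>
  define A1 where "A1 = 1 + 2 * k + A + B + M + k + N"
  define N1 where "N1 = k + N + M"
  have "cmod (h z) \<le> ((\<alpha> + 1) * (2 ^ k * C + c2 * \<bar>D\<bar>)) * (1 + cmod z) ^ A1 / Im z ^ N1" if z: "0 < Im z" for z
  proof -
    let ?b = "1 + cmod z" and ?y = "Im z"
    have yb: "?y \<le> ?b" using abs_Im_le_cmod[of z] by linarith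
    have b1: "1 \<le> ?b" by simp
    have w: "Im (cnj z) < 0" using z by simp
    \<comment> \<open>Dominates both the modulus of z - s and its inverse along the segment, so one
      bound serves both signs of \<alpha>.\<close>
    let ?X = "2 * ?b\<^sup>2 / ?y"
    let ?K = "?X ^ k * (C * ?b ^ A / ?y ^ N)"
    have Xy: "1 / ?y \<le> ?X"
    proof (rule divide_right_mono)
      have "1 \<le> ?b\<^sup>2" by (rule one_le_power[OF b1])
      then show "1 \<le> 2 * ?b\<^sup>2" by linarith
    qed (use z in simp)
    have Xb: "2 * ?b \<le> ?X"
    proof -
      have "2 * ?b * ?y \<le> 2 * ?b * ?b" using yb b1 by (intro mult_left_mono) auto
      then show ?thesis using z by (simp add: power2_eq_square field_simps)
    qed
    have X1: "1 \<le> ?X" using Xb b1 by argo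
    have kb: "cmod (ker z (seg (cnj z) t)) \<le> ?K" if t: "0 \<le> t" "t \<le> 1" for t
    proof -
      let ?s = "seg (cnj z) t"
      have s: "Im ?s < 0" by (rule Im_seg_neg[OF w t])
      have "?y \<le> Im (z - ?s)" using s by simp
      then have d1: "?y \<le> cmod (z - ?s)" using abs_Im_le_cmod[of "z - ?s"] by linarith
      have "cmod ?s \<le> cmod (of_real (1 - t) * cnj z) + cmod (of_real t * (- \<i>))"
        unfolding seg_def by (rule norm_triangle_ineq)
      also have "\<dots> \<le> cmod z + 1"
        using t by (intro add_mono) (auto simp: norm_mult mult_left_le_one_le simp del: of_real_diff)
      finally have "cmod (z - ?s) \<le> 2 * ?b" using norm_triangle_ineq4[of z ?s] b1 by argo
      then have d2: "cmod (z - ?s) \<le> ?X" using Xb by linarith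
      have pos: "0 < cmod (z - ?s)" using d1 z by linarith
      have "1 / cmod (z - ?s) \<le> 1 / ?y" using d1 z by (intro divide_left_mono mult_pos_pos pos) auto
      then have d3: "1 / cmod (z - ?s) \<le> ?X" using Xy by linarith
      have "cmod (z - ?s) powr \<alpha> \<le> ?X powr \<bar>\<alpha>\<bar>"
      proof (cases "\<alpha> \<ge> 0")
        case True
        then show ?thesis using d2 by (auto intro: powr_mono2)
      next
        case False
        have "cmod (z - ?s) powr \<alpha> = (1 / cmod (z - ?s)) powr (- \<alpha>)"
          using pos by (simp add: powr_divide powr_minus field_simps)
        also have "\<dots> \<le> ?X powr (- \<alpha>)" using False d3 by (intro powr_mono2) auto
        finally show ?thesis using False by simp
      qed
      also have "\<dots> \<le> ?X powr real k" using X1 k by (intro powr_mono) auto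
      also have "\<dots> = ?X ^ k" using X1 by (intro powr_realpow) linarith
      finally have "cmod (z - ?s) powr \<alpha> \<le> ?X ^ k" .
      moreover have "cmod (G ?s) \<le> C * ?b ^ A / ?y ^ N" using C(2)[OF w t] z by simp
      ultimately show ?thesis unfolding ker_def norm_mult cmod_powr_of_real
        using X1 by (intro mult_mono) auto
    qed
    have K0: "0 \<le> ?K" using kb[of 0] norm_ge_zero order_trans by (meson order_refl zero_le_one)
    have "cmod (J z) \<le> ?K * cmod (- \<i> - cnj z)"
      unfolding J_def norm_minus_cancel
    proof (rule contour_integral_bound_linepath)
      show "ker z contour_integrable_on linepath (cnj z) (- \<i>)" by (rule ker_integrable) (use z in auto)
      fix s assume "s \<in> closed_segment (cnj z) (- \<i>)"
      then obtain t where "0 \<le> t" "t \<le> 1" "s = seg (cnj z) t"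
        by (auto simp: in_segment seg_def scaleR_conv_of_real)
      then show "cmod (ker z s) \<le> ?K" using kb by blast
    qed (rule K0)
    also have "\<dots> \<le> ?K * ?b"
      using norm_triangle_ineq4[of "- \<i>" "cnj z"] by (intro mult_left_mono K0) simp
    also have "\<dots> = (2 ^ k * C) * ?b ^ (1 + 2 * k + A) / ?y ^ (k + N)"
      by (simp add: power_add power_mult power_divide power_mult_distrib)
    also have "\<dots> \<le> (2 ^ k * C) * ?b ^ A1 / ?y ^ (k + N + M)"
      using z yb b1 C(1) by (intro temperate_mono) (auto simp: A1_def)
    finally have J1: "cmod (J z) \<le> (2 ^ k * C) * ?b ^ A1 / ?y ^ N1" by (simp only: N1_def)
    have "cmod (u z) \<le> \<bar>D\<bar> * ?b ^ B / ?y ^ M"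
      by (rule order_trans[OF D[OF z]]) (use z in \<open>auto intro!: divide_right_mono mult_right_mono\<close>)
    also have "\<dots> \<le> \<bar>D\<bar> * ?b ^ A1 / ?y ^ (M + (k + N))"
      using z yb b1 by (intro temperate_mono) (auto simp: A1_def)
    finally have u1: "cmod (u z) \<le> \<bar>D\<bar> * ?b ^ A1 / ?y ^ N1" by (simp add: N1_def ac_simps)
    have "cmod (h z) \<le> (\<alpha> + 1) * (cmod (J z) + c2 * cmod (u z))"
    proof -
      have "cmod (h z) = (\<alpha> + 1) * cmod (J z - (2 * \<i>) powr of_real \<alpha> * u z)"
        unfolding h_def norm_mult[of "of_real _"] norm_of_real using \<alpha> by simp
      also have "\<dots> \<le> (\<alpha> + 1) * (cmod (J z) + cmod ((2 * \<i>) powr of_real \<alpha> * u z))"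
        using \<alpha> by (intro mult_left_mono norm_triangle_ineq4) auto
      finally show ?thesis by (simp add: norm_mult c2_def)
    qed
    also have "\<dots> \<le> (\<alpha> + 1) * ((2 ^ k * C) * ?b ^ A1 / ?y ^ N1 + c2 * (\<bar>D\<bar> * ?b ^ A1 / ?y ^ N1))"
      using \<alpha> c2 by (intro mult_left_mono add_mono J1 u1) auto
    also have "\<dots> = ((\<alpha> + 1) * (2 ^ k * C + c2 * \<bar>D\<bar>)) * ?b ^ A1 / ?y ^ N1"
      using z by (simp add: field_simps)
    finally show ?thesis .
  qed
  moreover have "(\<alpha> + 1) * (2 ^ k * C + c2 * \<bar>D\<bar>) \<ge> 0" using \<alpha> C c2 by simp
  ultimately show ?thesis by blast
qed

text \<open>The principal power of z + \<i> has its cut on Im z = -1, so the gluing takes place in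
  the strip \<bar>Im z\<bar> < 1. Dividing by the power afterwards leaves \<open>E\<close> itself
  below the line, where no branch is involved.\<close>

lemma E_entire_extension:
  obtains Eh where "Eh holomorphic_on UNIV" "\<And>z. Im z < 0 \<Longrightarrow> Eh z = E z"
    "\<And>z. 0 < Im z \<Longrightarrow> Eh z = h z * (z + \<i>) powr of_real (-(\<alpha> + 1))"
proof -
  let ?p = "\<lambda>c z. (z + \<i>) powr of_real c"
  have hol_p: "?p c holomorphic_on {z. -1 < Im z}" for c
    by (intro holomorphic_intros) (auto simp: complex_nonpos_Reals_iff)
  define f where "f z = ?p (\<alpha> + 1) z * E z" for z
  \<comment> \<open>\<open>E_locally_bounded\<close> requires \<delta> \<le> \<alpha> + 1, the
    gluing \<delta> < 1.\<close>
  define \<delta> where "\<delta> = min (1/2) (\<alpha> + 1)"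
  have \<delta>: "0 < \<delta>" "\<delta> \<le> \<alpha> + 1" "\<delta> < 1" using \<alpha> by (auto simp: \<delta>_def)
  have fhol: "f holomorphic_on {z. -1 < Im z \<and> Im z < 0}"
    unfolding f_def by (intro holomorphic_on_mult holomorphic_on_subset[OF hol_p] holomorphic_on_subset[OF holE]) auto
  have hhol: "h holomorphic_on {z. 0 < Im z \<and> Im z < 1}"
    by (rule holomorphic_on_subset[OF holh]) auto
  have jump: "\<exists>\<eta>>0. \<forall>x \<epsilon>. \<bar>x\<bar> \<le> R \<and> 0 < \<epsilon> \<and> \<epsilon> < \<eta> \<longrightarrow> cmod (h (Complex x \<epsilon>) - f (Complex x (-\<epsilon>))) \<le> e"
    if "e > 0" for R e
    using jump_tends_to_0[of "\<bar>R\<bar>" e] that unfolding f_def by fastforce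
  have bnd: "\<exists>C \<eta>. 0 < \<eta> \<and> \<eta> \<le> 1 \<and> (\<forall>x \<epsilon>. \<bar>x\<bar> \<le> R \<and> 0 < \<epsilon> \<and> \<epsilon> < \<eta> \<longrightarrow>
      cmod (f (Complex x (-\<epsilon>))) \<le> C * \<epsilon> powr (-\<delta>) \<and> cmod (h (Complex x \<epsilon>)) \<le> C * \<epsilon> powr (-\<delta>))" for R
  proof -
    obtain C where C: "C \<ge> 0" "\<And>x \<epsilon>. \<bar>x\<bar> \<le> R \<Longrightarrow> 0 < \<epsilon> \<Longrightarrow> \<epsilon> < 1 \<Longrightarrow> cmod (E (Complex x (-\<epsilon>))) \<le> C * \<epsilon> powr -\<delta>"
      using E_locally_bounded[OF \<delta>(1,2), of R] by blast
    \<comment> \<open>The bound for \<open>h\<close> is inherited from \<open>f\<close>: the jump is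
      at most 1, which \<epsilon>^(-\<delta>) \<ge> 1 absorbs.\<close>
    obtain \<eta> where \<eta>: "\<eta> > 0" "\<And>x \<epsilon>. \<bar>x\<bar> \<le> R \<Longrightarrow> 0 < \<epsilon> \<Longrightarrow> \<epsilon> < \<eta> \<Longrightarrow> cmod (h (Complex x \<epsilon>) - f (Complex x (-\<epsilon>))) \<le> 1"
      using jump[of 1 R] by auto
    define B where "B = (\<bar>R\<bar> + 1) powr (\<alpha> + 1) * C"
    have fb: "cmod (f (Complex x (-\<epsilon>))) \<le> B * \<epsilon> powr -\<delta>" if x: "\<bar>x\<bar> \<le> R" and e: "0 < \<epsilon>" "\<epsilon> < 1" for x \<epsilon>
    proof -
      have "cmod (Complex x (-\<epsilon>) + \<i>) \<le> \<bar>Re (Complex x (-\<epsilon>) + \<i>)\<bar> + \<bar>Im (Complex x (-\<epsilon>) + \<i>)\<bar>" by (rule cmod_le)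
      then have "cmod (Complex x (-\<epsilon>) + \<i>) \<le> \<bar>R\<bar> + 1" using x e by auto
      then have "cmod (Complex x (-\<epsilon>) + \<i>) powr (\<alpha> + 1) \<le> (\<bar>R\<bar> + 1) powr (\<alpha> + 1)"
        using \<alpha> by (intro powr_mono2) auto
      then have "cmod (f (Complex x (-\<epsilon>))) \<le> (\<bar>R\<bar> + 1) powr (\<alpha> + 1) * (C * \<epsilon> powr -\<delta>)"
        unfolding f_def norm_mult cmod_powr_of_real using C(2)[OF x e] by (intro mult_mono) auto
      then show ?thesis by (simp add: B_def)
    qed
    have "cmod (f (Complex x (-\<epsilon>))) \<le> (B + 1) * \<epsilon> powr -\<delta> \<and> cmod (h (Complex x \<epsilon>)) \<le> (B + 1) * \<epsilon> powr -\<delta>"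
      if x: "\<bar>x\<bar> \<le> R" and e: "0 < \<epsilon>" "\<epsilon> < min \<eta> 1" for x \<epsilon>
    proof -
      have 1: "1 \<le> \<epsilon> powr -\<delta>"
        using powr_mono2'[of \<delta> \<epsilon> 1] e \<delta> by (simp add: powr_minus one_le_inverse powr_le1)
      have 2: "cmod (f (Complex x (-\<epsilon>))) \<le> B * \<epsilon> powr -\<delta>" using fb[OF x] e by simp
      have "cmod (h (Complex x \<epsilon>)) \<le> cmod (f (Complex x (-\<epsilon>))) + cmod (h (Complex x \<epsilon>) - f (Complex x (-\<epsilon>)))"
        using norm_triangle_ineq[of "f (Complex x (-\<epsilon>))" "h (Complex x \<epsilon>) - f (Complex x (-\<epsilon>))"] by simp
      then have "cmod (h (Complex x \<epsilon>)) \<le> B * \<epsilon> powr -\<delta> + 1" using 2 \<eta>(2)[OF x e(1)] e by simp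
      then show ?thesis using 1 2 by (simp add: distrib_right)
    qed
    then show ?thesis using \<eta>(1) by (intro exI[of _ "B + 1"] exI[of _ "min \<eta> 1"]) auto
  qed
  obtain H where H: "H holomorphic_on {z. \<bar>Im z\<bar> < 1}"
    "\<And>z. -1 < Im z \<Longrightarrow> Im z < 0 \<Longrightarrow> H z = f z" "\<And>z. 0 < Im z \<Longrightarrow> Im z < 1 \<Longrightarrow> H z = h z"
    using glue_across_real_line[OF fhol hhol bnd \<delta>(3) jump] by blast
  define Eh where "Eh z = (if Im z < 0 then E z else (if Im z < 1 then H z else h z) * ?p (-(\<alpha> + 1)) z)" for z
  have pp: "?p (\<alpha> + 1) z * ?p (-(\<alpha> + 1)) z = 1" if "-1 < Im z" for z
  proof -
    have "z + \<i> \<noteq> 0" using that by (auto simp: complex_eq_iff)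
    then show ?thesis by (simp flip: powr_add)
  qed
  have "Eh holomorphic_on {z. Im z < 0}"
    by (rule holomorphic_transform[OF holE]) (simp add: Eh_def)
  moreover have "Eh holomorphic_on {z. \<bar>Im z\<bar> < 1}"
  proof (rule holomorphic_transform)
    show "(\<lambda>z. H z * ?p (-(\<alpha> + 1)) z) holomorphic_on {z. \<bar>Im z\<bar> < 1}"
      by (intro holomorphic_on_mult H(1) holomorphic_on_subset[OF hol_p]) auto
    fix z assume "z \<in> {z. \<bar>Im z\<bar> < 1}"
    then have z: "-1 < Im z" "Im z < 1" by auto
    show "H z * ?p (-(\<alpha> + 1)) z = Eh z"
    proof (cases "Im z < 0")
      case True
      have "H z * ?p (-(\<alpha> + 1)) z = (?p (\<alpha> + 1) z * ?p (-(\<alpha> + 1)) z) * E z"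
        using H(2)[OF z(1) True] by (simp add: f_def)
      then show ?thesis unfolding pp[OF z(1)] using True by (simp add: Eh_def)
    qed (use z in \<open>simp add: Eh_def\<close>)
  qed
  moreover have "Eh holomorphic_on {z. 0 < Im z}"
  proof (rule holomorphic_transform)
    show "(\<lambda>z. h z * ?p (-(\<alpha> + 1)) z) holomorphic_on {z. 0 < Im z}"
      by (intro holomorphic_on_mult holh holomorphic_on_subset[OF hol_p]) auto
  qed (simp add: Eh_def H(3))
  moreover have "open {z. \<bar>Im z\<bar> < 1}"
  proof -
    have "{z. \<bar>Im z\<bar> < 1} = {z. -1 < Im z} \<inter> {z. Im z < 1}" by auto
    then show ?thesis by (simp add: open_Int open_halfspace_Im_gt open_halfspace_Im_lt)
  qed
  ultimately have "Eh holomorphic_on ({z. Im z < 0} \<union> {z. \<bar>Im z\<bar> < 1}) \<union> {z. 0 < Im z}"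
    by (intro holomorphic_on_Un open_Un open_halfspace_Im_gt open_halfspace_Im_lt)
  moreover have "({z. Im z < 0} \<union> {z. \<bar>Im z\<bar> < 1}) \<union> {z. 0 < Im z} = UNIV"
    by (auto simp: not_less)
  ultimately have "Eh holomorphic_on UNIV" by simp
  then show ?thesis using that[of Eh] H(3) by (simp add: Eh_def)
qed

lemma G_higher_deriv_eventually_0: "\<exists>K. \<forall>n>K. (deriv ^^ n) G (- \<i>) = 0"
proof -
  obtain Eh where Eh: "Eh holomorphic_on UNIV" "\<And>z. Im z < 0 \<Longrightarrow> Eh z = E z"
    "\<And>z. 0 < Im z \<Longrightarrow> Eh z = h z * (z + \<i>) powr of_real (-(\<alpha> + 1))"
    using E_entire_extension by blast
  obtain C A N where C: "C \<ge> 0" "N > 0" "\<And>z. Im z < 0 \<Longrightarrow> cmod (E z) \<le> C * (1 + cmod z) ^ A / \<bar>Im z\<bar> ^ N"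
    using E_temperate by blast
  obtain D B M where D: "D \<ge> 0" "\<And>z. 0 < Im z \<Longrightarrow> cmod (h z) \<le> D * (1 + cmod z) ^ B / Im z ^ M"
    using h_temperate by blast
  define A1 where "A1 = A + M + B + N"
  have "cmod (Eh z) \<le> (C + D) * (1 + cmod z) ^ A1 / \<bar>Im z\<bar> ^ (N + M)" if z: "Im z \<noteq> 0" for z
  proof -
    have yb: "\<bar>Im z\<bar> \<le> 1 + cmod z" using abs_Im_le_cmod[of z] by linarith
    have y: "0 < \<bar>Im z\<bar>" using z by simp
    have mono: "X * (1 + cmod z) ^ A1 / \<bar>Im z\<bar> ^ (N + M) \<le> (C + D) * (1 + cmod z) ^ A1 / \<bar>Im z\<bar> ^ (N + M)"
      if "X \<le> C + D" for X
      using that y by (intro divide_right_mono mult_right_mono) auto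
    show ?thesis
    proof (cases "Im z < 0")
      case True
      have "cmod (Eh z) \<le> C * (1 + cmod z) ^ A / \<bar>Im z\<bar> ^ N" using C(3) Eh(2) True by simp
      also have "\<dots> \<le> C * (1 + cmod z) ^ A1 / \<bar>Im z\<bar> ^ (N + M)"
        using y yb C(1) by (intro temperate_mono) (auto simp: A1_def)
      also have "\<dots> \<le> (C + D) * (1 + cmod z) ^ A1 / \<bar>Im z\<bar> ^ (N + M)"
        by (rule mono) (use D in simp)
      finally show ?thesis .
    next
      case False
      then have z0: "0 < Im z" using z by simp
      \<comment> \<open>Above the line z + \<i> has modulus at least 1, so the factor with negative
        exponent does not spoil the bound of \<open>h\<close>.\<close>
      have "1 \<le> cmod (z + \<i>)" using abs_Im_le_cmod[of "z + \<i>"] z0 by simp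
      then have "cmod (z + \<i>) powr (-(\<alpha> + 1)) \<le> 1 powr (-(\<alpha> + 1))"
        using \<alpha> by (intro powr_mono2') auto
      then have "cmod (Eh z) \<le> cmod (h z) * 1"
        unfolding Eh(3)[OF z0] norm_mult cmod_powr_of_real by (intro mult_left_mono) auto
      also have "\<dots> \<le> D * (1 + cmod z) ^ B / \<bar>Im z\<bar> ^ M" using D(2)[OF z0] z0 by simp
      also have "\<dots> \<le> D * (1 + cmod z) ^ A1 / \<bar>Im z\<bar> ^ (M + N)"
        using y yb D(1) by (intro temperate_mono) (auto simp: A1_def)
      also have "\<dots> \<le> (C + D) * (1 + cmod z) ^ A1 / \<bar>Im z\<bar> ^ (N + M)"
        unfolding add.commute[of M N] by (rule mono) (use C in simp)
      finally show ?thesis .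
    qed
  qed
  then have *: "(deriv ^^ n) Eh (- \<i>) = 0" if "n > A1" for n
    using that C D by (intro higher_deriv_0_temperate[OF Eh(1), of "C + D" A1 "N + M"]) auto
  have "(deriv ^^ n) G (- \<i>) = 0" if "n > A1" for n
  proof (rule G_higher_deriv_0)
    have "(deriv ^^ n) E (- \<i>) = (deriv ^^ n) Eh (- \<i>)"
      by (rule higher_deriv_transform_within_open[OF holE _ open_halfspace_Im_lt])
        (use Eh in \<open>auto intro: holomorphic_on_subset\<close>)
    then show "(deriv ^^ n) E (- \<i>) = 0" using *[OF that] by simp
  qed
  then show ?thesis by blast
qed

lemma F_polynomial: "\<exists>P. \<forall>z. 0 < Im z \<longrightarrow> cnj (F z) = poly P (cnj z)"
proof -
  let ?L = "{z. Im z < 0}"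
  obtain K where K: "\<And>n. n > K \<Longrightarrow> (deriv ^^ n) G (- \<i>) = 0"
    using G_higher_deriv_eventually_0 by blast
  define Q where "Q z = (\<Sum>n\<le>K. (deriv ^^ n) G (- \<i>) / fact n * (z - (- \<i>)) ^ n)" for z
  have sub: "ball (- \<i>) 1 \<subseteq> ?L"
  proof
    fix z assume "z \<in> ball (- \<i>) 1"
    then show "z \<in> ?L" using abs_Im_le_cmod[of "- \<i> - z"] by (auto simp: dist_norm)
  qed
  have ball: "G z = Q z" if z: "z \<in> ball (- \<i>) 1" for z
  proof -
    have "(\<lambda>n. (deriv ^^ n) G (- \<i>) / fact n * (z - (- \<i>)) ^ n) sums G z"
      by (rule holomorphic_power_series[OF holomorphic_on_subset[OF holG sub] z])
    moreover have "(\<lambda>n. (deriv ^^ n) G (- \<i>) / fact n * (z - (- \<i>)) ^ n) sums Q z"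
      unfolding Q_def by (rule sums_finite) (use K in auto)
    ultimately show ?thesis by (rule sums_unique2)
  qed
  \<comment> \<open>The finite Taylor sum on the unit disc about -\<i> is continued to the
    half-plane by the identity theorem.\<close>
  have GQ: "G z = Q z" if "z \<in> ?L" for z
  proof (rule analytic_continuation_open[of "ball (- \<i>) 1" ?L G Q])
    show "connected ?L" by (intro convex_connected convex_halfspace_Im_lt)
    show "Q holomorphic_on ?L" unfolding Q_def by (intro holomorphic_intros) auto
  qed (use sub ball holG that open_halfspace_Im_lt in auto)
  define P where "P = (\<Sum>n\<le>K. smult ((deriv ^^ n) G (- \<i>) / fact n) ([:\<i>, 1:] ^ n))"
  have "poly P z = Q z" for z
    unfolding P_def Q_def by (simp add: poly_sum poly_power add.commute)
  then have "cnj (F z) = poly P (cnj z)" if "0 < Im z" for z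
    using GQ[of "cnj z"] that by (simp add: G_def)
  then show ?thesis by blast
qed

end

section \<open>Homogeneous solutions\<close>

text \<open>The strict Enestroem--Kakeya theorem.\<close>

lemma sum_powers_nonzero_unit_circle:
  fixes b :: "nat \<Rightarrow> real"
  assumes dec: "\<And>m. m < k \<Longrightarrow> b (Suc m) < b m" and pos: "0 < b k" and t: "cmod t = 1"
  shows "(\<Sum>m\<le>k. of_real (b m) * t ^ m) \<noteq> 0"
proof
  assume S: "(\<Sum>m\<le>k. of_real (b m) * t ^ m) = 0"
  have bpos: "0 < b (k - j)" for j
  proof (induction j)
    case (Suc j)
    show ?case
    proof (cases "j < k")
      case True
      then show ?thesis using Suc dec[of "k - Suc j"] by (simp add: Suc_diff_Suc)
    qed (use Suc in simp)
  qed (use pos in simp)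
  have bpos: "0 < b m" if "m \<le> k" for m using bpos[of "k - m"] that by simp
  show False
  proof (cases "t = 1")
    case True
    then have "complex_of_real (\<Sum>m\<le>k. b m) = 0" using S by simp
    moreover have "0 < (\<Sum>m\<le>k. b m)" using bpos by (intro sum_pos) auto
    ultimately show False by (simp only: of_real_eq_0_iff)
  next
    case False
    have Ret: "Re (t ^ n) \<le> 1" for n
      using complex_Re_le_cmod[of "t ^ n"] t by (simp add: norm_power)
    have Re1: "Re t < 1"
    proof (rule ccontr)
      assume "\<not> Re t < 1"
      then have "Re t = 1" using Ret[of 1] by simp
      then have "Im t = 0" using t by (simp add: cmod_def)
      then show False using \<open>Re t = 1\<close> False by (simp add: complex_eq_iff)
    qed
    \<comment> \<open>Abel summation: multiplication by 1 - t brings in the differences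
      \<open>b m - b (Suc m)\<close>, positive for m < k.\<close>
    have "(1 - t) * (\<Sum>m\<le>n. of_real (b m) * t ^ m) =
        of_real (b 0) - (\<Sum>m<n. of_real (b m - b (Suc m)) * t ^ Suc m) - of_real (b n) * t ^ Suc n" for n
      by (induction n) (simp_all add: algebra_simps)
    from this[of k] have "of_real (b 0) = (\<Sum>m<k. of_real (b m - b (Suc m)) * t ^ Suc m) + of_real (b k) * t ^ Suc k"
      unfolding S by (simp add: algebra_simps)
    then have "b 0 = Re ((\<Sum>m<k. of_real (b m - b (Suc m)) * t ^ Suc m) + of_real (b k) * t ^ Suc k)"
      by (metis Re_complex_of_real)
    also have "\<dots> = (\<Sum>m<k. (b m - b (Suc m)) * Re (t ^ Suc m)) + b k * Re (t ^ Suc k)"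
      by (simp only: plus_complex.sel Re_sum Re_complex_of_real times_complex.sel Im_complex_of_real mult_zero_left diff_zero)
    finally have b0: "b 0 = (\<Sum>m<k. (b m - b (Suc m)) * Re (t ^ Suc m)) + b k * Re (t ^ Suc k)" .
    show False
    proof (cases "k = 0")
      case True
      then show False using b0 Re1 bpos[of 0] by simp
    next
      case False
      \<comment> \<open>By \<open>b0\<close>, b 0 is a sum of real parts at most 1 with positive
        weights of total b 0. The term m = 0 is strictly smaller than its weight because Re t < 1, a
        contradiction.\<close>
      have "(\<Sum>m<k. (b m - b (Suc m)) * Re (t ^ Suc m)) < (\<Sum>m<k. b m - b (Suc m))"
      proof (rule sum_strict_mono_ex1)
        show "\<forall>m\<in>{..<k}. (b m - b (Suc m)) * Re (t ^ Suc m) \<le> b m - b (Suc m)"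
          using dec Ret by (auto intro!: mult_left_le simp del: power_Suc simp: less_imp_le)
        have "(b 0 - b (Suc 0)) * Re t < (b 0 - b (Suc 0)) * 1"
          using dec[of 0] False Re1 by (intro mult_strict_left_mono) auto
        then show "\<exists>m\<in>{..<k}. (b m - b (Suc m)) * Re (t ^ Suc m) < b m - b (Suc m)"
          using False by (intro bexI[of _ 0]) auto
      qed simp
      also have "\<dots> = b 0 - b k" by (rule sum_lessThan_telescope')
      finally have "b 0 < b 0 - b k + b k * Re (t ^ Suc k)" using b0 by linarith
      moreover have "b k * Re (t ^ Suc k) \<le> b k" using Ret[of "Suc k"] pos by (intro mult_left_le) auto
      ultimately show False by linarith
    qed
  qed
qed

text \<open>The Taylor coefficients at 0 of (1 - x)^(-\<alpha>-1). For z \<noteq> 0,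
  \<open>hpoly\<close> is z^k times the partial sum up to degree k of this series at x = cnj z /
  z.\<close>

definition hcoeff :: "real \<Rightarrow> nat \<Rightarrow> real" where
  "hcoeff \<alpha> m = pochhammer (\<alpha> + 1) m / fact m"

definition hpoly :: "real \<Rightarrow> nat \<Rightarrow> complex \<Rightarrow> complex" where
  "hpoly \<alpha> k z = (\<Sum>m\<le>k. of_real (hcoeff \<alpha> m) * cnj z ^ m * z ^ (k - m))"

lemma hcoeff_0: "hcoeff \<alpha> 0 = 1"
  by (simp add: hcoeff_def)

lemma hcoeff_Suc: "real (Suc m) * hcoeff \<alpha> (Suc m) = (\<alpha> + 1 + real m) * hcoeff \<alpha> m"
  by (simp add: hcoeff_def pochhammer_Suc mult.commute del: of_nat_Suc)

lemma hcoeff_pos: "\<alpha> > -1 \<Longrightarrow> 0 < hcoeff \<alpha> m"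
  unfolding hcoeff_def by (intro divide_pos_pos pochhammer_pos) auto

lemma hcoeff_Suc_diff: "real (Suc m) * (hcoeff \<alpha> (Suc m) - hcoeff \<alpha> m) = \<alpha> * hcoeff \<alpha> m"
  using hcoeff_Suc[of m \<alpha>] by (simp add: algebra_simps)

text \<open>
  This is where $\alpha \neq 0$ enters: the coefficients are strictly increasing in $m$ for $\alpha > 0$ and
  strictly decreasing for $\alpha < 0$, whereas for $\alpha = 0$ the sum has zeros in the upper half-plane.
\<close>

lemma hpoly_nonzero:
  assumes "\<alpha> > -1" "\<alpha> \<noteq> 0" "z \<noteq> 0"
  shows "hpoly \<alpha> k z \<noteq> 0"
proof -
  define t where "t = cnj z / z"
  have t: "cmod t = 1" "t \<noteq> 0" using assms by (auto simp: t_def norm_divide)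
  have "hpoly \<alpha> k z = (\<Sum>m\<le>k. z ^ k * (of_real (hcoeff \<alpha> m) * t ^ m))"
    unfolding hpoly_def
  proof (rule sum.cong)
    fix m assume "m \<in> {..k}"
    then have "z ^ k = z ^ m * z ^ (k - m)" by (simp flip: power_add)
    moreover have "cnj z ^ m = t ^ m * z ^ m" using assms by (simp add: t_def power_divide)
    ultimately show "of_real (hcoeff \<alpha> m) * cnj z ^ m * z ^ (k - m) = z ^ k * (of_real (hcoeff \<alpha> m) * t ^ m)"
      by simp
  qed simp
  then have hp: "hpoly \<alpha> k z = z ^ k * (\<Sum>m\<le>k. of_real (hcoeff \<alpha> m) * t ^ m)"
    by (simp add: sum_distrib_left)
  have "(\<Sum>m\<le>k. of_real (hcoeff \<alpha> m) * t ^ m) \<noteq> 0"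
  proof (cases "\<alpha> < 0")
    case True
    show ?thesis
    proof (rule sum_powers_nonzero_unit_circle)
      fix m
      have "real (Suc m) * (hcoeff \<alpha> (Suc m) - hcoeff \<alpha> m) < 0"
        unfolding hcoeff_Suc_diff using True hcoeff_pos[OF assms(1)] by (rule mult_neg_pos)
      then show "hcoeff \<alpha> (Suc m) < hcoeff \<alpha> m" by (simp add: mult_less_0_iff)
    qed (use t hcoeff_pos[OF assms(1)] in auto)
  next
    case False
    then have a: "\<alpha> > 0" using assms by simp
    \<comment> \<open>For increasing coefficients the sum is reversed: up to the factor t^k it is a
      polynomial in 1 / t, also on the unit circle, with decreasing coefficients.\<close>
    have "(\<Sum>m\<le>k. of_real (hcoeff \<alpha> (k - m)) * (inverse t) ^ m) \<noteq> 0"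
    proof (rule sum_powers_nonzero_unit_circle)
      fix m assume m: "m < k"
      have "0 < real (Suc (k - Suc m)) * (hcoeff \<alpha> (Suc (k - Suc m)) - hcoeff \<alpha> (k - Suc m))"
        unfolding hcoeff_Suc_diff using a hcoeff_pos[OF assms(1)] by simp
      then show "hcoeff \<alpha> (k - Suc m) < hcoeff \<alpha> (k - m)"
        using m by (simp add: zero_less_mult_iff Suc_diff_Suc)
    qed (use t hcoeff_pos[OF assms(1)] in \<open>auto simp: norm_inverse\<close>)
    moreover have "(\<Sum>m\<le>k. of_real (hcoeff \<alpha> m) * t ^ m)
        = (\<Sum>m\<le>k. of_real (hcoeff \<alpha> (k - m)) * t ^ (k - m))"
      by (rule sum.nat_diff_reindex[symmetric, of "\<lambda>m. of_real (hcoeff \<alpha> m) * t ^ m" "Suc k", simplified lessThan_Suc_atMost, simplified])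
    moreover have "\<dots> = (\<Sum>m\<le>k. t ^ k * (of_real (hcoeff \<alpha> (k - m)) * (inverse t) ^ m))"
      using t by (intro sum.cong) (auto simp: power_diff field_simps)
    ultimately show ?thesis using t by (simp add: sum_distrib_left[symmetric])
  qed
  then show ?thesis using assms hp by simp
qed

lemma hpoly_scale: "hpoly \<alpha> k (of_real r * z) = of_real r ^ k * hpoly \<alpha> k z"
  unfolding hpoly_def sum_distrib_left
proof (rule sum.cong)
  fix m assume "m \<in> {..k}"
  then have "complex_of_real r ^ k = of_real r ^ m * of_real r ^ (k - m)" by (simp flip: power_add)
  then show "of_real (hcoeff \<alpha> m) * cnj (of_real r * z) ^ m * (of_real r * z) ^ (k - m)
      = of_real r ^ k * (of_real (hcoeff \<alpha> m) * cnj z ^ m * z ^ (k - m))"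
    by (simp add: power_mult_distrib)
qed simp

lemma hpoly_cont: "continuous_on S (hpoly \<alpha> k)"
  unfolding hpoly_def by (intro continuous_intros)

lemma hpoly_sphere: "\<exists>\<xi>\<in>sphere 0 1. hpoly \<alpha> k z = of_real (cmod z) ^ k * hpoly \<alpha> k \<xi>"
proof (cases "z = 0")
  case True
  then show ?thesis using hpoly_scale[of \<alpha> k 0 1] by (intro bexI[of _ 1]) auto
next
  case False
  then show ?thesis using hpoly_scale[of \<alpha> k "cmod z" "z / of_real (cmod z)"]
    by (intro bexI[of _ "z / of_real (cmod z)"]) (auto simp: norm_divide)
qed

lemma hpoly_upper: "\<exists>B\<ge>0. \<forall>z. cmod (hpoly \<alpha> k z) \<le> B * cmod z ^ k"
proof -
  have "bounded (hpoly \<alpha> k ` sphere 0 1)"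
    by (intro compact_imp_bounded compact_continuous_image hpoly_cont) auto
  then obtain B where B: "\<And>\<xi>. \<xi> \<in> sphere 0 1 \<Longrightarrow> cmod (hpoly \<alpha> k \<xi>) \<le> B" unfolding bounded_iff by blast
  have "0 \<le> B" using B[of 1] norm_ge_zero order_trans by (auto intro: order_trans[OF norm_ge_zero])
  moreover have "cmod (hpoly \<alpha> k z) \<le> B * cmod z ^ k" for z
  proof -
    obtain \<xi> where \<xi>: "\<xi> \<in> sphere 0 1" "hpoly \<alpha> k z = of_real (cmod z) ^ k * hpoly \<alpha> k \<xi>"
      using hpoly_sphere by blast
    then have "cmod (hpoly \<alpha> k z) = cmod (hpoly \<alpha> k \<xi>) * cmod z ^ k" by (simp add: norm_mult norm_power)
    also have "\<dots> \<le> B * cmod z ^ k" by (intro mult_right_mono B \<xi>) simp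
    finally show ?thesis .
  qed
  ultimately show ?thesis by blast
qed

text \<open>The minimum over the unit circle is positive by \<open>hpoly_nonzero\<close>, and
  homogeneity spreads it over the plane. Including the real points of the circle matters, because
  the arguments of a sequence in the half-plane may tend to 0 or pi.\<close>

lemma hpoly_lower:
  assumes "\<alpha> > -1" "\<alpha> \<noteq> 0"
  shows "\<exists>c>0. \<forall>z. c * cmod z ^ k \<le> cmod (hpoly \<alpha> k z)"
proof -
  have "\<exists>\<xi>0\<in>sphere (0::complex) 1. \<forall>\<xi>\<in>sphere 0 1. cmod (hpoly \<alpha> k \<xi>0) \<le> cmod (hpoly \<alpha> k \<xi>)"
    by (intro continuous_attains_inf continuous_intros hpoly_cont) auto
  then obtain \<xi>0 where x0: "\<xi>0 \<in> sphere 0 1" "\<And>\<xi>. \<xi> \<in> sphere 0 1 \<Longrightarrow> cmod (hpoly \<alpha> k \<xi>0) \<le> cmod (hpoly \<alpha> k \<xi>)"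
    by blast
  have "\<xi>0 \<noteq> 0" using x0(1) by auto
  then have "0 < cmod (hpoly \<alpha> k \<xi>0)" using hpoly_nonzero[OF assms] by simp
  moreover have "cmod (hpoly \<alpha> k \<xi>0) * cmod z ^ k \<le> cmod (hpoly \<alpha> k z)" for z
  proof -
    obtain \<xi> where \<xi>: "\<xi> \<in> sphere 0 1" "hpoly \<alpha> k z = of_real (cmod z) ^ k * hpoly \<alpha> k \<xi>"
      using hpoly_sphere by blast
    then have "cmod (hpoly \<alpha> k z) = cmod (hpoly \<alpha> k \<xi>) * cmod z ^ k" by (simp add: norm_mult norm_power)
    moreover have "cmod (hpoly \<alpha> k \<xi>0) * cmod z ^ k \<le> cmod (hpoly \<alpha> k \<xi>) * cmod z ^ k"
      by (intro mult_right_mono x0 \<xi>) simp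
    ultimately show ?thesis by simp
  qed
  ultimately show ?thesis by blast
qed

text \<open>After multiplication by \<bar>zs j\<bar>^(-n) the terms of degree below n tend to 0,
  while the one of degree n keeps modulus at least \<bar>b n\<bar> c by \<open>hpoly_lower\<close>.
  So b n = 0, and the shorter sum still tends to 0.\<close>

lemma hpoly_combination_zero:
  assumes \<alpha>: "\<alpha> > -1" "\<alpha> \<noteq> 0" and zs: "filterlim zs at_infinity sequentially"
    and lim: "(\<lambda>j. \<Sum>k<n. b k * hpoly \<alpha> k (zs j)) \<longlonglongrightarrow> 0"
  shows "\<forall>k<n. b k = 0"
  using lim
proof (induction n)
  case (Suc n)
  let ?i = "\<lambda>j. inverse (cmod (zs j))"
  have "filterlim (\<lambda>j. cmod (zs j)) at_top sequentially"
    by (rule filterlim_compose[OF filterlim_norm_at_top zs])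
  then have i0: "?i \<longlonglongrightarrow> 0" by (rule tendsto_inverse_0_at_top)
  have nz: "eventually (\<lambda>j. zs j \<noteq> 0) sequentially"
    using zs by (auto simp: filterlim_at_infinity[of 0, OF order_refl] dest!: spec[of _ 1] elim: eventually_mono)
  have low: "(\<lambda>j. b k * hpoly \<alpha> k (zs j) * of_real (?i j) ^ n) \<longlonglongrightarrow> 0" if "k < n" for k
  proof -
    obtain B where B: "\<And>z. cmod (hpoly \<alpha> k z) \<le> B * cmod z ^ k" using hpoly_upper by blast
    show ?thesis
    proof (rule Lim_null_comparison)
      show "eventually (\<lambda>j. norm (b k * hpoly \<alpha> k (zs j) * of_real (?i j) ^ n) \<le> cmod (b k) * B * ?i j ^ (n - k)) sequentially"
        using nz
      proof eventually_elim
        case (elim j)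
        have "norm (b k * hpoly \<alpha> k (zs j) * of_real (?i j) ^ n) = cmod (b k) * cmod (hpoly \<alpha> k (zs j)) * ?i j ^ n"
          by (simp add: norm_mult norm_power norm_inverse)
        also have "\<dots> \<le> cmod (b k) * (B * cmod (zs j) ^ k) * ?i j ^ n"
          by (intro mult_right_mono mult_left_mono B) auto
        also have "?i j ^ n = ?i j ^ k * ?i j ^ (n - k)" using that by (simp flip: power_add)
        also have "cmod (b k) * (B * cmod (zs j) ^ k) * (?i j ^ k * ?i j ^ (n - k)) = cmod (b k) * B * ?i j ^ (n - k)"
          using elim by (simp add: power_inverse)
        finally show ?case .
      qed
      have "(\<lambda>j. cmod (b k) * B * ?i j ^ (n - k)) \<longlonglongrightarrow> cmod (b k) * B * 0 ^ (n - k)"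
        by (intro tendsto_intros i0)
      moreover have "(0::real) ^ (n - k) = 0" using that by (simp add: power_0_left)
      ultimately show "(\<lambda>j. cmod (b k) * B * ?i j ^ (n - k)) \<longlonglongrightarrow> 0" by (simp only: mult_zero_right)
    qed
  qed
  have "(\<lambda>j. (\<Sum>k<Suc n. b k * hpoly \<alpha> k (zs j)) * of_real (?i j) ^ n - (\<Sum>k<n. b k * hpoly \<alpha> k (zs j) * of_real (?i j) ^ n))
      \<longlonglongrightarrow> 0 * of_real 0 ^ n - (\<Sum>k<n. 0)"
    by (intro tendsto_diff tendsto_mult Suc.prems tendsto_power tendsto_of_real i0 tendsto_sum low) auto
  then have top: "(\<lambda>j. b n * hpoly \<alpha> n (zs j) * of_real (?i j) ^ n) \<longlonglongrightarrow> 0"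
    by (simp add: sum_distrib_right distrib_right)
  obtain c where c: "c > 0" "\<And>z. c * cmod z ^ n \<le> cmod (hpoly \<alpha> n z)" using hpoly_lower[OF \<alpha>] by blast
  have "cmod (b n) * c \<le> 0"
  proof (rule tendsto_lowerbound)
    show "(\<lambda>j. cmod (b n * hpoly \<alpha> n (zs j) * of_real (?i j) ^ n)) \<longlonglongrightarrow> 0"
      using top by (rule tendsto_norm_zero)
    show "eventually (\<lambda>j. cmod (b n) * c \<le> cmod (b n * hpoly \<alpha> n (zs j) * of_real (?i j) ^ n)) sequentially"
      using nz
    proof eventually_elim
      case (elim j)
      have "cmod (b n) * c = cmod (b n) * (c * cmod (zs j) ^ n) * ?i j ^ n" using elim by (simp add: power_inverse)
      also have "\<dots> \<le> cmod (b n) * cmod (hpoly \<alpha> n (zs j)) * ?i j ^ n"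
        by (intro mult_right_mono mult_left_mono c) auto
      finally show ?case by (simp add: norm_mult norm_power norm_inverse)
    qed
  qed simp
  then have bn: "b n = 0" using c(1) by (simp add: mult_le_0_iff)
  then have "\<forall>k<n. b k = 0" using Suc by simp
  with bn show ?case by (auto simp: less_Suc_eq)
qed simp

lemma hpoly_Suc: "hpoly \<alpha> (Suc k) z = z * hpoly \<alpha> k z + of_real (hcoeff \<alpha> (Suc k)) * cnj z ^ Suc k"
  unfolding hpoly_def sum_distrib_left by (simp add: Suc_diff_le mult_ac)

text \<open>Here Q is the dbar derivative. As dbar y = \<i>/2 and z - cnj z = 2 \<i> y, the second
  identity says that dbar of y^(\<alpha>+1) \<open>hpoly\<close> is y^\<alpha> times a single power
  of cnj z. In the induction step z times the old right-hand side cancels by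
  \<open>hcoeff_Suc\<close>.\<close>

lemma hpoly_has_derivative:
  "\<exists>P Q. (hpoly \<alpha> k has_derivative (\<lambda>h. P * h + Q * cnj h)) (at z) \<and>
    of_real (\<alpha> + 1) * hpoly \<alpha> k z - (z - cnj z) * Q = of_real ((\<alpha> + 1 + real k) * hcoeff \<alpha> k) * cnj z ^ k"
proof (induction k)
  case 0
  have "hpoly \<alpha> 0 = (\<lambda>z. 1)" by (simp add: hpoly_def hcoeff_0 fun_eq_iff)
  then show ?case by (intro exI[of _ 0]) (auto simp: hcoeff_0)
next
  case (Suc k)
  then obtain P Q where PQ: "(hpoly \<alpha> k has_derivative (\<lambda>h. P * h + Q * cnj h)) (at z)"
    "of_real (\<alpha> + 1) * hpoly \<alpha> k z - (z - cnj z) * Q = of_real ((\<alpha> + 1 + real k) * hcoeff \<alpha> k) * cnj z ^ k"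
    by blast
  let ?a = "complex_of_real (hcoeff \<alpha> (Suc k))"
  have cn: "((\<lambda>z. cnj z ^ Suc k) has_derivative (\<lambda>h. of_nat (Suc k) * cnj z ^ k * cnj h)) (at z)"
    by (rule has_derivative_eq_rhs[OF has_derivative_power[OF bounded_linear_imp_has_derivative[OF bounded_linear_cnj]]])
      (auto simp: mult_ac)
  have "(hpoly \<alpha> (Suc k) has_derivative (\<lambda>h. (z * (P * h + Q * cnj h) + h * hpoly \<alpha> k z) + ?a * (of_nat (Suc k) * cnj z ^ k * cnj h))) (at z)"
    unfolding hpoly_Suc[abs_def]
    by (intro has_derivative_add has_derivative_mult has_derivative_ident PQ(1) has_derivative_mult_right cn)
  moreover have "(\<lambda>h. (z * (P * h + Q * cnj h) + h * hpoly \<alpha> k z) + ?a * (of_nat (Suc k) * cnj z ^ k * cnj h))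
     = (\<lambda>h. (z * P + hpoly \<alpha> k z) * h + (z * Q + ?a * of_nat (Suc k) * cnj z ^ k) * cnj h)"
    by (simp add: fun_eq_iff algebra_simps)
  moreover have "of_real (\<alpha> + 1) * hpoly \<alpha> (Suc k) z - (z - cnj z) * (z * Q + ?a * of_nat (Suc k) * cnj z ^ k)
     = of_real ((\<alpha> + 1 + real (Suc k)) * hcoeff \<alpha> (Suc k)) * cnj z ^ Suc k"
  proof -
    have r: "of_nat (Suc k) * ?a = of_real ((\<alpha> + 1 + real k) * hcoeff \<alpha> k)"
      unfolding hcoeff_Suc[symmetric] by simp
    have "of_real (\<alpha> + 1) * hpoly \<alpha> (Suc k) z - (z - cnj z) * (z * Q + ?a * of_nat (Suc k) * cnj z ^ k)
       = z * (of_real (\<alpha> + 1) * hpoly \<alpha> k z - (z - cnj z) * Q) - z * (of_nat (Suc k) * ?a) * cnj z ^ k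
         + (of_real (\<alpha> + 1) + of_nat (Suc k)) * ?a * cnj z ^ Suc k"
      unfolding hpoly_Suc by (simp add: algebra_simps)
    also have "\<dots> = (of_real (\<alpha> + 1) + of_nat (Suc k)) * ?a * cnj z ^ Suc k"
      unfolding PQ(2) r by (simp add: algebra_simps)
    finally show ?thesis by simp
  qed
  ultimately show ?case
    by (intro exI[of _ "z * P + hpoly \<alpha> k z"] exI[of _ "z * Q + ?a * of_nat (Suc k) * cnj z ^ k"] conjI) simp_all
qed

lemma homogeneous_solution_has_derivative:
  assumes z: "0 < Im z"
  shows "\<exists>A. ((\<lambda>z. of_real (Im z powr (\<alpha> + 1)) * hpoly \<alpha> k z) has_derivative
    (\<lambda>h. A * h + of_real (Im z powr \<alpha>) * ((\<i> / 2 * of_real ((\<alpha> + 1 + real k) * hcoeff \<alpha> k)) * cnj z ^ k) * cnj h)) (at z)"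
proof -
  obtain P Q where PQ: "(hpoly \<alpha> k has_derivative (\<lambda>h. P * h + Q * cnj h)) (at z)"
    "of_real (\<alpha> + 1) * hpoly \<alpha> k z - (z - cnj z) * Q = of_real ((\<alpha> + 1 + real k) * hcoeff \<alpha> k) * cnj z ^ k"
    using hpoly_has_derivative by blast
  have 1: "((\<lambda>z. Im z powr (\<alpha> + 1)) has_derivative (\<lambda>h. (\<alpha> + 1) * Im z powr \<alpha> * Im h)) (at z)"
    by (rule has_derivative_eq_rhs, (rule derivative_eq_intros refl | (use z in force))+)
      (use z in \<open>auto simp: fun_eq_iff powr_diff powr_add\<close>)
  have "((\<lambda>z. of_real (Im z powr (\<alpha> + 1)) * hpoly \<alpha> k z) has_derivative
    (\<lambda>h. of_real (Im z powr (\<alpha> + 1)) * (P * h + Q * cnj h) + of_real ((\<alpha> + 1) * Im z powr \<alpha> * Im h) * hpoly \<alpha> k z)) (at z)"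
    by (intro has_derivative_mult has_derivative_of_real 1 PQ(1))
  moreover have "(\<lambda>h. of_real (Im z powr (\<alpha> + 1)) * (P * h + Q * cnj h) + of_real ((\<alpha> + 1) * Im z powr \<alpha> * Im h) * hpoly \<alpha> k z)
    = (\<lambda>h. (of_real (Im z powr (\<alpha> + 1)) * P - \<i> / 2 * of_real ((\<alpha> + 1) * Im z powr \<alpha>) * hpoly \<alpha> k z) * h +
      of_real (Im z powr \<alpha>) * ((\<i> / 2 * of_real ((\<alpha> + 1 + real k) * hcoeff \<alpha> k)) * cnj z ^ k) * cnj h)"
  proof
    fix h
    \<comment> \<open>Expresses that y has z-derivative -\<i>/2 and dbar derivative \<i>/2, the
      source of the factor \<i>/2 in the statement.\<close>
    have I: "complex_of_real (Im h) = - \<i> / 2 * h + \<i> / 2 * cnj h" by (simp add: complex_eq_iff)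
    have y: "complex_of_real (Im z powr (\<alpha> + 1)) = of_real (Im z powr \<alpha>) * (- \<i> / 2 * (z - cnj z))"
      using z by (simp add: complex_eq_iff powr_add)
    have "of_real (Im z powr (\<alpha> + 1)) * (P * h + Q * cnj h) + of_real ((\<alpha> + 1) * Im z powr \<alpha> * Im h) * hpoly \<alpha> k z
      = (of_real (Im z powr (\<alpha> + 1)) * P - \<i> / 2 * of_real ((\<alpha> + 1) * Im z powr \<alpha>) * hpoly \<alpha> k z) * h
       + of_real (Im z powr (\<alpha> + 1)) * Q * cnj h + \<i> / 2 * of_real (Im z powr \<alpha>) * (of_real (\<alpha> + 1) * hpoly \<alpha> k z) * cnj h"
      unfolding of_real_mult[of _ "Im h"] I by (simp add: algebra_simps)
    also have "of_real (Im z powr (\<alpha> + 1)) * Q * cnj h = - (\<i> / 2 * of_real (Im z powr \<alpha>) * ((z - cnj z) * Q) * cnj h)"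
      unfolding y by (simp add: field_simps)
    also have "X + - (\<i> / 2 * of_real (Im z powr \<alpha>) * ((z - cnj z) * Q) * cnj h)
        + \<i> / 2 * of_real (Im z powr \<alpha>) * (of_real (\<alpha> + 1) * hpoly \<alpha> k z) * cnj h
        = X + of_real (Im z powr \<alpha>) * ((\<i> / 2 * of_real ((\<alpha> + 1 + real k) * hcoeff \<alpha> k)) * cnj z ^ k) * cnj h" for X
    proof -
      have "X + - (e * Y * (D * Q) * t) + e * Y * w * t = X + Y * (e * (w - D * Q)) * t" for e D Y t w
        by (simp add: algebra_simps)
      from this[of "\<i> / 2" _ "z - cnj z"] show ?thesis
        unfolding mult.assoc[of "\<i> / 2" "of_real ((\<alpha> + 1 + real k) * hcoeff \<alpha> k)"] PQ(2)[symmetric] .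
    qed
    finally show "of_real (Im z powr (\<alpha> + 1)) * (P * h + Q * cnj h) + of_real ((\<alpha> + 1) * Im z powr \<alpha> * Im h) * hpoly \<alpha> k z
      = (of_real (Im z powr (\<alpha> + 1)) * P - \<i> / 2 * of_real ((\<alpha> + 1) * Im z powr \<alpha>) * hpoly \<alpha> k z) * h +
       of_real (Im z powr \<alpha>) * ((\<i> / 2 * of_real ((\<alpha> + 1 + real k) * hcoeff \<alpha> k)) * cnj z ^ k) * cnj h" .
  qed
  ultimately show ?thesis by auto
qed

section \<open>Uniqueness\<close>

text \<open>Extension by 0 to the lower half-plane is continuous, hence holomorphic across the line,
  and the identity theorem applies.\<close>

lemma holomorphic_zero_boundary_imp_zero:
  assumes hol: "f holomorphic_on {z. 0 < Im z}"
    and cont: "continuous_on {z. 0 \<le> Im z} f" and zero: "\<And>z. Im z = 0 \<Longrightarrow> f z = 0"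
    and z: "0 < Im z"
  shows "f z = 0"
proof -
  define g where "g z = (if Im z \<le> 0 then 0 else f z)" for z
  have "continuous_on UNIV g"
    unfolding g_def
    by (rule continuous_on_cases_le) (use cont zero in \<open>auto intro!: continuous_intros\<close>)
  moreover have "g holomorphic_on {z. Im z < 0}"
    by (rule holomorphic_transform[of "\<lambda>z. 0"]) (auto simp: g_def)
  moreover have "g holomorphic_on {z. 0 < Im z}"
    by (rule holomorphic_transform[OF hol]) (auto simp: g_def)
  ultimately have g: "g holomorphic_on UNIV"
    using holomorphic_on_paste_across_line[of UNIV \<i> g 0] by simp
  have "g z = 0"
    by (rule analytic_continuation_open[of "{z. Im z < 0}" UNIV g "\<lambda>z. 0"])
      (use g in \<open>auto simp: g_def open_halfspace_Im_lt intro: exI[of _ "- \<i>"]\<close>)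
  then show ?thesis using z by (simp add: g_def)
qed

context alpha_temperate
begin

text \<open>Each homogeneous solution contributes one power of cnj z to the dbar derivative, so the
  coefficients can be read off from the polynomial cnj F. The difference is then holomorphic with
  zero boundary values.\<close>

lemma u_eq_homogeneous_combination:
  "\<exists>n b. \<forall>z. 0 < Im z \<longrightarrow> u z = of_real (Im z powr (\<alpha> + 1)) * (\<Sum>k<n. b k * hpoly \<alpha> k z)"
proof -
  obtain P where P: "\<And>z. 0 < Im z \<Longrightarrow> cnj (F z) = poly P (cnj z)" using F_polynomial by blast
  define c where "c k = \<i> / 2 * of_real ((\<alpha> + 1 + real k) * hcoeff \<alpha> k)" for k
  have c0: "c k \<noteq> 0" for k
    using \<alpha> hcoeff_pos[OF \<alpha>, of k] by (auto simp: c_def simp del: of_real_add of_real_mult)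
  define n where "n = Suc (degree P)"
  define b where "b k = coeff P k / c k" for k
  define U where "U k z = of_real (Im z powr (\<alpha> + 1)) * hpoly \<alpha> k z" for k z
  \<comment> \<open>\<open>SOME\<close> turns the z-derivatives, known only to exist at each point,
    into a function of k and z that can be summed over k.\<close>
  define A where "A k z = (SOME A. (U k has_derivative
      (\<lambda>h. A * h + of_real (Im z powr \<alpha>) * (c k * cnj z ^ k) * cnj h)) (at z))" for k z
  have A: "(U k has_derivative (\<lambda>h. A k z * h + of_real (Im z powr \<alpha>) * (c k * cnj z ^ k) * cnj h)) (at z)"
    if "0 < Im z" for k z
    unfolding A_def
    by (rule someI_ex) (unfold U_def[abs_def] c_def, rule homogeneous_solution_has_derivative[OF that])
  \<comment> \<open>The values of \<open>u\<close> on the real line are arbitrary, hence the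
    explicit 0. There \<open>U k\<close> vanishes because \<open>0 powr x = 0\<close>, and its
    continuity uses \<alpha> + 1 > 0.\<close>
  define v where "v z = (if Im z = 0 then 0 else u z) - (\<Sum>k<n. b k * U k z)" for z
  have "v z = 0" if "0 < Im z" for z
  proof (rule holomorphic_zero_boundary_imp_zero[of v])
    have "continuous_on {z. 0 \<le> Im z} (U k)" for k
      unfolding U_def[abs_def] using \<alpha>
      by (intro continuous_on_mult continuous_on_of_real hpoly_cont continuous_on_powr' continuous_on_Im
          continuous_on_id continuous_on_const) auto
    then show "continuous_on {z. 0 \<le> Im z} v"
      unfolding v_def by (intro continuous_on_diff cont_ext continuous_intros)
    show "v z = 0" if "Im z = 0" for z
      using that by (simp add: v_def U_def)
    show "v holomorphic_on {z. 0 < Im z}"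
      unfolding holomorphic_on_def
    proof
      fix z assume "z \<in> {z. 0 < Im z}"
      then have z: "0 < Im z" by simp
      have "((\<lambda>z. u z - (\<Sum>k<n. b k * U k z)) has_derivative
          (\<lambda>h. (a z * h + of_real (Im z powr \<alpha>) * cnj (F z) * cnj h) -
            (\<Sum>k<n. b k * (A k z * h + of_real (Im z powr \<alpha>) * (c k * cnj z ^ k) * cnj h)))) (at z)"
        by (intro has_derivative_diff has_derivative_sum has_derivative_mult_right A deriv_u z)
      moreover have "(\<lambda>h. (a z * h + of_real (Im z powr \<alpha>) * cnj (F z) * cnj h) -
            (\<Sum>k<n. b k * (A k z * h + of_real (Im z powr \<alpha>) * (c k * cnj z ^ k) * cnj h)))
          = (\<lambda>h. (a z - (\<Sum>k<n. b k * A k z)) * h)"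
      proof
        fix h
        have "cnj (F z) = (\<Sum>k<n. coeff P k * cnj z ^ k)"
          unfolding P[OF z] poly_altdef n_def lessThan_Suc_atMost ..
        also have "\<dots> = (\<Sum>k<n. b k * (c k * cnj z ^ k))"
          by (intro sum.cong refl) (use c0 in \<open>simp add: b_def\<close>)
        finally have 1: "cnj (F z) = (\<Sum>k<n. b k * (c k * cnj z ^ k))" .
        have "(\<Sum>k<n. b k * (A k z * h + of_real (Im z powr \<alpha>) * (c k * cnj z ^ k) * cnj h))
          = (\<Sum>k<n. b k * A k z) * h + of_real (Im z powr \<alpha>) * (\<Sum>k<n. b k * (c k * cnj z ^ k)) * cnj h"
          by (simp add: sum_distrib_left sum_distrib_right sum.distrib algebra_simps)
        then show "(a z * h + of_real (Im z powr \<alpha>) * cnj (F z) * cnj h) -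
            (\<Sum>k<n. b k * (A k z * h + of_real (Im z powr \<alpha>) * (c k * cnj z ^ k) * cnj h))
          = (a z - (\<Sum>k<n. b k * A k z)) * h"
          unfolding 1 by (simp add: algebra_simps)
      qed
      ultimately have "((\<lambda>z. u z - (\<Sum>k<n. b k * U k z)) has_field_derivative (a z - (\<Sum>k<n. b k * A k z))) (at z)"
        by (simp add: has_field_derivative_def)
      then have "(v has_field_derivative (a z - (\<Sum>k<n. b k * A k z))) (at z)"
        by (rule has_field_derivative_transform_within_open[OF _ open_halfspace_Im_gt[of 0]])
          (use z in \<open>auto simp: v_def\<close>)
      then show "v field_differentiable at z within {z. 0 < Im z}"
        unfolding field_differentiable_def by (blast intro: has_field_derivative_at_within)
    qed
  qed (rule that)
  then have "u z = of_real (Im z powr (\<alpha> + 1)) * (\<Sum>k<n. b k * hpoly \<alpha> k z)" if "0 < Im z" for z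
    using that by (simp add: v_def U_def sum_distrib_left mult_ac)
  then show ?thesis by blast
qed

end

section \<open>Translation of the hypotheses on \<open>u\<close> into the locale assumptions\<close>

context alpha_boundary
begin

text \<open>The growth hypothesis concerns large \<bar>z\<bar>; on the remaining half-disc the zero
  boundary values bound \<open>u\<close>. The radius is taken at least 1 so that \<bar>z\<bar>^2 /
  Im z \<ge> 1 outside and the exponent may be rounded up.\<close>

lemma temperate_growth_imp_bound:
  assumes "temperate_growth_at_infinity u"
  shows "\<exists>C A N. \<forall>z. 0 < Im z \<longrightarrow> cmod (u z) \<le> C * (1 + cmod z) ^ A / Im z ^ N"
proof -
  obtain C R N where C: "C > 0" "R > 0" "N > 0"
    and bnd: "\<And>z. 0 < Im z \<Longrightarrow> cmod z > R \<Longrightarrow> cmod (u z) \<le> C * ((cmod z)\<^sup>2 / Im z) powr N"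
    using assms unfolding temperate_growth_at_infinity_def upper_half_plane_def by auto
  define n where "n = nat \<lceil>N\<rceil>"
  have n: "N \<le> real n" unfolding n_def by (rule real_nat_ceiling_ge)
  obtain M where M: "M \<ge> 0" "\<And>z. \<bar>Re z\<bar> \<le> max R 1 \<Longrightarrow> 0 < Im z \<Longrightarrow> Im z \<le> max R 1 \<Longrightarrow> cmod (u z) \<le> M"
    using u_bounded[of "max R 1" "max R 1"] by auto
  have "cmod (u z) \<le> (C + M) * (1 + cmod z) ^ (2 * n) / Im z ^ n" if z: "0 < Im z" for z
  proof -
    have yb: "Im z \<le> cmod z" using abs_Im_le_cmod[of z] by linarith
    let ?T = "(1 + cmod z) ^ (2 * n) / Im z ^ n"
    have T0: "0 \<le> ?T" using z by simp
    show ?thesis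
    proof (cases "cmod z > max R 1")
      case True
      have "1 * Im z \<le> cmod z * cmod z" using True yb z by (intro mult_mono) auto
      then have "1 \<le> (cmod z)\<^sup>2 / Im z" using z by (simp add: power2_eq_square)
      then have "((cmod z)\<^sup>2 / Im z) powr N \<le> ((cmod z)\<^sup>2 / Im z) powr real n"
        using n by (intro powr_mono)
      also have "\<dots> = ((cmod z)\<^sup>2 / Im z) ^ n" using z True by (intro powr_realpow divide_pos_pos) auto
      also have "\<dots> = cmod z ^ (2 * n) / Im z ^ n" by (simp add: power_divide power_mult)
      also have "\<dots> \<le> ?T" using z by (intro divide_right_mono power_mono) auto
      finally have "cmod (u z) \<le> C * ?T"
        using bnd[OF z] True C by (intro order_trans[OF bnd[OF z]] mult_left_mono) auto
      also have "\<dots> \<le> (C + M) * ?T" using M T0 by (intro mult_right_mono) auto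
      finally show ?thesis by simp
    next
      case False
      have "cmod (u z) \<le> M"
        using False abs_Re_le_cmod[of z] yb z by (intro M(2)) auto
      also have "M * 1 \<le> M * ?T"
      proof (rule mult_left_mono)
        have "Im z ^ n \<le> (1 + cmod z) ^ n" using yb z by (intro power_mono) auto
        also have "\<dots> \<le> (1 + cmod z) ^ (2 * n)" by (intro power_increasing) auto
        finally show "1 \<le> ?T" using z by simp
      qed (rule M)
      then have "M \<le> M * ?T" by simp
      also have "\<dots> \<le> (C + M) * ?T" using C T0 by (intro mult_right_mono) auto
      finally show ?thesis by simp
    qed
  qed
  then show ?thesis by blast
qed

end

text \<open>A real-linear map of the plane is determined by its values at 1 and \<i>, which the
  chain rule identifies with the two partial derivatives.\<close>

lemma has_derivative_wirtinger:
  assumes "f differentiable (at z)"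
  shows "(f has_derivative (\<lambda>h. d_z f z * h + dbar_z f z * cnj h)) (at z)"
proof -
  obtain D where D: "(f has_derivative D) (at z)" using assms unfolding differentiable_def by blast
  have "((\<lambda>t. z + of_real t * w) has_vector_derivative w) (at 0)" for w
    by (auto intro!: derivative_eq_intros has_vector_derivative_real_field)
  then have "((\<lambda>t. f (z + of_real t * w)) has_derivative (\<lambda>t. D (t *\<^sub>R w))) (at 0)" for w
    using has_derivative_compose[of "\<lambda>t. z + of_real t * w" "\<lambda>t. t *\<^sub>R w" 0 UNIV f D] D
    by (simp add: has_vector_derivative_def)
  then have "((\<lambda>t. f (z + of_real t * w)) has_vector_derivative D w) (at 0)" for w
    using linear_scale[OF has_derivative_linear[OF D]] by (simp add: has_vector_derivative_def)
  then have *: "vector_derivative (\<lambda>t. f (z + of_real t * w)) (at 0) = D w" for w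
    by (rule vector_derivative_at)
  have px: "partial_x f z = D 1" and py: "partial_y f z = D \<i>"
    using *[of 1] *[of \<i>] by (simp_all add: partial_x_def partial_y_def mult.commute)
  have "D h = d_z f z * h + dbar_z f z * cnj h" for h
  proof -
    have "D h = D (Re h *\<^sub>R 1 + Im h *\<^sub>R \<i>)" by (simp add: scaleR_conv_of_real complex_eq[symmetric] mult.commute)
    also have "\<dots> = of_real (Re h) * D 1 + of_real (Im h) * D \<i>"
      unfolding linear_add[OF has_derivative_linear[OF D]] linear_scale[OF has_derivative_linear[OF D]]
      by (simp only: scaleR_conv_of_real)
    also have "\<dots> = d_z f z * h + dbar_z f z * cnj h"
      by (simp add: d_z_def dbar_z_def px py complex_eq_iff field_simps)
    finally show ?thesis .
  qed
  then have "D = (\<lambda>h. d_z f z * h + dbar_z f z * cnj h)" by (rule ext)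
  then show ?thesis using D by simp
qed

text \<open>The function y^(-\<alpha>) dbar u is differentiable by \<open>C2_on\<close> and has
  vanishing z-derivative, so it is antiholomorphic and its conjugate is the required
  \<open>F\<close>.\<close>

lemma alpha_harmonic_imp_alpha_pair:
  assumes "alpha_harmonic \<alpha> u"
  obtains F where "alpha_pair \<alpha> u F (d_z u)"
proof -
  let ?H = "{z. 0 < Im z}"
  have H: "upper_half_plane = ?H" by (simp add: upper_half_plane_def)
  define \<phi> where "\<phi> z = of_real (Im z powr - \<alpha>) * dbar_z u z" for z
  have u1: "\<And>z. 0 < Im z \<Longrightarrow> u differentiable (at z)" "continuous_on ?H (partial_x u)" "continuous_on ?H (partial_y u)"
    and u2: "\<And>z. 0 < Im z \<Longrightarrow> partial_x u differentiable (at z)" "\<And>z. 0 < Im z \<Longrightarrow> partial_y u differentiable (at z)"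
    and L: "\<And>z. 0 < Im z \<Longrightarrow> d_z \<phi> z = 0"
    using assms unfolding alpha_harmonic_def C2_on_def C1_on_def H \<phi>_def[abs_def] by auto
  define F where "F z = cnj (\<phi> z)" for z
  have "alpha_pair \<alpha> u F (d_z u)"
  proof
    show "continuous_on ?H (d_z u)"
      unfolding d_z_def[abs_def] by (intro continuous_intros u1) simp
    show "F holomorphic_on ?H"
      unfolding holomorphic_on_def
    proof
      fix z assume "z \<in> ?H"
      then have z: "0 < Im z" by simp
      have "(\<lambda>w. complex_of_real (Im w powr - \<alpha>)) differentiable (at z)"
        unfolding differentiable_def
        by (rule exI, (rule derivative_eq_intros refl | (use z in force))+)
      then have "\<phi> differentiable (at z)"
        unfolding \<phi>_def[abs_def] dbar_z_def[abs_def] divide_inverse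
        by (intro differentiable_mult differentiable_add u2 z differentiable_const)
      from has_derivative_wirtinger[OF this]
      have "(\<phi> has_derivative (\<lambda>h. dbar_z \<phi> z * cnj h)) (at z)" using L[OF z] by simp
      from bounded_linear.has_derivative[OF bounded_linear_cnj this]
      have "(F has_field_derivative cnj (dbar_z \<phi> z)) (at z)"
        by (simp add: F_def[abs_def] has_field_derivative_def)
      then show "F field_differentiable at z within ?H"
        unfolding field_differentiable_def by (blast intro: has_field_derivative_at_within)
    qed
    fix z assume z: "0 < Im z"
    have "of_real (Im z powr \<alpha>) * cnj (F z) = (of_real (Im z powr \<alpha> * Im z powr - \<alpha>)) * dbar_z u z"
      by (simp add: F_def \<phi>_def)
    also have "Im z powr \<alpha> * Im z powr - \<alpha> = 1" using z by (simp flip: powr_add)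
    finally have "of_real (Im z powr \<alpha>) * cnj (F z) = dbar_z u z" by simp
    then show "(u has_derivative (\<lambda>h. d_z u z * h + of_real (Im z powr \<alpha>) * cnj (F z) * cnj h)) (at z)"
      using has_derivative_wirtinger[OF u1(1)[OF z]] by simp
  qed
  then show ?thesis by (rule that)
qed

theorem theorem1p1:
  fixes \<alpha> :: real and u :: "complex \<Rightarrow> complex"
  assumes "\<alpha> > -1" and "\<alpha> \<noteq> 0"
    and "alpha_harmonic \<alpha> u"
    and "temperate_growth_at_infinity u"
    and "\<And>x::real. (u \<longlongrightarrow> 0) (at (of_real x) within upper_half_plane)"
    and "\<exists>zs :: nat \<Rightarrow> complex. (\<forall>j. zs j \<in> upper_half_plane) \<and>
           filterlim zs at_infinity sequentially \<and>
           (\<lambda>j. u (zs j) / of_real (Im (zs j) powr (\<alpha> + 1))) \<longlonglongrightarrow> 0"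
  shows "\<forall>z\<in>upper_half_plane. u z = 0"
proof -
  have H: "upper_half_plane = {z. 0 < Im z}" by (simp add: upper_half_plane_def)
  obtain F where "alpha_pair \<alpha> u F (d_z u)"
    using alpha_harmonic_imp_alpha_pair[OF assms(3)] .
  then interpret alpha_boundary \<alpha> u F "d_z u"
    using assms(1,5) by (intro alpha_boundary.intro alpha_boundary_axioms.intro) (auto simp: H)
  interpret alpha_temperate \<alpha> u F "d_z u"
    by unfold_locales (rule temperate_growth_imp_bound[OF assms(4)])
  obtain n b where ub: "\<And>z. 0 < Im z \<Longrightarrow> u z = of_real (Im z powr (\<alpha> + 1)) * (\<Sum>k<n. b k * hpoly \<alpha> k z)"
    using u_eq_homogeneous_combination by blast
  obtain zs where zs: "\<And>j. 0 < Im (zs j)" "filterlim zs at_infinity sequentially"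
    "(\<lambda>j. u (zs j) / of_real (Im (zs j) powr (\<alpha> + 1))) \<longlonglongrightarrow> 0"
    using assms(6) by (auto simp: H)
  \<comment> \<open>Division by y^(\<alpha>+1) removes exactly the common factor, so the hypothesis
    on the sequence becomes a statement about the polynomial combination.\<close>
  have "u (zs j) / of_real (Im (zs j) powr (\<alpha> + 1)) = (\<Sum>k<n. b k * hpoly \<alpha> k (zs j))" for j
    using zs(1)[of j] by (simp add: ub)
  then have "\<forall>k<n. b k = 0"
    using hpoly_combination_zero[OF assms(1,2) zs(2)] zs(3) by simp
  then show ?thesis by (simp add: H ub)
qed

end
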